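(* Let $\mathcal C$ be a dagger category whose objects are orthosets of at most countable rank, whose morphisms are maps between them, and whose dagger assigns to each morphism an adjoint of it, and assume that $\mathcal C$ contains an orthoset of non-zero rank. Assume that: (H1) $\mathcal C$ has dagger biproducts. (H2) For every $X\in\mathcal C$ and every subspace $A$ of $X$, the orthosets $A$, $A^\perp$ and the inclusion maps $\iota_A\colon A\to X$, $\iota_{A^\perp}\colon A^\perp\to X$ belong to $\mathcal C$, and $A\xrightarrow{\iota_A}X\xleftarrow{\iota_{A^\perp}}A^\perp$ is a dagger biproduct of $A$ and $A^\perp$. (H3) (a) Any unital orthoset in $\mathcal C$ is dagger simple. (b) Any two unital orthosets in $\mathcal C$ are dagger isomorphic. Then for each $X\in\mathcal C$ of rank $n$ there are an $n$-dimensional uniform orthomodular space $H$ and an orthoisomorphism between $P(X)$ and $P(H)$. Moreover, let $h\colon X_1\to X_2$ be an isometry in $\mathcal C$. Then there are uniform orthomodular spaces $H_1$ and $H_2$ such that $H_1$ is a subspace of $H_2$, and orthoisomorphisms $r_1\colon P(X_1)\to P(H_1)$ and $r_2\colon P(X_2)\to P(H_2)$ such that $$r_2\circ P(h)=P(\iota_{H_1})\circ r_1,$$ where $\iota_{H_1}\colon H_1\to H_2$ is the inclusion map.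
   Context: Orthosets: An orthoset is a non-empty set $X$ with a binary relation $\perp$ and a constant $0\in X$ such that $x\perp y$ implies $y\perp x$, $x\perp x$ only if $x=0$, and $0\perp x$ for all $x\in X$. An element $\neq 0$ is called proper. For $A\subseteq X$ put $A^\perp=\{x\in X: x\perp y\text{ for all }y\in A\}$; $A$ is orthoclosed if $A^{\perp\perp}=A$. A subspace of $X$ is an orthoclosed subset with the restricted relation and the same $0$ (again an orthoset). The rank of $X$ is the supremum of the cardinalities of sets of mutually orthogonal proper elements. $X$ is unital if there is a proper $z\in X$ such that no proper element of $X$ is orthogonal to $z$. A map $g\colon Y\to X$ is an adjoint of $f\colon X\to Y$ if for all $x\in X,y\in Y$: $f(x)\perp y$ iff $x\perp g(y)$. Write $x\parallel y$ if $\{x\}^\perp=\{y\}^\perp$, $[x]$ for the $\parallel$-class of $x$, and $P(X)=\{[x]:x\in X\}$, an orthoset with $[x]\perp[y]$ iff $x\perp y$ and constant $[0]$. A map $f\colon X\to Y$ possessing an adjoint preserves $\parallel$ and induces $P(f)\colon P(X)\to P(Y)$, $[x]\mapsto[f(x)]$. An orthoisomorphism is a bijection between orthosets preserving and reflecting $\perp$. Dagger categories: A dagger on a category is an involutive functor $^\ast\colon\mathcal C^{op}\to\mathcal C$ that is the identity on objects. A morphism $f\colon A\to B$ is an isometry (dagger monomorphism) if $f^\ast\circ f=\mathrm{id}_A$, a dagger isomorphism if moreover $f\circ f^\ast=\mathrm{id}_B$. If there is a zero object $0$, the zero map $0_{A,B}\colon A\to B$ is the unique morphism factoring through $0$. A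 dagger biproduct of $A,B$ is a coproduct $A\xrightarrow{\iota_A}A\oplus B\xleftarrow{\iota_B}B$ with $\iota_A,\iota_B$ dagger monomorphisms and $\iota_B^\ast\circ\iota_A=0_{A,B}$. "$\mathcal C$ has dagger biproducts" means that $\mathcal C$ has a zero object and every pair of objects has a dagger biproduct. An object $X$ is dagger simple if it is non-zero and any dagger monomorphism from a non-zero object to $X$ is a dagger isomorphism. Orthomodular spaces: A $\ast$-sfield is a skew field with an involutory antiautomorphism $^\ast$. A Hermitian space over a $\ast$-sfield $F$ is a (left) linear space $H$ over $F$ with a map $(\cdot,\cdot)\colon H\times H\to F$ that is linear in the first argument, satisfies $(w,\alpha u+\beta v)=(w,u)\alpha^\ast+(w,v)\beta^\ast$ and $(u,v)=(v,u)^\ast$, and is anisotropic ($(u,u)=0$ implies $u=0$); it is an orthoset with $u\perp v$ iff $(u,v)=0$ and constant the zero vector, and is assumed to contain at most countably many pairwise orthogonal non-zero vectors. Its dimension is the cardinality of any maximal set of pairwise orthogonal non-zero vectors. A subspace of $H$ is an orthoclosed subset with the restricted linear structure and form. $H$ is orthomodular if $H=S+S^\perp$ for every subspace $S$, and uniform if each $1$-dimensional subspace contains a vector $u$ with $(u,u)=1$. *)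

theory Defs
  imports
    "HOL-Algebra.Module"
    "HOL-Algebra.AbelCoset"
    "HOL-Library.FuncSet"
    "HOL-Library.Countable_Set"
    "HOL-Library.Extended_Nat"
begin

section \<open>Orthosets\<close>

record 'a orthoset = "'a partial_object" +
  perp :: "('a \<times> 'a) set"
  origin :: 'a

abbreviation orth :: "'a orthoset \<Rightarrow> 'a \<Rightarrow> 'a \<Rightarrow> bool" (infix "\<perp>\<index>" 50)
  where "orth X x y \<equiv> (x, y) \<in> perp X"

(* The relation lives on the carrier only, so that equality of records is equality of orthosets. *)
locale orthoset =
  fixes X :: "'a orthoset" (structure)
  assumes origin_closed: "origin X \<in> carrier X"
    and perp_closed: "perp X \<subseteq> carrier X \<times> carrier X"
    and perp_sym: "x \<perp> y \<Longrightarrow> y \<perp> x"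
    and perp_self: "x \<perp> x \<Longrightarrow> x = origin X"
    and origin_perp: "x \<in> carrier X \<Longrightarrow> origin X \<perp> x"

definition proper :: "'a orthoset \<Rightarrow> 'a \<Rightarrow> bool"
  where "proper X x \<longleftrightarrow> x \<in> carrier X \<and> x \<noteq> origin X"

definition ocomp :: "'a orthoset \<Rightarrow> 'a set \<Rightarrow> 'a set"
  where "ocomp X A = {x \<in> carrier X. \<forall>y\<in>A. x \<perp>\<^bsub>X\<^esub> y}"

definition orthoclosed :: "'a orthoset \<Rightarrow> 'a set \<Rightarrow> bool"
  where "orthoclosed X A \<longleftrightarrow> A \<subseteq> carrier X \<and> ocomp X (ocomp X A) = A"

definition restr :: "'a orthoset \<Rightarrow> 'a set \<Rightarrow> 'a orthoset"
  where "restr X A = \<lparr>carrier = A, perp = perp X \<inter> A \<times> A, origin = origin X\<rparr>"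

definition orthogonal_set :: "'a orthoset \<Rightarrow> 'a set \<Rightarrow> bool"
  where "orthogonal_set X D \<longleftrightarrow> (\<forall>x\<in>D. proper X x) \<and> pairwise (orth X) D"

definition maximal_orthogonal_set :: "'a orthoset \<Rightarrow> 'a set \<Rightarrow> bool"
  where "maximal_orthogonal_set X D \<longleftrightarrow>
    orthogonal_set X D \<and> (\<forall>E. orthogonal_set X E \<and> D \<subseteq> E \<longrightarrow> E = D)"

definition countable_rank :: "'a orthoset \<Rightarrow> bool"
  where "countable_rank X \<longleftrightarrow> (\<forall>D. orthogonal_set X D \<longrightarrow> countable D)"

(* Cardinality of a countable set, with \<infinity> for aleph_0. Ranks and dimensions are taken in enat,
   which is adequate because they are only used where countable_rank holds. *)
definition ecard :: "'a set \<Rightarrow> enat"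
  where "ecard D = (if finite D then enat (card D) else \<infinity>)"

definition orank :: "'a orthoset \<Rightarrow> enat"
  where "orank X = (SUP D \<in> {D. orthogonal_set X D}. ecard D)"

definition unital :: "'a orthoset \<Rightarrow> bool"
  where "unital X \<longleftrightarrow> (\<exists>z. proper X z \<and> \<not> (\<exists>x. proper X x \<and> x \<perp>\<^bsub>X\<^esub> z))"

definition is_adjoint :: "'a orthoset \<Rightarrow> 'b orthoset \<Rightarrow> ('a \<Rightarrow> 'b) \<Rightarrow> ('b \<Rightarrow> 'a) \<Rightarrow> bool"
  where "is_adjoint X Y f g \<longleftrightarrow>
    (\<forall>x\<in>carrier X. \<forall>y\<in>carrier Y. f x \<perp>\<^bsub>Y\<^esub> y \<longleftrightarrow> x \<perp>\<^bsub>X\<^esub> g y)"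

definition parallel :: "'a orthoset \<Rightarrow> 'a \<Rightarrow> 'a \<Rightarrow> bool"
  where "parallel X x y \<longleftrightarrow> ocomp X {x} = ocomp X {y}"

definition pclass :: "'a orthoset \<Rightarrow> 'a \<Rightarrow> 'a set"
  where "pclass X x = {y \<in> carrier X. parallel X x y}"

definition proj_orthoset :: "'a orthoset \<Rightarrow> 'a set orthoset"
  where "proj_orthoset X =
    \<lparr>carrier = pclass X ` carrier X,
     perp = {(pclass X x, pclass X y) | x y. x \<perp>\<^bsub>X\<^esub> y},
     origin = pclass X (origin X)\<rparr>"

(* The induced map [x] |-> [f x]; the_elem is meaningful when f preserves parallelism,
   in particular when f possesses an adjoint. *)
definition proj_map :: "'a orthoset \<Rightarrow> 'b orthoset \<Rightarrow> ('a \<Rightarrow> 'b) \<Rightarrow> 'a set \<Rightarrow> 'b set"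
  where "proj_map X Y f = (\<lambda>c\<in>carrier (proj_orthoset X). the_elem ((\<lambda>x. pclass Y (f x)) ` c))"

definition orthoisomorphism :: "'a orthoset \<Rightarrow> 'b orthoset \<Rightarrow> ('a \<Rightarrow> 'b) \<Rightarrow> bool"
  where "orthoisomorphism X Y f \<longleftrightarrow> bij_betw f (carrier X) (carrier Y) \<and>
    (\<forall>x\<in>carrier X. \<forall>y\<in>carrier X. x \<perp>\<^bsub>X\<^esub> y \<longleftrightarrow> f x \<perp>\<^bsub>Y\<^esub> f y)"


section \<open>Dagger categories of orthosets\<close>

(* Morphisms X \<rightarrow> Y are functions, extensional on the carrier of X; composition is composition of
   maps. Domain and codomain are carried as indices of Hom and Dag. *)
record 'a orthocat =
  Obj :: "'a orthoset set"
  Hom :: "'a orthoset \<Rightarrow> 'a orthoset \<Rightarrow> ('a \<Rightarrow> 'a) set"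
  Dag :: "'a orthoset \<Rightarrow> 'a orthoset \<Rightarrow> ('a \<Rightarrow> 'a) \<Rightarrow> 'a \<Rightarrow> 'a"

definition incl :: "'a set \<Rightarrow> 'a \<Rightarrow> 'a"
  where "incl A = (\<lambda>x\<in>A. x)"

abbreviation ident :: "'a orthoset \<Rightarrow> 'a \<Rightarrow> 'a"
  where "ident X \<equiv> incl (carrier X)"

locale dagger_orthocat =
  fixes C :: "'a orthocat"
  assumes obj_orthoset: "X \<in> Obj C \<Longrightarrow> orthoset X"
    and obj_countable_rank: "X \<in> Obj C \<Longrightarrow> countable_rank X"
    and hom_maps: "\<lbrakk>X \<in> Obj C; Y \<in> Obj C\<rbrakk> \<Longrightarrow> Hom C X Y \<subseteq> carrier X \<rightarrow>\<^sub>E carrier Y"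
    and hom_ident: "X \<in> Obj C \<Longrightarrow> ident X \<in> Hom C X X"
    and hom_compose:
      "\<lbrakk>X \<in> Obj C; Y \<in> Obj C; Z \<in> Obj C; f \<in> Hom C X Y; g \<in> Hom C Y Z\<rbrakk>
        \<Longrightarrow> compose (carrier X) g f \<in> Hom C X Z"
    and dag_hom: "\<lbrakk>X \<in> Obj C; Y \<in> Obj C; f \<in> Hom C X Y\<rbrakk> \<Longrightarrow> Dag C X Y f \<in> Hom C Y X"
    and dag_ident: "X \<in> Obj C \<Longrightarrow> Dag C X X (ident X) = ident X"
    and dag_compose:
      "\<lbrakk>X \<in> Obj C; Y \<in> Obj C; Z \<in> Obj C; f \<in> Hom C X Y; g \<in> Hom C Y Z\<rbrakk>
        \<Longrightarrow> Dag C X Z (compose (carrier X) g f) = compose (carrier Z) (Dag C X Y f) (Dag C Y Z g)"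
    and dag_dag:
      "\<lbrakk>X \<in> Obj C; Y \<in> Obj C; f \<in> Hom C X Y\<rbrakk> \<Longrightarrow> Dag C Y X (Dag C X Y f) = f"
    and dag_adjoint:
      "\<lbrakk>X \<in> Obj C; Y \<in> Obj C; f \<in> Hom C X Y\<rbrakk> \<Longrightarrow> is_adjoint X Y f (Dag C X Y f)"

definition isometry :: "'a orthocat \<Rightarrow> 'a orthoset \<Rightarrow> 'a orthoset \<Rightarrow> ('a \<Rightarrow> 'a) \<Rightarrow> bool"
  where "isometry C X Y f \<longleftrightarrow>
    f \<in> Hom C X Y \<and> compose (carrier X) (Dag C X Y f) f = ident X"

definition dagger_iso :: "'a orthocat \<Rightarrow> 'a orthoset \<Rightarrow> 'a orthoset \<Rightarrow> ('a \<Rightarrow> 'a) \<Rightarrow> bool"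
  where "dagger_iso C X Y f \<longleftrightarrow>
    isometry C X Y f \<and> compose (carrier Y) f (Dag C X Y f) = ident Y"

definition zero_object :: "'a orthocat \<Rightarrow> 'a orthoset \<Rightarrow> bool"
  where "zero_object C Z \<longleftrightarrow> Z \<in> Obj C \<and>
    (\<forall>X\<in>Obj C. (\<exists>!f. f \<in> Hom C X Z) \<and> (\<exists>!f. f \<in> Hom C Z X))"

definition zero_map :: "'a orthocat \<Rightarrow> 'a orthoset \<Rightarrow> 'a orthoset \<Rightarrow> ('a \<Rightarrow> 'a) \<Rightarrow> bool"
  where "zero_map C X Y f \<longleftrightarrow>
    (\<exists>Z g h. zero_object C Z \<and> g \<in> Hom C X Z \<and> h \<in> Hom C Z Y \<and> f = compose (carrier X) h g)"

definition coproduct ::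
    "'a orthocat \<Rightarrow> 'a orthoset \<Rightarrow> 'a orthoset \<Rightarrow> 'a orthoset \<Rightarrow> ('a \<Rightarrow> 'a) \<Rightarrow> ('a \<Rightarrow> 'a) \<Rightarrow> bool"
  where "coproduct C A B S i j \<longleftrightarrow>
    S \<in> Obj C \<and> i \<in> Hom C A S \<and> j \<in> Hom C B S \<and>
    (\<forall>Y\<in>Obj C. \<forall>f\<in>Hom C A Y. \<forall>g\<in>Hom C B Y.
      \<exists>!h. h \<in> Hom C S Y \<and> compose (carrier A) h i = f \<and> compose (carrier B) h j = g)"

definition dagger_biproduct ::
    "'a orthocat \<Rightarrow> 'a orthoset \<Rightarrow> 'a orthoset \<Rightarrow> 'a orthoset \<Rightarrow> ('a \<Rightarrow> 'a) \<Rightarrow> ('a \<Rightarrow> 'a) \<Rightarrow> bool"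
  where "dagger_biproduct C A B S i j \<longleftrightarrow>
    coproduct C A B S i j \<and> isometry C A S i \<and> isometry C B S j \<and>
    zero_map C A B (compose (carrier A) (Dag C B S j) i)"

definition has_dagger_biproducts :: "'a orthocat \<Rightarrow> bool"
  where "has_dagger_biproducts C \<longleftrightarrow> (\<exists>Z. zero_object C Z) \<and>
    (\<forall>A\<in>Obj C. \<forall>B\<in>Obj C. \<exists>S i j. dagger_biproduct C A B S i j)"

definition dagger_simple :: "'a orthocat \<Rightarrow> 'a orthoset \<Rightarrow> bool"
  where "dagger_simple C X \<longleftrightarrow> X \<in> Obj C \<and> \<not> zero_object C X \<and>
    (\<forall>Y\<in>Obj C. \<forall>f. \<not> zero_object C Y \<and> isometry C Y X f \<longrightarrow> dagger_iso C Y X f)"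


section \<open>Orthomodular spaces\<close>

record 'f star_ring = "'f ring" +
  star :: "'f \<Rightarrow> 'f"

locale star_sfield = ring F for F :: "'f star_ring" (structure) +
  assumes units: "Units F = carrier F - {\<zero>}"
    and star_closed: "a \<in> carrier F \<Longrightarrow> star F a \<in> carrier F"
    and star_add: "\<lbrakk>a \<in> carrier F; b \<in> carrier F\<rbrakk> \<Longrightarrow> star F (a \<oplus> b) = star F a \<oplus> star F b"
    and star_mult: "\<lbrakk>a \<in> carrier F; b \<in> carrier F\<rbrakk> \<Longrightarrow> star F (a \<otimes> b) = star F b \<otimes> star F a"
    and star_star: "a \<in> carrier F \<Longrightarrow> star F (star F a) = a"

(* As for the library's modules, the fields mult and one of the space are unused. *)
record ('f, 'v) form_space = "('f, 'v) module" +
  form :: "'v \<Rightarrow> 'v \<Rightarrow> 'f"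

definition orthoset_of :: "('f, 'v) form_space \<Rightarrow> 'f star_ring \<Rightarrow> 'v orthoset"
  where "orthoset_of H F =
    \<lparr>carrier = carrier H,
     perp = {(u, v). u \<in> carrier H \<and> v \<in> carrier H \<and> form H u v = \<zero>\<^bsub>F\<^esub>},
     origin = \<zero>\<^bsub>H\<^esub>\<rparr>"

(* The library's locale module demands a commutative ring of scalars, hence the explicit axioms. *)
locale hermitian_space = F?: star_sfield F + H?: abelian_group H
  for F :: "'f star_ring" (structure) and H :: "('f, 'v) form_space" (structure) +
  assumes smult_closed:
      "\<lbrakk>a \<in> carrier F; u \<in> carrier H\<rbrakk> \<Longrightarrow> a \<odot>\<^bsub>H\<^esub> u \<in> carrier H"
    and smult_l_distr:
      "\<lbrakk>a \<in> carrier F; b \<in> carrier F; u \<in> carrier H\<rbrakk>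
        \<Longrightarrow> (a \<oplus>\<^bsub>F\<^esub> b) \<odot>\<^bsub>H\<^esub> u = a \<odot>\<^bsub>H\<^esub> u \<oplus>\<^bsub>H\<^esub> b \<odot>\<^bsub>H\<^esub> u"
    and smult_r_distr:
      "\<lbrakk>a \<in> carrier F; u \<in> carrier H; v \<in> carrier H\<rbrakk>
        \<Longrightarrow> a \<odot>\<^bsub>H\<^esub> (u \<oplus>\<^bsub>H\<^esub> v) = a \<odot>\<^bsub>H\<^esub> u \<oplus>\<^bsub>H\<^esub> a \<odot>\<^bsub>H\<^esub> v"
    and smult_assoc:
      "\<lbrakk>a \<in> carrier F; b \<in> carrier F; u \<in> carrier H\<rbrakk>
        \<Longrightarrow> (a \<otimes>\<^bsub>F\<^esub> b) \<odot>\<^bsub>H\<^esub> u = a \<odot>\<^bsub>H\<^esub> (b \<odot>\<^bsub>H\<^esub> u)"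
    and smult_one: "u \<in> carrier H \<Longrightarrow> \<one>\<^bsub>F\<^esub> \<odot>\<^bsub>H\<^esub> u = u"
    and form_closed: "\<lbrakk>u \<in> carrier H; v \<in> carrier H\<rbrakk> \<Longrightarrow> form H u v \<in> carrier F"
    and form_left:
      "\<lbrakk>a \<in> carrier F; b \<in> carrier F; u \<in> carrier H; v \<in> carrier H; w \<in> carrier H\<rbrakk>
        \<Longrightarrow> form H (a \<odot>\<^bsub>H\<^esub> u \<oplus>\<^bsub>H\<^esub> b \<odot>\<^bsub>H\<^esub> v) w =
          a \<otimes>\<^bsub>F\<^esub> form H u w \<oplus>\<^bsub>F\<^esub> b \<otimes>\<^bsub>F\<^esub> form H v w"
    and form_right:
      "\<lbrakk>a \<in> carrier F; b \<in> carrier F; u \<in> carrier H; v \<in> carrier H; w \<in> carrier H\<rbrakk>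
        \<Longrightarrow> form H w (a \<odot>\<^bsub>H\<^esub> u \<oplus>\<^bsub>H\<^esub> b \<odot>\<^bsub>H\<^esub> v) =
          form H w u \<otimes>\<^bsub>F\<^esub> star F a \<oplus>\<^bsub>F\<^esub> form H w v \<otimes>\<^bsub>F\<^esub> star F b"
    and form_symmetric:
      "\<lbrakk>u \<in> carrier H; v \<in> carrier H\<rbrakk> \<Longrightarrow> form H u v = star F (form H v u)"
    and anisotropic: "\<lbrakk>u \<in> carrier H; form H u u = \<zero>\<^bsub>F\<^esub>\<rbrakk> \<Longrightarrow> u = \<zero>\<^bsub>H\<^esub>"
    and countably_many_orthogonal: "countable_rank (orthoset_of H F)"

definition has_dim :: "('f, 'v) form_space \<Rightarrow> 'f star_ring \<Rightarrow> enat \<Rightarrow> bool"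
  where "has_dim H F n \<longleftrightarrow> (\<forall>D. maximal_orthogonal_set (orthoset_of H F) D \<longrightarrow> ecard D = n)"

definition is_subspace ::
    "('f, 'v) form_space \<Rightarrow> ('f, 'v) form_space \<Rightarrow> 'f star_ring \<Rightarrow> bool"
  where "is_subspace S H F \<longleftrightarrow>
    orthoclosed (orthoset_of H F) (carrier S) \<and> S = H\<lparr>carrier := carrier S\<rparr>"

locale orthomodular_space = hermitian_space +
  assumes orthomodular:
    "orthoclosed (orthoset_of H F) S \<Longrightarrow> carrier H = S <+>\<^bsub>H\<^esub> ocomp (orthoset_of H F) S"

(* The statement has to name types for the scalars and the vectors of the spaces it asserts to
   exist; it takes the type 'a of the elements of the orthosets for both. This is no restriction:
   with U unital, adding a fixed unit vector of a complement embeds H into the projective space of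
   the biproduct of X and U, and likewise F into that of U and U, so F and H have isomorphic
   copies on subsets of 'a. *)
locale uniform_orthomodular_space = orthomodular_space +
  assumes uniform:
    "\<lbrakk>is_subspace S H F; has_dim S F 1\<rbrakk> \<Longrightarrow> \<exists>u\<in>carrier S. form H u u = \<one>\<^bsub>F\<^esub>"

end

theory Submission
  imports Defs
begin

text \<open>Fix a unital object \<open>U\<close> and a proper element \<open>e\<close> of it; one exists because
\<open>{x}\<^sup>\<bottom>\<^sup>\<bottom>\<close> is a unital subspace for each proper \<open>x\<close>. The idea is to use the morphisms
\<open>U \<rightarrow> X\<close> as vectors and the endomorphisms of \<open>U\<close> as scalars. Biproducts provide an addition that
is bilinear for composition and respected by the dagger; \<open>g\<^sup>\<dagger> \<cdot> f\<close> is a Hermitian form with values in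
the scalars; and \<open>f e \<bottom> g e\<close> holds precisely if \<open>g\<^sup>\<dagger> \<cdot> f = 0\<close>, since a unital object in the category
contains no two orthogonal proper elements. By dagger simplicity and the uniqueness of unital
objects, each line of \<open>X\<close> is the closure of the image of an isometry \<open>v : U \<rightarrow> X\<close>, and \<open>v \<cdot> v\<^sup>\<dagger>\<close> fixes
every vector lying on that line (lemma \<open>line_isometry\<close>). Hence \<open>f \<mapsto> f e\<close> meets every line of \<open>X\<close>.

The biproduct \<open>U \<oplus> U\<close> supplies the arithmetic. A vector orthogonal to \<open>(f, g)\<close> is a linear relation
between \<open>f\<close> and \<open>g\<close> whose coefficients do not both vanish (lemma \<open>annihilator\<close>). For \<open>f = g = 1\<close> this
yields the scalar \<open>-1\<close>; for nonzero \<open>f\<close> and \<open>g\<close> it yields the Ore condition (lemma \<open>ore\<close>).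

The scalars form a domain but in general not a skew field: for example, if \<open>V\<close> is the ring of
finite elements of a non-archimedean real closed field, the orthoclosed submodules of the modules
\<open>V\<^sup>n\<close> with the standard form satisfy the hypotheses, and the scalars are \<open>V\<close>. The space \<open>H\<close> is
therefore built from fractions \<open>f / c\<close> of a vector \<open>f\<close> by a nonzero scalar \<open>c\<close>, and the
skew field is the case \<open>X = U\<close>. All laws are verified by passing to suitable representatives:
common denominators for the addition, the Ore condition for scaling and for the form. A fraction is
encoded by a point of the biproduct of \<open>X\<close> and \<open>U\<close>, namely by the line through \<open>(f, c)\<close>, which
keeps \<open>H\<close> inside the type of the elements of the orthosets.

Passing to fractions does not change lines, so \<open>P(H)\<close> is \<open>P(X)\<close>, and orthoclosed sets of
\<open>H\<close> correspond to those of \<open>X\<close>. Orthomodularity is the identity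
\<open>\<iota>\<^sub>A \<cdot> \<iota>\<^sub>A\<^sup>\<dagger> + \<iota>\<^sub>B \<cdot> \<iota>\<^sub>B\<^sup>\<dagger> = 1\<close> with \<open>B = A\<^sup>\<bottom>\<close>; uniformity is the existence of the isometries \<open>v\<close>
above. That the rank is the dimension needs that maximal orthogonal sets of a Hermitian space are of
the same size; this is proved with chains of linear subspaces, of which the orthogonal complement
of one vector can collapse at most one step.

An isometry \<open>h : X \<rightarrow> Y\<close> acts on vectors by composition. Because the vectors form a group, \<open>h \<cdot> h\<^sup>\<dagger>\<close>
fixes all vectors that lie in the closure of the image of \<open>h\<close>, so the fractions with numerator
\<open>h \<cdot> f\<close> form a subspace of the space that represents \<open>Y\<close>, and this subspace represents \<open>X\<close>.\<close>
section \<open>Orthosets and maps between them\<close>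

context orthoset
begin

lemma ocomp_antimono: "A \<subseteq> B \<Longrightarrow> ocomp X B \<subseteq> ocomp X A"
  by (auto simp: ocomp_def)

lemma ocomp_subset: "ocomp X A \<subseteq> carrier X"
  by (auto simp: ocomp_def)

lemma subset_ocomp_ocomp: "A \<subseteq> carrier X \<Longrightarrow> A \<subseteq> ocomp X (ocomp X A)"
  by (auto simp: ocomp_def intro: perp_sym)

lemma ocomp3: "A \<subseteq> carrier X \<Longrightarrow> ocomp X (ocomp X (ocomp X A)) = ocomp X A"
  by (meson ocomp_antimono ocomp_subset subset_antisym subset_ocomp_ocomp)

lemma orthoclosed_ocomp: "A \<subseteq> carrier X \<Longrightarrow> orthoclosed X (ocomp X A)"
  by (simp add: orthoclosed_def ocomp_subset ocomp3)

lemma perp_origin: "x \<in> carrier X \<Longrightarrow> x \<perp> origin X"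
  using origin_perp perp_sym by blast

lemma origin_in_ocomp: "A \<subseteq> carrier X \<Longrightarrow> origin X \<in> ocomp X A"
  by (auto simp: ocomp_def origin_closed origin_perp)

lemma ocomp_carrier: "ocomp X (carrier X) = {origin X}"
  using origin_closed origin_perp perp_self by (auto simp: ocomp_def)

lemma perp_carrier: "x \<perp> y \<Longrightarrow> x \<in> carrier X \<and> y \<in> carrier X"
  using perp_closed by auto

lemma perp_all_origin: "x \<in> carrier X \<Longrightarrow> (\<And>y. y \<in> carrier X \<Longrightarrow> x \<perp> y) \<Longrightarrow> x = origin X"
  using perp_self by blast

lemma orthoclosed_origin: "orthoclosed X {origin X}"
  by (metis ocomp_carrier order_refl orthoclosed_ocomp)

lemma parallel_perp: "parallel X x y \<Longrightarrow> z \<perp> x \<longleftrightarrow> z \<perp> y"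
  using perp_carrier by (auto simp: parallel_def ocomp_def set_eq_iff)

lemma parallel_perp': "parallel X x y \<Longrightarrow> x \<perp> z \<longleftrightarrow> y \<perp> z"
  using parallel_perp perp_sym by blast

lemma parallelI:
  "(\<And>z. z \<in> carrier X \<Longrightarrow> z \<perp> x \<longleftrightarrow> z \<perp> y) \<Longrightarrow> parallel X x y"
  by (auto simp: parallel_def ocomp_def)

lemma restr_orthoset:
  assumes "A \<subseteq> carrier X" "origin X \<in> A" shows "orthoset (restr X A)"
  using assms by unfold_locales
    (auto simp: restr_def intro: perp_sym perp_self origin_perp)

lemma orthoclosed_subset: "orthoclosed X A \<Longrightarrow> A \<subseteq> carrier X"
  by (simp add: orthoclosed_def)

lemma origin_in_orthoclosed: "orthoclosed X A \<Longrightarrow> origin X \<in> A"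
  by (metis ocomp_subset origin_in_ocomp orthoclosed_def)

end

lemma parallel_refl [simp]: "parallel X x x"
  by (simp add: parallel_def)

lemma parallel_sym: "parallel X x y \<Longrightarrow> parallel X y x"
  by (simp add: parallel_def)

lemma pclass_eq_iff:
  "y \<in> carrier X \<Longrightarrow> pclass X x = pclass X y \<longleftrightarrow> parallel X x y"
  unfolding pclass_def parallel_def by auto

lemma restr_simps [simp]:
  "carrier (restr X A) = A" "origin (restr X A) = origin X"
  "orth (restr X A) x y \<longleftrightarrow> orth X x y \<and> x \<in> A \<and> y \<in> A"
  by (auto simp: restr_def)

lemma (in orthoset) orthoclosed_parallel:
  "orthoclosed X A \<Longrightarrow> x \<in> A \<Longrightarrow> y \<in> carrier X \<Longrightarrow> parallel X x y \<Longrightarrow> y \<in> A"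
proof -
  assume A: "orthoclosed X A" "x \<in> A" "y \<in> carrier X" "parallel X x y"
  have "y \<perp> z" if "z \<in> ocomp X A" for z
    using that A(2) parallel_perp'[OF A(4)] perp_sym by (auto simp: ocomp_def)
  then have "y \<in> ocomp X (ocomp X A)"
    using A(3) by (simp add: ocomp_def[of X "ocomp X A"])
  then show "y \<in> A" using A by (simp add: orthoclosed_def)
qed

text \<open>In \<open>{x}\<^sup>\<bottom>\<^sup>\<bottom>\<close> an element orthogonal to \<open>x\<close> lies in a set and in its complement.\<close>
lemma (in orthoset) unital_restr:
  assumes x: "proper X x"
  shows "unital (restr X (ocomp X (ocomp X {x})))"
proof -
  have "x \<in> ocomp X (ocomp X {x})" using x subset_ocomp_ocomp[of "{x}"] by (auto simp: proper_def)
  moreover have "y = origin X" if "y \<in> ocomp X (ocomp X {x})" "y \<perp> x" for y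
    using that perp_self by (auto simp: ocomp_def)
  ultimately show ?thesis
    unfolding unital_def using x by (auto simp: proper_def intro!: exI[of _ x])
qed

lemma proj_orthoset_carrier: "carrier (proj_orthoset X) = pclass X ` carrier X"
  by (simp add: proj_orthoset_def)

text \<open>The class \<open>pclass X x\<close> is mapped to a single class, so that the choice in \<open>proj_map\<close> is determined.\<close>
lemma proj_map_pclass:
  assumes f: "\<And>x. x \<in> carrier X \<Longrightarrow> f x \<in> carrier Y"
    and par: "\<And>x y. x \<in> carrier X \<Longrightarrow> y \<in> carrier X \<Longrightarrow> parallel X x y \<Longrightarrow> parallel Y (f x) (f y)"
    and x: "x \<in> carrier X"
  shows "proj_map X Y f (pclass X x) = pclass Y (f x)"
proof -
  have "pclass Y (f y) = pclass Y (f x)" if "y \<in> pclass X x" for y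
    using that pclass_eq_iff[OF f[OF x]] par[OF _ x, of y] by (auto simp: pclass_def intro: parallel_sym)
  moreover have "x \<in> pclass X x" using x by (simp add: pclass_def)
  ultimately have "(\<lambda>y. pclass Y (f y)) ` pclass X x = {pclass Y (f x)}" by blast
  then show ?thesis using x by (simp add: proj_map_def proj_orthoset_def)
qed

lemma (in orthoset) perp_proj_iff:
  assumes "x \<in> carrier X" "y \<in> carrier X"
  shows "orth (proj_orthoset X) (pclass X x) (pclass X y) \<longleftrightarrow> x \<perp> y"
proof
  assume "orth (proj_orthoset X) (pclass X x) (pclass X y)"
  then obtain x' y' where xy: "pclass X x = pclass X x'" "pclass X y = pclass X y'" "x' \<perp> y'"
    by (auto simp: proj_orthoset_def)
  then have "parallel X x x'" "parallel X y y'"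
    using perp_carrier[OF xy(3)] by (auto simp: pclass_eq_iff)
  then show "x \<perp> y" using xy(3) parallel_perp parallel_perp' by blast
qed (auto simp: proj_orthoset_def)

text \<open>Orthogonality determines the size of orthogonal sets: a map that preserves and reflects \<open>\<bottom>\<close> is
injective on an orthogonal set, because a proper element is not orthogonal to itself.\<close>
locale orthoset_map = A: orthoset A + B: orthoset B for A :: "'a orthoset" and B :: "'b orthoset" +
  fixes f :: "'a \<Rightarrow> 'b"
  assumes map_closed: "x \<in> carrier A \<Longrightarrow> f x \<in> carrier B"
    and map_perp: "\<lbrakk>x \<in> carrier A; y \<in> carrier A\<rbrakk> \<Longrightarrow> orth B (f x) (f y) \<longleftrightarrow> orth A x y"
begin

lemma orthogonal_set_image:
  assumes D: "orthogonal_set A D"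
  shows "orthogonal_set B (f ` D)" "inj_on f D"
proof -
  have c: "x \<in> carrier A" "x \<noteq> origin A" if "x \<in> D" for x
    using D that by (auto simp: orthogonal_set_def proper_def)
  have "f x \<noteq> origin B" if "x \<in> D" for x
  proof
    assume "f x = origin B"
    then have "orth B (f x) (f x)" by (simp add: B.origin_perp B.origin_closed)
    then show False using map_perp[of x x] A.perp_self[of x] c[OF that] by simp
  qed
  then show "orthogonal_set B (f ` D)"
    using D c by (auto simp: orthogonal_set_def proper_def pairwise_def map_perp map_closed)
  show "inj_on f D"
  proof (rule inj_onI, rule ccontr)
    fix x y assume xy: "x \<in> D" "y \<in> D" "f x = f y" "x \<noteq> y"
    then have "orth A x y" using D by (auto simp: orthogonal_set_def pairwise_def)
    then have "orth A x x" using map_perp xy c by metis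
    then show False using A.perp_self c[OF xy(1)] by simp
  qed
qed

lemma ecard_image: "orthogonal_set A D \<Longrightarrow> ecard (f ` D) = ecard D"
  using orthogonal_set_image(2) by (auto simp: ecard_def card_image finite_image_iff)

lemma countable_rank_map: "countable_rank B \<Longrightarrow> countable_rank A"
  using orthogonal_set_image countable_image_inj_eq unfolding countable_rank_def by blast

lemma orank_mono: "orank A \<le> orank B"
  unfolding orank_def
proof (rule SUP_mono)
  fix D assume "D \<in> {D. orthogonal_set A D}"
  then show "\<exists>E\<in>{D. orthogonal_set B D}. ecard D \<le> ecard E"
    using orthogonal_set_image(1) ecard_image by (metis mem_Collect_eq order_refl)
qed

end

text \<open>A map that is onto up to parallelism induces an orthoisomorphism of the projective orthosets;
describing the isomorphism in this way avoids computations with classes.\<close>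
locale orthoset_rep = orthoset_map +
  assumes map_onto: "y \<in> carrier B \<Longrightarrow> \<exists>x\<in>carrier A. parallel B (f x) y"
begin

lemma parallel_iff:
  assumes "x \<in> carrier A" "y \<in> carrier A"
  shows "parallel B (f x) (f y) \<longleftrightarrow> parallel A x y"
proof
  assume "parallel B (f x) (f y)"
  then have "orth B z (f x) \<longleftrightarrow> orth B z (f y)" for z by (rule B.parallel_perp)
  then show "parallel A x y" using assms map_perp by (intro A.parallelI) blast
next
  assume p: "parallel A x y"
  show "parallel B (f x) (f y)"
  proof (rule B.parallelI)
    fix z assume "z \<in> carrier B"
    then obtain w where w: "w \<in> carrier A" "parallel B (f w) z" using map_onto by blast
    have "orth B z (f u) \<longleftrightarrow> orth A w u" if "u \<in> carrier A" for u
      using B.parallel_perp'[OF w(2)] map_perp[OF w(1) that] by blast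
    then show "orth B z (f x) = orth B z (f y)"
      using assms A.parallel_perp[OF p] by blast
  qed
qed

lemma proj_map_rep: "x \<in> carrier A \<Longrightarrow> proj_map A B f (pclass A x) = pclass B (f x)"
  using map_closed parallel_iff by (intro proj_map_pclass) blast+

lemma orthoisomorphism_rep: "orthoisomorphism (proj_orthoset A) (proj_orthoset B) (proj_map A B f)"
proof -
  have "inj_on (proj_map A B f) (pclass A ` carrier A)"
  proof (rule inj_onI)
    fix c d assume "c \<in> pclass A ` carrier A" "d \<in> pclass A ` carrier A"
      and eq: "proj_map A B f c = proj_map A B f d"
    then obtain x y where xy: "x \<in> carrier A" "y \<in> carrier A" "c = pclass A x" "d = pclass A y" by blast
    then have "pclass B (f x) = pclass B (f y)" using eq by (simp add: proj_map_rep)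
    then have "parallel A x y" using pclass_eq_iff map_closed parallel_iff xy by metis
    then show "c = d" using xy pclass_eq_iff by metis
  qed
  moreover have "proj_map A B f ` pclass A ` carrier A = pclass B ` carrier B"
  proof (intro equalityI subsetI)
    fix c assume "c \<in> pclass B ` carrier B"
    then obtain y where y: "y \<in> carrier B" "c = pclass B y" by blast
    then obtain x where x: "x \<in> carrier A" "parallel B (f x) y" using map_onto by blast
    then have "c = proj_map A B f (pclass A x)" using y pclass_eq_iff[of y B "f x"] by (simp add: proj_map_rep)
    then show "c \<in> proj_map A B f ` pclass A ` carrier A" using x by blast
  qed (auto simp: proj_map_rep map_closed)
  ultimately show ?thesis
    by (auto simp: orthoisomorphism_def bij_betw_def proj_orthoset_carrier
        proj_map_rep A.perp_proj_iff B.perp_proj_iff map_closed map_perp)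
qed

text \<open>Choosing preimages up to parallelism yields a map backwards, which transfers rank and
countability in the other direction.\<close>
lemma inverse_map: "\<exists>g. orthoset_map B A g"
proof -
  define g where "g y = (SOME x. x \<in> carrier A \<and> parallel B (f x) y)" for y
  have g: "g y \<in> carrier A \<and> parallel B (f (g y)) y" if "y \<in> carrier B" for y
    unfolding g_def by (rule someI_ex) (use map_onto[OF that] in blast)
  have "orth A (g x) (g y) \<longleftrightarrow> orth B x y" if xy: "x \<in> carrier B" "y \<in> carrier B" for x y
  proof -
    have "orth A (g x) (g y) \<longleftrightarrow> orth B (f (g x)) (f (g y))" using g xy map_perp by blast
    also have "\<dots> \<longleftrightarrow> orth B x y" using g xy B.parallel_perp B.parallel_perp' by blast
    finally show ?thesis .
  qed
  then have "orthoset_map B A g"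
    using g by unfold_locales auto
  then show ?thesis by blast
qed

lemma orank_eq: "orank A = orank B"
  using inverse_map orank_mono orthoset_map.orank_mono by (metis order_antisym)

lemma countable_rank_rep: "countable_rank A \<Longrightarrow> countable_rank B"
  using inverse_map orthoset_map.countable_rank_map by blast

end

context orthoset
begin

lemma maximal_ocomp:
  assumes "maximal_orthogonal_set X D" shows "ocomp X D = {origin X}"
proof -
  have D: "orthogonal_set X D" using assms by (simp add: maximal_orthogonal_set_def)
  have "x = origin X" if x: "x \<in> ocomp X D" for x
  proof (rule ccontr)
    assume 0: "x \<noteq> origin X"
    have xD: "x \<notin> D" using x 0 perp_self by (auto simp: ocomp_def)
    have "orthogonal_set X (insert x D)"
      using D x 0 by (auto simp: orthogonal_set_def proper_def ocomp_def pairwise_insert intro: perp_sym)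
    then have "insert x D = D" using assms unfolding maximal_orthogonal_set_def by blast
    then show False using xD by blast
  qed
  moreover have "D \<subseteq> carrier X" using D by (auto simp: orthogonal_set_def proper_def)
  ultimately show ?thesis using origin_in_ocomp by blast
qed

lemma ocomp_restr: "B \<subseteq> S \<Longrightarrow> S \<subseteq> carrier X \<Longrightarrow> ocomp (restr X S) B = ocomp X B \<inter> S"
  by (auto simp: ocomp_def)

text \<open>With \<open>B\<close> the complement of \<open>T\<close> in \<open>S\<close>, the set \<open>T\<close> is the complement in \<open>X\<close> of \<open>B \<union> S\<^sup>\<bottom>\<close>.\<close>
lemma orthoclosed_restr:
  assumes S: "orthoclosed X S" and T: "orthoclosed (restr X S) T" shows "orthoclosed X T"
proof -
  have SX: "S \<subseteq> carrier X" using S by (rule orthoclosed_subset)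
  have TS: "T \<subseteq> S" using T by (simp add: orthoclosed_def)
  let ?A = "ocomp X T \<inter> S"
  have "T = ocomp X ?A \<inter> S"
    using T ocomp_restr[OF TS SX] ocomp_restr[of ?A S] SX by (simp add: orthoclosed_def)
  moreover have "ocomp X (?A \<union> ocomp X S) = ocomp X ?A \<inter> ocomp X (ocomp X S)"
    by (auto simp: ocomp_def)
  moreover have "ocomp X (ocomp X S) = S" using S by (simp add: orthoclosed_def)
  ultimately have "T = ocomp X (?A \<union> ocomp X S)" by simp
  then show ?thesis using orthoclosed_ocomp[of "?A \<union> ocomp X S"] SX ocomp_subset by auto
qed

lemma countable_rank_restr:
  assumes "countable_rank X" "S \<subseteq> carrier X" shows "countable_rank (restr X S)"
  unfolding countable_rank_def
proof (intro allI impI)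
  fix D assume "orthogonal_set (restr X S) D"
  then have "orthogonal_set X D"
    using assms(2) by (auto simp: orthogonal_set_def proper_def pairwise_def)
  then show "countable D" using assms(1) by (simp add: countable_rank_def)
qed

end

section \<open>Dimension and subspaces of Hermitian spaces\<close>

lemma orthoset_of_simps [simp]: "carrier (orthoset_of H F) = carrier H"
    "origin (orthoset_of H F) = zero H"
    "orth (orthoset_of H F) u v \<longleftrightarrow> u \<in> carrier H \<and> v \<in> carrier H \<and> form H u v = zero F"
  by (auto simp: orthoset_of_def)

context hermitian_space
begin

abbreviation OH :: "'v orthoset" where "OH \<equiv> orthoset_of H F"

lemma star_zero: "star F \<zero>\<^bsub>F\<^esub> = \<zero>\<^bsub>F\<^esub>"
proof -
  have "star F \<zero>\<^bsub>F\<^esub> \<oplus>\<^bsub>F\<^esub> star F \<zero>\<^bsub>F\<^esub> = star F \<zero>\<^bsub>F\<^esub>"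
    using F.star_add[of "\<zero>\<^bsub>F\<^esub>" "\<zero>\<^bsub>F\<^esub>"] by simp
  then show ?thesis using F.star_closed[of "\<zero>\<^bsub>F\<^esub>"] F.add.r_cancel_one by simp
qed

lemma form_perp_sym:
  "\<lbrakk>u \<in> carrier H; v \<in> carrier H; form H u v = \<zero>\<^bsub>F\<^esub>\<rbrakk> \<Longrightarrow> form H v u = \<zero>\<^bsub>F\<^esub>"
  using form_symmetric[of v u] star_zero by simp

lemma form_zero_left: 
  assumes "v \<in> carrier H" shows "form H \<zero>\<^bsub>H\<^esub> v = \<zero>\<^bsub>F\<^esub>"
proof -
  have "form H \<zero>\<^bsub>H\<^esub> v = form H \<zero>\<^bsub>H\<^esub> v \<oplus>\<^bsub>F\<^esub> form H \<zero>\<^bsub>H\<^esub> v"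
    using form_left[of "\<one>\<^bsub>F\<^esub>" "\<one>\<^bsub>F\<^esub>" "\<zero>\<^bsub>H\<^esub>" "\<zero>\<^bsub>H\<^esub>" v] assms form_closed[of "\<zero>\<^bsub>H\<^esub>" v]
    by (simp add: smult_one)
  then show ?thesis using form_closed[of "\<zero>\<^bsub>H\<^esub>" v] assms F.add.r_cancel_one by simp
qed

lemma smult_zero_left: 
  assumes u: "u \<in> carrier H" shows "\<zero>\<^bsub>F\<^esub> \<odot>\<^bsub>H\<^esub> u = \<zero>\<^bsub>H\<^esub>"
proof -
  have c: "\<zero>\<^bsub>F\<^esub> \<odot>\<^bsub>H\<^esub> u \<in> carrier H" using u smult_closed by simp
  have "\<zero>\<^bsub>F\<^esub> \<odot>\<^bsub>H\<^esub> u = \<zero>\<^bsub>F\<^esub> \<odot>\<^bsub>H\<^esub> u \<oplus>\<^bsub>H\<^esub> \<zero>\<^bsub>F\<^esub> \<odot>\<^bsub>H\<^esub> u"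
    using smult_l_distr[of "\<zero>\<^bsub>F\<^esub>" "\<zero>\<^bsub>F\<^esub>" u] u by simp
  then show ?thesis using c H.add.r_cancel_one by simp
qed

lemma orthoset_of_space: "orthoset OH"
proof
  show "perp OH \<subseteq> carrier OH \<times> carrier OH" by (auto simp: orthoset_of_def)
qed (auto simp: form_zero_left intro: form_perp_sym anisotropic)

definition linear_set :: "'v set \<Rightarrow> bool"
  where "linear_set W \<longleftrightarrow> W \<subseteq> carrier H \<and> \<zero>\<^bsub>H\<^esub> \<in> W \<and>
    (\<forall>a\<in>carrier F. \<forall>b\<in>carrier F. \<forall>u\<in>W. \<forall>v\<in>W. a \<odot>\<^bsub>H\<^esub> u \<oplus>\<^bsub>H\<^esub> b \<odot>\<^bsub>H\<^esub> v \<in> W)"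

lemma linear_setD:
  "\<lbrakk>linear_set W; a \<in> carrier F; b \<in> carrier F; u \<in> W; v \<in> W\<rbrakk>
    \<Longrightarrow> a \<odot>\<^bsub>H\<^esub> u \<oplus>\<^bsub>H\<^esub> b \<odot>\<^bsub>H\<^esub> v \<in> W"
  by (simp add: linear_set_def)

lemma linear_ocomp: "linear_set (ocomp OH E)" if "E \<subseteq> carrier H"
  using that
  by (auto simp: linear_set_def ocomp_def form_zero_left smult_closed form_left subset_iff)

lemma linear_Int: "linear_set V \<Longrightarrow> linear_set W \<Longrightarrow> linear_set (V \<inter> W)"
  by (auto simp: linear_set_def)

lemma linear_orthoclosed: "orthoclosed OH S \<Longrightarrow> linear_set S"
  using linear_ocomp[of "ocomp OH S"] by (auto simp: orthoclosed_def ocomp_def)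

inductive chain :: "'v set \<Rightarrow> nat \<Rightarrow> bool" where
  chain_0: "linear_set W \<Longrightarrow> chain W 0"
| chain_Suc: "chain V m \<Longrightarrow> linear_set W \<Longrightarrow> V \<subset> W \<Longrightarrow> chain W (Suc m)"

lemma chain_linear: "chain W n \<Longrightarrow> linear_set W"
  by (auto elim: chain.cases)

lemma chain_mono: 
  assumes "chain V n" "linear_set W" "V \<subseteq> W" shows "chain W n"
  using assms(1)
proof cases
  case chain_0
  then show ?thesis using assms by (simp add: chain.chain_0)
next
  case (chain_Suc V' m)
  then show ?thesis using assms chain.chain_Suc[of V' m W] by auto
qed

text \<open>Intersecting with \<open>{d}\<^sup>\<bottom>\<close> identifies at most two consecutive members of a chain. If \<open>V \<subset> W\<close> and some
\<open>x \<in> V\<close> is not orthogonal to \<open>d\<close>, then an element of \<open>W - V\<close> can be corrected by a multiple of \<open>x\<close> so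
as to become orthogonal to \<open>d\<close>, and it stays outside \<open>V\<close>. Thus no step above the first member not
contained in \<open>{d}\<^sup>\<bottom>\<close> collapses.\<close>
lemma chain_ocomp:
  assumes "chain W n" "d \<in> carrier H" shows "chain (W \<inter> ocomp OH {d}) (n - 1)"
  using assms(1)
proof (induction W n rule: chain.induct)
  case (chain_0 W)
  then show ?case using assms(2) by (simp add: chain.chain_0 linear_Int linear_ocomp)
next
  case (chain_Suc V m W)
  let ?P = "ocomp OH {d}"
  have lin: "linear_set (W \<inter> ?P)" using chain_Suc assms(2) by (simp add: linear_Int linear_ocomp)
  show ?case
  proof (cases "V \<subseteq> ?P")
    case True
    then have "V \<subseteq> W \<inter> ?P" using chain_Suc by auto
    then show ?thesis using chain_mono[OF chain_Suc.hyps(1) lin] by simp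
  next
    case False
    have V: "linear_set V" using chain_Suc chain_linear by blast
    obtain x where x: "x \<in> V" "x \<notin> ?P" using False by blast
    obtain y where y: "y \<in> W" "y \<notin> V" using chain_Suc by blast
    have xy [simp]: "x \<in> carrier H" "y \<in> carrier H" "x \<in> W"
      using x y chain_Suc V by (auto simp: linear_set_def)
    note [simp] = assms(2) form_closed smult_closed
    have "form H x d \<in> Units F" using x F.units by (auto simp: ocomp_def)
    then obtain i where i [simp]: "i \<in> carrier F" "i \<otimes>\<^bsub>F\<^esub> form H x d = \<one>\<^bsub>F\<^esub>" by (auto simp: Units_def)
    define k where "k = form H y d \<otimes>\<^bsub>F\<^esub> i"
    have k [simp]: "k \<in> carrier F" and kx: "k \<otimes>\<^bsub>F\<^esub> form H x d = form H y d"
      by (simp_all add: k_def F.m_assoc)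
    define z where "z = \<one>\<^bsub>F\<^esub> \<odot>\<^bsub>H\<^esub> y \<oplus>\<^bsub>H\<^esub> (\<ominus>\<^bsub>F\<^esub> k) \<odot>\<^bsub>H\<^esub> x"
    have "form H z d = form H y d \<oplus>\<^bsub>F\<^esub> \<ominus>\<^bsub>F\<^esub> (k \<otimes>\<^bsub>F\<^esub> form H x d)"
      by (simp add: z_def form_left F.l_minus)
    then have "form H z d = \<zero>\<^bsub>F\<^esub>" by (simp add: kx F.r_neg)
    moreover have zW: "z \<in> W" unfolding z_def by (rule linear_setD[OF chain_Suc.hyps(2)]) (use y in simp_all)
    moreover have zH [simp]: "z \<in> carrier H" by (simp add: z_def)
    ultimately have "z \<in> W \<inter> ?P" by (simp add: ocomp_def)
    moreover have "z \<notin> V"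
    proof
      assume "z \<in> V"
      then have "\<one>\<^bsub>F\<^esub> \<odot>\<^bsub>H\<^esub> z \<oplus>\<^bsub>H\<^esub> k \<odot>\<^bsub>H\<^esub> x \<in> V"
        by (intro linear_setD[OF V]) (use x in simp_all)
      moreover have "\<one>\<^bsub>F\<^esub> \<odot>\<^bsub>H\<^esub> z \<oplus>\<^bsub>H\<^esub> k \<odot>\<^bsub>H\<^esub> x = y \<oplus>\<^bsub>H\<^esub> (\<ominus>\<^bsub>F\<^esub> k \<oplus>\<^bsub>F\<^esub> k) \<odot>\<^bsub>H\<^esub> x"
        by (simp add: z_def smult_one smult_l_distr H.a_assoc)
      moreover have "\<dots> = y" by (simp add: F.l_neg smult_zero_left)
      ultimately show False using y by simp
    qed
    ultimately have ss: "V \<inter> ?P \<subset> W \<inter> ?P" using chain_Suc.hyps(3) by blast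
    show ?thesis
    proof (cases m)
      case 0
      then show ?thesis using lin by (simp add: chain.chain_0)
    next
      case (Suc m')
      then show ?thesis using chain.chain_Suc[OF chain_Suc.IH lin ss] by simp
    qed
  qed
qed

lemma chain_ocomp_finite:
  assumes "finite D" "D \<subseteq> carrier H" "chain (carrier H) n"
  shows "chain (ocomp OH D) (n - card D)"
  using assms
proof (induction D rule: finite_induct)
  case empty
  then show ?case by (simp add: ocomp_def)
next
  case (insert d D)
  have "ocomp OH (insert d D) = ocomp OH D \<inter> ocomp OH {d}" by (auto simp: ocomp_def)
  then show ?case using insert chain_ocomp[of "ocomp OH D" "n - card D" d] by simp
qed

lemma chain_trivial: "chain {\<zero>\<^bsub>H\<^esub>} n \<Longrightarrow> n = 0"
  by (erule chain.cases) (auto simp: linear_set_def dest: chain_linear)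

text \<open>The chain consists of the complements of the sets \<open>E - E'\<close>, for \<open>E'\<close> growing from the empty set to \<open>E\<close>:
the element added to \<open>E'\<close> enters the complement at this moment and not before.\<close>
lemma chain_orthogonal:
  assumes "finite E" "orthogonal_set OH E" shows "chain (carrier H) (card E)"
proof -
  have EH: "E \<subseteq> carrier H" using assms(2) by (auto simp: orthogonal_set_def proper_def)
  have "chain (ocomp OH (E - E')) (card E')" if "finite E'" "E' \<subseteq> E" for E'
    using that
  proof (induction E' rule: finite_induct)
    case empty
    then show ?case using EH by (simp add: chain_0 linear_ocomp)
  next
    case (insert x E')
    have x: "x \<in> E" "x \<in> carrier H" "x \<noteq> \<zero>\<^bsub>H\<^esub>"
      using insert assms(2) by (auto simp: orthogonal_set_def proper_def)
    have "x \<in> ocomp OH (E - insert x E')"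
      using assms(2) x EH by (auto simp: ocomp_def orthogonal_set_def pairwise_def)
    moreover have "x \<notin> ocomp OH (E - E')"
      using x insert.hyps(2) anisotropic by (auto simp: ocomp_def)
    moreover have "ocomp OH (E - E') \<subseteq> ocomp OH (E - insert x E')" by (auto simp: ocomp_def)
    ultimately have "ocomp OH (E - E') \<subset> ocomp OH (E - insert x E')" by blast
    moreover have "linear_set (ocomp OH (E - insert x E'))" using EH by (intro linear_ocomp) auto
    ultimately show ?case using insert chain_Suc by simp
  qed
  from this[OF assms(1)] show ?thesis by (simp add: ocomp_def)
qed

text \<open>A chain of length \<open>card E\<close> loses at most \<open>card D\<close> of its steps on the way to \<open>D\<^sup>\<bottom>\<close>, which has none.\<close>
lemma card_orthogonal_le:
  assumes D: "finite D" "D \<subseteq> carrier H" "ocomp OH D = {\<zero>\<^bsub>H\<^esub>}" and E: "finite E" "orthogonal_set OH E"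
  shows "card E \<le> card D"
proof -
  have "chain {\<zero>\<^bsub>H\<^esub>} (card E - card D)"
    using chain_ocomp_finite[OF D(1,2) chain_orthogonal[OF E]] D(3) by simp
  then show ?thesis using chain_trivial[of "card E - card D"] by simp
qed

lemma ecard_orthogonal_le:
  assumes D: "D \<subseteq> carrier H" "ocomp OH D = {\<zero>\<^bsub>H\<^esub>}" and E: "orthogonal_set OH E"
  shows "ecard E \<le> ecard D"
proof (cases "finite D")
  case True
  have "finite E"
  proof (rule ccontr)
    assume "infinite E"
    then obtain E' where E': "E' \<subseteq> E" "finite E'" "card E' = Suc (card D)"
      using infinite_arbitrarily_large by blast
    then have "orthogonal_set OH E'" using E unfolding orthogonal_set_def pairwise_def by blast
    then show False using card_orthogonal_le[OF True D E'(2)] E'(3) by simp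
  qed
  then show ?thesis using card_orthogonal_le[OF True D _ E] True by (simp add: ecard_def)
qed (simp add: ecard_def)

text \<open>A maximal orthogonal set has trivial complement and is therefore at least as large as any other
orthogonal set.\<close>
lemma has_dim_orank: "has_dim H F (orank OH)"
  unfolding has_dim_def
proof (intro allI impI)
  interpret O: orthoset OH by (rule orthoset_of_space)
  fix D assume D: "maximal_orthogonal_set OH D"
  have D': "orthogonal_set OH D" using D by (simp add: maximal_orthogonal_set_def)
  have "ecard E \<le> ecard D" if "orthogonal_set OH E" for E
    using ecard_orthogonal_le[OF _ _ that] O.maximal_ocomp[OF D] D'
    by (auto simp: orthogonal_set_def proper_def)
  then show "ecard D = orank OH"
    unfolding orank_def using D' by (intro antisym SUP_least SUP_upper) auto
qed

lemma orthoset_of_restr: "S \<subseteq> carrier H \<Longrightarrow> orthoset_of (H\<lparr>carrier := S\<rparr>) F = restr OH S"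
  by (auto simp: orthoset_of_def restr_def)

lemma hermitian_subspace:
  assumes S: "linear_set S" shows "hermitian_space F (H\<lparr>carrier := S\<rparr>)"
proof -
  interpret O: orthoset OH by (rule orthoset_of_space)
  have SH [simp]: "x \<in> carrier H" if "x \<in> S" for x using S that by (auto simp: linear_set_def)
  have smult_S [simp]: "a \<odot>\<^bsub>H\<^esub> u \<in> S" if "a \<in> carrier F" "u \<in> S" for a u
    using linear_setD[OF S that(1) F.zero_closed that(2,2)] that by (simp add: smult_zero_left smult_closed)
  have add_S [simp]: "u \<oplus>\<^bsub>H\<^esub> v \<in> S" if "u \<in> S" "v \<in> S" for u v
    using linear_setD[OF S F.one_closed F.one_closed that] that by (simp add: smult_one)
  have zero_S [simp]: "\<zero>\<^bsub>H\<^esub> \<in> S" using S by (simp add: linear_set_def)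
  interpret S: abelian_group "H\<lparr>carrier := S\<rparr>"
  proof (rule abelian_groupI, goal_cases)
    case (6 u)
    then have u: "u \<in> S" by simp
    have "(\<ominus>\<^bsub>F\<^esub> \<one>\<^bsub>F\<^esub>) \<odot>\<^bsub>H\<^esub> u \<oplus>\<^bsub>H\<^esub> u = (\<ominus>\<^bsub>F\<^esub> \<one>\<^bsub>F\<^esub> \<oplus>\<^bsub>F\<^esub> \<one>\<^bsub>F\<^esub>) \<odot>\<^bsub>H\<^esub> u"
      using u by (subst smult_l_distr) (simp_all add: smult_one)
    then show ?case
      using u by (intro bexI[of _ "(\<ominus>\<^bsub>F\<^esub> \<one>\<^bsub>F\<^esub>) \<odot>\<^bsub>H\<^esub> u"]) (simp_all add: F.l_neg smult_zero_left)
  qed (auto simp: H.a_assoc intro: H.a_comm)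
  show ?thesis
  proof unfold_locales
    show "countable_rank (orthoset_of (H\<lparr>carrier := S\<rparr>) F)"
      using O.countable_rank_restr[OF countably_many_orthogonal, of S]
      by (simp add: orthoset_of_restr subset_iff)
  qed (simp_all add: smult_closed smult_l_distr smult_r_distr smult_assoc smult_one form_closed
      form_left form_right anisotropic, blast intro: form_symmetric SH)
qed

end

context orthomodular_space
begin

lemma decompose:
  assumes S: "orthoclosed OH S" and x: "x \<in> carrier H"
  obtains u v where "u \<in> S" "v \<in> ocomp OH S" "x = u \<oplus>\<^bsub>H\<^esub> v"
proof -
  have "x \<in> S <+>\<^bsub>H\<^esub> ocomp OH S" using orthomodular[OF S] x by simp
  then show thesis using that unfolding set_add_def' by blast
qed

text \<open>A closed subset \<open>T\<close> of \<open>S\<close> is closed in \<open>H\<close> too. The decomposition \<open>x = u + v\<close> of an \<open>x \<in> S\<close> with respect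
to \<open>T\<close> and \<open>T\<^sup>\<bottom>\<close> in \<open>H\<close> stays within \<open>S\<close> because \<open>v = x - u\<close>.\<close>
lemma orthomodular_subspace:
  assumes S: "orthoclosed OH S" shows "orthomodular_space F (H\<lparr>carrier := S\<rparr>)"
proof -
  interpret O: orthoset OH by (rule orthoset_of_space)
  have lin: "linear_set S" by (rule linear_orthoclosed[OF S])
  have SH: "S \<subseteq> carrier H" by (rule O.orthoclosed_subset[OF S, simplified])
  interpret S: hermitian_space F "H\<lparr>carrier := S\<rparr>" by (rule hermitian_subspace[OF lin])
  show ?thesis
  proof
    fix T assume "orthoclosed (orthoset_of (H\<lparr>carrier := S\<rparr>) F) T"
    then have T': "orthoclosed (restr OH S) T" by (simp add: orthoset_of_restr[OF SH])
    have TS: "T \<subseteq> S" using T' by (simp add: orthoclosed_def)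
    have T: "orthoclosed OH T" by (rule O.orthoclosed_restr[OF S T'])
    have oc: "ocomp (restr OH S) T = ocomp OH T \<inter> S" by (rule O.ocomp_restr[OF TS]) (simp add: SH)
    have "\<exists>u\<in>T. \<exists>v\<in>ocomp OH T \<inter> S. x = u \<oplus>\<^bsub>H\<^esub> v" if x: "x \<in> S" for x
    proof -
      have xH: "x \<in> carrier H" using x SH by blast
      obtain u v where uv: "u \<in> T" "v \<in> ocomp OH T" "x = u \<oplus>\<^bsub>H\<^esub> v" using decompose[OF T xH] by blast
      have c: "u \<in> carrier H" "v \<in> carrier H" "u \<in> S" using uv TS SH by (auto simp: ocomp_def)
      have "\<one>\<^bsub>F\<^esub> \<odot>\<^bsub>H\<^esub> x \<oplus>\<^bsub>H\<^esub> (\<ominus>\<^bsub>F\<^esub> \<one>\<^bsub>F\<^esub>) \<odot>\<^bsub>H\<^esub> u \<in> S"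
        by (rule linear_setD[OF lin]) (use x c in simp_all)
      also have "\<one>\<^bsub>F\<^esub> \<odot>\<^bsub>H\<^esub> x \<oplus>\<^bsub>H\<^esub> (\<ominus>\<^bsub>F\<^esub> \<one>\<^bsub>F\<^esub>) \<odot>\<^bsub>H\<^esub> u
          = v \<oplus>\<^bsub>H\<^esub> (\<one>\<^bsub>F\<^esub> \<odot>\<^bsub>H\<^esub> u \<oplus>\<^bsub>H\<^esub> (\<ominus>\<^bsub>F\<^esub> \<one>\<^bsub>F\<^esub>) \<odot>\<^bsub>H\<^esub> u)"
        using c smult_closed[of "\<ominus>\<^bsub>F\<^esub> \<one>\<^bsub>F\<^esub>" u] uv(3) H.a_comm[of u v] by (simp add: smult_one H.a_assoc)
      also have "\<dots> = v \<oplus>\<^bsub>H\<^esub> (\<one>\<^bsub>F\<^esub> \<oplus>\<^bsub>F\<^esub> \<ominus>\<^bsub>F\<^esub> \<one>\<^bsub>F\<^esub>) \<odot>\<^bsub>H\<^esub> u"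
        using c by (subst smult_l_distr) simp_all
      also have "\<dots> = v" using c by (simp add: F.r_neg smult_zero_left)
      finally show ?thesis using uv by blast
    qed
    then show "carrier (H\<lparr>carrier := S\<rparr>) = T <+>\<^bsub>H\<lparr>carrier := S\<rparr>\<^esub> ocomp (orthoset_of (H\<lparr>carrier := S\<rparr>) F) T"
      using TS S.a_closed by (auto simp: orthoset_of_restr[OF SH] oc set_add_def')
  qed
qed

text \<open>A vector of \<open>H\<close> and its component in \<open>S\<close> have the same products with the elements of \<open>S\<close>.\<close>
lemma parallel_subspace:
  assumes S: "orthoclosed OH S" and uv: "u \<in> S" "v \<in> S" and par: "parallel (restr OH S) u v"
  shows "parallel OH u v"
proof -
  interpret O: orthoset OH by (rule orthoset_of_space)
  have SH: "S \<subseteq> carrier H" by (rule O.orthoclosed_subset[OF S, simplified])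
  have *: "form H x w = \<zero>\<^bsub>F\<^esub> \<longleftrightarrow> form H s w = \<zero>\<^bsub>F\<^esub>"
    if x: "x = s \<oplus>\<^bsub>H\<^esub> t" "s \<in> S" "t \<in> ocomp OH S" "w \<in> S" for x s t w
  proof -
    have c: "s \<in> carrier H" "t \<in> carrier H" "w \<in> carrier H" "form H t w = \<zero>\<^bsub>F\<^esub>"
      using x SH by (auto simp: ocomp_def)
    have "form H x w = form H s w"
      using form_left[of "\<one>\<^bsub>F\<^esub>" "\<one>\<^bsub>F\<^esub>" s t w] c form_closed[of s w] x(1) by (simp add: smult_one)
    then show ?thesis by simp
  qed
  show ?thesis
  proof (rule O.parallelI)
    fix z assume "z \<in> carrier OH"
    then obtain s t where st: "s \<in> S" "t \<in> ocomp OH S" "z = s \<oplus>\<^bsub>H\<^esub> t" using decompose[OF S] by auto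
    have "orth (restr OH S) s u \<longleftrightarrow> orth (restr OH S) s v"
      using par st(1) uv by (auto simp: parallel_def ocomp_def set_eq_iff)
    then show "orth OH z u \<longleftrightarrow> orth OH z v"
      using *[OF st(3,1,2)] uv st SH by auto
  qed
qed

end

lemma (in uniform_orthomodular_space) uniform_subspace:
  assumes S: "orthoclosed (orthoset_of H F) S" shows "uniform_orthomodular_space F (H\<lparr>carrier := S\<rparr>)"
proof -
  interpret O: orthoset "orthoset_of H F" by (rule orthoset_of_space)
  have SH: "S \<subseteq> carrier H" by (rule O.orthoclosed_subset[OF S, simplified])
  interpret S: orthomodular_space F "H\<lparr>carrier := S\<rparr>" by (rule orthomodular_subspace[OF S])
  show ?thesis
  proof
    fix T assume T: "is_subspace T (H\<lparr>carrier := S\<rparr>) F" "has_dim T F 1"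
    then have "orthoclosed (restr (orthoset_of H F) S) (carrier T)" "T = H\<lparr>carrier := carrier T\<rparr>"
      by (auto simp: is_subspace_def orthoset_of_restr[OF SH])
    then have "is_subspace T H F" using O.orthoclosed_restr[OF S] by (simp add: is_subspace_def)
    then show "\<exists>u\<in>carrier T. form (H\<lparr>carrier := S\<rparr>) u u = \<one>\<^bsub>F\<^esub>" using uniform T(2) by simp
  qed
qed

section \<open>Morphisms with domain and codomain\<close>

text \<open>Arrows carry their domain and codomain, so that composition, dagger and addition are operations
on arrows alone and equations between composites can be rewritten like those of an algebra.\<close>
datatype 'a arrow = Arrow (src: "'a orthoset") (tgt: "'a orthoset") (fn: "'a \<Rightarrow> 'a")

definition cmp :: "'a arrow \<Rightarrow> 'a arrow \<Rightarrow> 'a arrow" (infixr "\<cdot>" 70)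
  where "g \<cdot> f = Arrow (src f) (tgt g) (compose (carrier (src f)) (fn g) (fn f))"

definition idn :: "'a orthoset \<Rightarrow> 'a arrow"
  where "idn X = Arrow X X (ident X)"

definition zer :: "'a orthoset \<Rightarrow> 'a orthoset \<Rightarrow> 'a arrow"
  where "zer X Y = Arrow X Y (\<lambda>x\<in>carrier X. origin Y)"

lemma cmp_simps [simp]: "src (g \<cdot> f) = src f" "tgt (g \<cdot> f) = tgt g"
    "x \<in> carrier (src f) \<Longrightarrow> fn (g \<cdot> f) x = fn g (fn f x)"
  by (auto simp: cmp_def compose_def)

lemma idn_simps [simp]: "src (idn X) = X" "tgt (idn X) = X"
    "x \<in> carrier X \<Longrightarrow> fn (idn X) x = x"
  by (auto simp: idn_def incl_def)

lemma zer_simps [simp]: "src (zer X Y) = X" "tgt (zer X Y) = Y"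
    "x \<in> carrier X \<Longrightarrow> fn (zer X Y) x = origin Y"
  by (auto simp: zer_def)

context dagger_orthocat
begin

definition arr :: "'a arrow \<Rightarrow> bool"
  where "arr f \<longleftrightarrow> src f \<in> Obj C \<and> tgt f \<in> Obj C \<and> fn f \<in> Hom C (src f) (tgt f)"

definition dag :: "'a arrow \<Rightarrow> 'a arrow" ("_\<^sup>\<dagger>" [1000] 1000)
  where "f\<^sup>\<dagger> = Arrow (tgt f) (src f) (Dag C (src f) (tgt f) (fn f))"

abbreviation in_hom :: "'a arrow \<Rightarrow> 'a orthoset \<Rightarrow> 'a orthoset \<Rightarrow> bool" ("\<guillemotleft>_ : _ \<rightarrow> _\<guillemotright>")
  where "\<guillemotleft>f : X \<rightarrow> Y\<guillemotright> \<equiv> arr f \<and> src f = X \<and> tgt f = Y"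

lemma dag_simps [simp]: "src (f\<^sup>\<dagger>) = tgt f" "tgt (f\<^sup>\<dagger>) = src f"
  by (auto simp: dag_def)

lemma arr_Obj: "arr f \<Longrightarrow> src f \<in> Obj C" "arr f \<Longrightarrow> tgt f \<in> Obj C"
  by (auto simp: arr_def)

lemma arr_funcset: "arr f \<Longrightarrow> fn f \<in> carrier (src f) \<rightarrow>\<^sub>E carrier (tgt f)"
  using hom_maps[of "src f" "tgt f"] unfolding arr_def by blast

lemma fn_closed [simp]: "arr f \<Longrightarrow> x \<in> carrier (src f) \<Longrightarrow> fn f x \<in> carrier (tgt f)"
  using arr_funcset by blast

lemma arr_eqI:
  assumes "arr f" "arr g" "src f = src g" "tgt f = tgt g"
    and "\<And>x. x \<in> carrier (src f) \<Longrightarrow> fn f x = fn g x"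
  shows "f = g"
  using assms arr_funcset[of f] arr_funcset[of g]
  by (metis PiE_ext arrow.expand)

lemma arr_cmp [simp]:
  assumes "arr f" "arr g" "src g = tgt f" shows "arr (g \<cdot> f)"
proof -
  have "compose (carrier (src f)) (fn g) (fn f) \<in> Hom C (src f) (tgt g)"
    by (rule hom_compose[of _ "tgt f"]) (use assms in \<open>auto simp: arr_def\<close>)
  then show ?thesis using assms by (simp add: arr_def cmp_def)
qed

lemma arr_idn [simp]: "X \<in> Obj C \<Longrightarrow> arr (idn X)"
  by (simp add: arr_def idn_def hom_ident)

lemma arr_dag [simp]: "arr f \<Longrightarrow> arr (f\<^sup>\<dagger>)"
  by (simp add: arr_def dag_def dag_hom)

lemma cmp_assoc [simp]:
  assumes "arr f" "tgt f = src g" shows "(h \<cdot> g) \<cdot> f = h \<cdot> (g \<cdot> f)"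
  using arr_funcset[OF assms(1)] assms(2) by (auto simp: cmp_def compose_def intro!: restrict_ext)

lemma cmp_idn [simp]: "arr f \<Longrightarrow> src f = X \<Longrightarrow> f \<cdot> idn X = f"
  by (rule arr_eqI) (auto simp: arr_Obj)

lemma idn_cmp [simp]: "arr f \<Longrightarrow> tgt f = X \<Longrightarrow> idn X \<cdot> f = f"
  by (rule arr_eqI) (auto simp: arr_Obj)

lemma dag_dag' [simp]: "arr f \<Longrightarrow> (f\<^sup>\<dagger>)\<^sup>\<dagger> = f"
  by (auto simp: arr_def dag_def dag_dag)

lemma dag_idn [simp]: "X \<in> Obj C \<Longrightarrow> (idn X)\<^sup>\<dagger> = idn X"
  by (simp add: dag_def idn_def dag_ident)

lemma dag_cmp [simp]:
  assumes "arr f" "arr g" "src g = tgt f" shows "(g \<cdot> f)\<^sup>\<dagger> = f\<^sup>\<dagger> \<cdot> g\<^sup>\<dagger>"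
proof -
  have "Dag C (src f) (tgt g) (compose (carrier (src f)) (fn g) (fn f))
      = compose (carrier (tgt g)) (Dag C (src f) (tgt f) (fn f)) (Dag C (tgt f) (tgt g) (fn g))"
    by (rule dag_compose) (use assms in \<open>auto simp: arr_def\<close>)
  then show ?thesis using assms by (simp add: cmp_def dag_def)
qed

declare arr_Obj [simp]

lemma adjoint:
  assumes "arr f" "x \<in> carrier (src f)" "y \<in> carrier (tgt f)"
  shows "orth (tgt f) (fn f x) y \<longleftrightarrow> orth (src f) x (fn (f\<^sup>\<dagger>) y)"
  using assms dag_adjoint[of "src f" "tgt f" "fn f"]
  by (auto simp: arr_def dag_def is_adjoint_def simp del: arr_Obj)

lemma adjoint':
  assumes "arr f" "x \<in> carrier (src f)" "y \<in> carrier (tgt f)"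
  shows "orth (tgt f) y (fn f x) \<longleftrightarrow> orth (src f) (fn (f\<^sup>\<dagger>) y) x"
  using adjoint[OF assms] assms orthoset.perp_sym[OF obj_orthoset] by (metis arr_Obj)

lemma fn_parallel:
  assumes "arr f" "x \<in> carrier (src f)" "y \<in> carrier (src f)" "parallel (src f) x y"
  shows "parallel (tgt f) (fn f x) (fn f y)"
proof (rule orthoset.parallelI[OF obj_orthoset])
  fix z assume "z \<in> carrier (tgt f)"
  then show "orth (tgt f) z (fn f x) = orth (tgt f) z (fn f y)"
    using assms by (simp add: adjoint' orthoset.parallel_perp[OF obj_orthoset, of "src f" x y])
qed (use assms in auto)

lemma fn_origin [simp]:
  assumes "arr f" shows "fn f (origin (src f)) = origin (tgt f)"
proof -
  interpret S: orthoset "src f" using assms obj_orthoset by auto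
  interpret T: orthoset "tgt f" using assms obj_orthoset by auto
  have d: "fn (f\<^sup>\<dagger>) y \<in> carrier (src f)" if "y \<in> carrier (tgt f)" for y
    using assms that fn_closed[of "f\<^sup>\<dagger>" y] by simp
  show ?thesis
    using assms by (intro T.perp_all_origin) (auto simp: adjoint S.origin_closed S.origin_perp d)
qed

end

section \<open>Zero maps, biproducts and addition\<close>

locale splitting_orthocat = dagger_orthocat C for C :: "'a orthocat" +
  assumes biproducts: "has_dagger_biproducts C"
    and subspaces: "\<lbrakk>X \<in> Obj C; orthoclosed X A\<rbrakk> \<Longrightarrow>
      restr X A \<in> Obj C \<and> restr X (ocomp X A) \<in> Obj C \<and>
      incl A \<in> Hom C (restr X A) X \<and> incl (ocomp X A) \<in> Hom C (restr X (ocomp X A)) X \<and>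
      dagger_biproduct C (restr X A) (restr X (ocomp X A)) X (incl A) (incl (ocomp X A))"
begin

definition emb :: "'a orthoset \<Rightarrow> 'a set \<Rightarrow> 'a arrow"
  where "emb X A = Arrow (restr X A) X (incl A)"

lemma emb_simps [simp]: "src (emb X A) = restr X A" "tgt (emb X A) = X"
    "x \<in> A \<Longrightarrow> fn (emb X A) x = x"
  by (auto simp: emb_def incl_def)

lemma arr_emb [simp]: "X \<in> Obj C \<Longrightarrow> orthoclosed X A \<Longrightarrow> arr (emb X A)"
  using subspaces[of X A] by (simp add: arr_def emb_def del: arr_Obj)

lemma restr_Obj [simp]: "X \<in> Obj C \<Longrightarrow> orthoclosed X A \<Longrightarrow> restr X A \<in> Obj C"
  using subspaces[of X A] by simp

text \<open>The subspace \<open>{0}\<close> of \<open>Z\<close> belongs to the category, so the endomorphism \<open>\<iota> \<cdot> \<iota>\<^sup>\<dagger>\<close> of \<open>Z\<close> takes values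
in \<open>{0}\<close>; but a zero object has no endomorphism besides the identity.\<close>
lemma zero_object_carrier:
  assumes "zero_object C Z" shows "carrier Z = {origin Z}"
proof -
  have Z: "Z \<in> Obj C" using assms by (simp add: zero_object_def)
  interpret Z: orthoset Z using Z by (rule obj_orthoset)
  let ?r = "emb Z {origin Z}"
  have r: "arr ?r" using Z by (simp add: Z.orthoclosed_origin)
  have "fn (?r \<cdot> ?r\<^sup>\<dagger>) \<in> Hom C Z Z" "fn (idn Z) \<in> Hom C Z Z"
    using arr_cmp[OF arr_dag[OF r] r] arr_idn[OF Z] by (auto simp: arr_def simp del: arr_Obj)
  then have eq: "fn (?r \<cdot> ?r\<^sup>\<dagger>) = fn (idn Z)"
    using assms Z unfolding zero_object_def by blast
  have "z = origin Z" if z: "z \<in> carrier Z" for z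
  proof -
    have "fn (?r\<^sup>\<dagger>) z \<in> {origin Z}"
      using fn_closed[OF arr_dag[OF r], of z] z by simp
    then have "fn (?r \<cdot> ?r\<^sup>\<dagger>) z = origin Z" using z by simp
    then show ?thesis using eq z by simp
  qed
  then show ?thesis using Z.origin_closed by blast
qed

lemma zero_map_fn:
  assumes XY: "X \<in> Obj C" "Y \<in> Obj C" and f: "zero_map C X Y f"
  shows "f = fn (zer X Y)"
proof -
  obtain Z g h where Z: "zero_object C Z" and g: "g \<in> Hom C X Z" and h: "h \<in> Hom C Z Y"
    and f: "f = compose (carrier X) h g"
    using f by (auto simp: zero_map_def)
  have ZO: "Z \<in> Obj C" using Z by (simp add: zero_object_def)
  have 1: "g \<in> carrier X \<rightarrow>\<^sub>E carrier Z" using hom_maps XY ZO g by blast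
  have h': "arr (Arrow Z Y h)" using h XY ZO by (simp add: arr_def del: arr_Obj)
  have "h (origin Z) = origin Y" using fn_origin[OF h'] by simp
  then show ?thesis
    using 1 zero_object_carrier[OF Z] by (auto simp: f zer_def compose_def intro!: restrict_ext)
qed

lemma arr_zer [simp]:
  assumes "X \<in> Obj C" "Y \<in> Obj C" shows "arr (zer X Y)"
proof -
  obtain Z where Z: "zero_object C Z" using biproducts by (auto simp: has_dagger_biproducts_def)
  then have ZO: "Z \<in> Obj C" by (simp add: zero_object_def)
  obtain g h where gh: "g \<in> Hom C X Z" "h \<in> Hom C Z Y"
    using Z assms unfolding zero_object_def by meson
  then have "zero_map C X Y (compose (carrier X) h g)" using Z by (auto simp: zero_map_def)
  then have "compose (carrier X) h g = fn (zer X Y)" using zero_map_fn assms by blast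
  then show ?thesis
    using hom_compose[OF assms(1) ZO assms(2) gh] assms by (simp add: arr_def del: arr_Obj)
qed

lemma zer_cmp [simp]: "arr f \<Longrightarrow> tgt f = X \<Longrightarrow> Y \<in> Obj C \<Longrightarrow> zer X Y \<cdot> f = zer (src f) Y"
  by (rule arr_eqI) auto

lemma cmp_zer [simp]: "arr f \<Longrightarrow> src f = Y \<Longrightarrow> X \<in> Obj C \<Longrightarrow> f \<cdot> zer X Y = zer X (tgt f)"
  using fn_origin by (intro arr_eqI) auto

lemma dag_zer [simp]:
  assumes "X \<in> Obj C" "Y \<in> Obj C" shows "(zer X Y)\<^sup>\<dagger> = zer Y X"
proof (rule arr_eqI)
  interpret X: orthoset X using assms(1) by (rule obj_orthoset)
  interpret Y: orthoset Y using assms(2) by (rule obj_orthoset)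
  fix y assume "y \<in> carrier (src ((zer X Y)\<^sup>\<dagger>))"
  then have y: "y \<in> carrier Y" by simp
  have c: "fn ((zer X Y)\<^sup>\<dagger>) y \<in> carrier X"
    using fn_closed[OF arr_dag[OF arr_zer[OF assms]], of y] y by simp
  have "orth X (fn ((zer X Y)\<^sup>\<dagger>) y) x" if "x \<in> carrier X" for x
    using adjoint[OF arr_zer[OF assms], of x y] that y by (auto simp: Y.origin_perp intro: X.perp_sym)
  then have "fn ((zer X Y)\<^sup>\<dagger>) y = origin X" using c by (intro X.perp_all_origin)
  then show "fn ((zer X Y)\<^sup>\<dagger>) y = fn (zer Y X) y" using y by simp
qed (use assms in auto)

text \<open>Dagger biproducts in terms of arrows, with the symmetric zero condition included and the zero maps
made explicit.\<close>
definition biprod :: "'a arrow \<Rightarrow> 'a arrow \<Rightarrow> bool"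
  where "biprod i j \<longleftrightarrow> arr i \<and> arr j \<and> tgt j = tgt i \<and>
    i\<^sup>\<dagger> \<cdot> i = idn (src i) \<and> j\<^sup>\<dagger> \<cdot> j = idn (src j) \<and>
    j\<^sup>\<dagger> \<cdot> i = zer (src i) (src j) \<and> i\<^sup>\<dagger> \<cdot> j = zer (src j) (src i) \<and>
    (\<forall>f g. arr f \<and> arr g \<and> src f = src i \<and> src g = src j \<and> tgt f = tgt g \<longrightarrow>
      (\<exists>!h. \<guillemotleft>h : tgt i \<rightarrow> tgt f\<guillemotright> \<and> h \<cdot> i = f \<and> h \<cdot> j = g))"

definition copair :: "'a arrow \<Rightarrow> 'a arrow \<Rightarrow> 'a arrow \<Rightarrow> 'a arrow \<Rightarrow> 'a arrow"
  where "copair i j f g = (THE h. \<guillemotleft>h : tgt i \<rightarrow> tgt f\<guillemotright> \<and> h \<cdot> i = f \<and> h \<cdot> j = g)"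

lemma isometry_arr:
  assumes "X \<in> Obj C" "Y \<in> Obj C"
  shows "isometry C X Y f \<longleftrightarrow> arr (Arrow X Y f) \<and> (Arrow X Y f)\<^sup>\<dagger> \<cdot> Arrow X Y f = idn X"
  using assms by (auto simp: isometry_def arr_def dag_def cmp_def idn_def simp del: arr_Obj)

lemma biprodI:
  assumes A: "A \<in> Obj C" and B: "B \<in> Obj C" and S: "dagger_biproduct C A B S i j"
  shows "biprod (Arrow A S i) (Arrow B S j)"
proof -
  let ?i = "Arrow A S i" and ?j = "Arrow B S j"
  have SO: "S \<in> Obj C" using S by (simp add: dagger_biproduct_def coproduct_def)
  have i: "arr ?i" "?i\<^sup>\<dagger> \<cdot> ?i = idn A" and j: "arr ?j" "?j\<^sup>\<dagger> \<cdot> ?j = idn B"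
    using S A B SO by (auto simp: dagger_biproduct_def isometry_arr)
  have "fn (?j\<^sup>\<dagger> \<cdot> ?i) = fn (zer A B)"
    using S zero_map_fn[OF A B] by (auto simp: dagger_biproduct_def cmp_def dag_def)
  then have z: "?j\<^sup>\<dagger> \<cdot> ?i = zer A B" by (intro arrow.expand) auto
  have "?i\<^sup>\<dagger> \<cdot> ?j = (?j\<^sup>\<dagger> \<cdot> ?i)\<^sup>\<dagger>" using i j by simp
  then have z': "?i\<^sup>\<dagger> \<cdot> ?j = zer B A" using A B by (simp add: z)
  have "\<exists>!h. \<guillemotleft>h : S \<rightarrow> tgt f\<guillemotright> \<and> h \<cdot> ?i = f \<and> h \<cdot> ?j = g"
    if fg: "arr f" "arr g" "src f = A" "src g = B" "tgt f = tgt g" for f g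
  proof -
    have "\<exists>!h. h \<in> Hom C S (tgt f) \<and> compose (carrier A) h i = fn f \<and> compose (carrier B) h j = fn g"
      using S fg unfolding dagger_biproduct_def coproduct_def arr_def by metis
    then obtain h where h: "h \<in> Hom C S (tgt f)" "compose (carrier A) h i = fn f"
        "compose (carrier B) h j = fn g"
      and u: "\<And>h'. h' \<in> Hom C S (tgt f) \<Longrightarrow> compose (carrier A) h' i = fn f \<Longrightarrow>
        compose (carrier B) h' j = fn g \<Longrightarrow> h' = h" by metis
    show ?thesis
    proof (rule ex1I[of _ "Arrow S (tgt f) h"])
      show "\<guillemotleft>Arrow S (tgt f) h : S \<rightarrow> tgt f\<guillemotright> \<and> Arrow S (tgt f) h \<cdot> ?i = f \<and> Arrow S (tgt f) h \<cdot> ?j = g"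
        using h SO fg arr_Obj(2)[OF fg(1)] by (auto simp: arr_def[of "Arrow _ _ _"] cmp_def intro!: arrow.expand simp del: arr_Obj)
    next
      fix k assume k: "\<guillemotleft>k : S \<rightarrow> tgt f\<guillemotright> \<and> k \<cdot> ?i = f \<and> k \<cdot> ?j = g"
      then have "fn k = h"
        by (intro u) (auto simp: arr_def cmp_def simp del: arr_Obj)
      then show "k = Arrow S (tgt f) h" using k by (intro arrow.expand) auto
    qed
  qed
  then show ?thesis using i j z z' by (auto simp: biprod_def)
qed

lemma biprod_exists:
  assumes "A \<in> Obj C" "B \<in> Obj C"
  shows "\<exists>i j. biprod i j \<and> src i = A \<and> src j = B"
proof -
  obtain S i j where "dagger_biproduct C A B S i j"
    using biproducts assms unfolding has_dagger_biproducts_def by blast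
  from biprodI[OF assms this] show ?thesis
    by (intro exI[of _ "Arrow A S i"] exI[of _ "Arrow B S j"]) auto
qed

lemma biprod_emb:
  assumes "X \<in> Obj C" "orthoclosed X A" shows "biprod (emb X A) (emb X (ocomp X A))"
  using subspaces[OF assms] biprodI unfolding emb_def by blast

lemma biprod_swap: "biprod i j \<Longrightarrow> biprod j i"
  unfolding biprod_def by (metis (no_types, lifting))

lemma biprodD [simp]:
  assumes "biprod i j"
  shows "arr i" "arr j" "tgt j = tgt i" "i\<^sup>\<dagger> \<cdot> i = idn (src i)" "j\<^sup>\<dagger> \<cdot> j = idn (src j)"
    "j\<^sup>\<dagger> \<cdot> i = zer (src i) (src j)" "i\<^sup>\<dagger> \<cdot> j = zer (src j) (src i)"
  using assms by (auto simp: biprod_def)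

lemma copair:
  assumes "biprod i j" "arr f" "arr g" "src f = src i" "src g = src j" "tgt f = tgt g"
  shows "\<guillemotleft>copair i j f g : tgt i \<rightarrow> tgt f\<guillemotright>" "copair i j f g \<cdot> i = f" "copair i j f g \<cdot> j = g"
proof -
  have "\<exists>!h. \<guillemotleft>h : tgt i \<rightarrow> tgt f\<guillemotright> \<and> h \<cdot> i = f \<and> h \<cdot> j = g"
    using assms unfolding biprod_def by blast
  from theI'[OF this]
  show "\<guillemotleft>copair i j f g : tgt i \<rightarrow> tgt f\<guillemotright>" "copair i j f g \<cdot> i = f" "copair i j f g \<cdot> j = g"
    unfolding copair_def by blast+
qed

lemma biprod_epi:
  assumes b: "biprod i j" and h: "arr h" "arr k" "src h = tgt i" "src k = tgt i" "tgt h = tgt k"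
    and eq: "h \<cdot> i = k \<cdot> i" "h \<cdot> j = k \<cdot> j"
  shows "h = k"
proof -
  have "\<exists>!l. \<guillemotleft>l : tgt i \<rightarrow> tgt (k \<cdot> i)\<guillemotright> \<and> l \<cdot> i = k \<cdot> i \<and> l \<cdot> j = k \<cdot> j"
  proof -
    have "arr (k \<cdot> i) \<and> arr (k \<cdot> j) \<and> src (k \<cdot> i) = src i \<and> src (k \<cdot> j) = src j \<and> tgt (k \<cdot> i) = tgt (k \<cdot> j)"
      using h biprodD(1-3)[OF b] by simp
    then show ?thesis using b unfolding biprod_def by blast
  qed
  then obtain l where "\<And>h'. \<guillemotleft>h' : tgt i \<rightarrow> tgt k\<guillemotright> \<and> h' \<cdot> i = k \<cdot> i \<and> h' \<cdot> j = k \<cdot> j \<Longrightarrow> h' = l"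
    by (metis (lifting) cmp_simps(2))
  then show ?thesis using h eq by metis
qed

lemma biprod_mono:
  assumes b: "biprod i j" and h: "arr h" "arr k" "tgt h = tgt i" "tgt k = tgt i" "src h = src k"
    and eq: "i\<^sup>\<dagger> \<cdot> h = i\<^sup>\<dagger> \<cdot> k" "j\<^sup>\<dagger> \<cdot> h = j\<^sup>\<dagger> \<cdot> k"
  shows "h = k"
proof -
  have 1: "h\<^sup>\<dagger> \<cdot> i = k\<^sup>\<dagger> \<cdot> i" and 2: "h\<^sup>\<dagger> \<cdot> j = k\<^sup>\<dagger> \<cdot> j"
    using arg_cong[OF eq(1), of dag] arg_cong[OF eq(2), of dag] biprodD[OF b] h by simp_all
  have "h\<^sup>\<dagger> = k\<^sup>\<dagger>" by (rule biprod_epi[OF b _ _ _ _ _ 1 2]) (use h in auto)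
  from arg_cong[OF this, of dag] show ?thesis using h by simp
qed

definition chosen_biprod :: "'a orthoset \<Rightarrow> 'a orthoset \<Rightarrow> 'a arrow \<times> 'a arrow"
  where "chosen_biprod A B = (SOME p. biprod (fst p) (snd p) \<and> src (fst p) = A \<and> src (snd p) = B)"

abbreviation inl :: "'a orthoset \<Rightarrow> 'a orthoset \<Rightarrow> 'a arrow" where "inl A B \<equiv> fst (chosen_biprod A B)"
abbreviation inr :: "'a orthoset \<Rightarrow> 'a orthoset \<Rightarrow> 'a arrow" where "inr A B \<equiv> snd (chosen_biprod A B)"

lemma chosen_biprod:
  assumes "A \<in> Obj C" "B \<in> Obj C"
  shows "biprod (inl A B) (inr A B)" "src (inl A B) = A" "src (inr A B) = B"
proof -
  have "\<exists>p. biprod (fst p) (snd p) \<and> src (fst p) = A \<and> src (snd p) = B"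
    using biprod_exists[OF assms] by auto
  from someI_ex[OF this]
  show "biprod (inl A B) (inr A B)" "src (inl A B) = A" "src (inr A B) = B"
    by (auto simp: chosen_biprod_def)
qed

text \<open>The usual addition in a category with biproducts: \<open>[f, g]\<close> after the diagonal, where the diagonal is
the dagger of the codiagonal \<open>[1, 1]\<close>.\<close>
definition hom_plus :: "'a arrow \<Rightarrow> 'a arrow \<Rightarrow> 'a arrow" (infixl "\<boxplus>" 65)
  where "f \<boxplus> g = copair (inl (src f) (src f)) (inr (src f) (src f)) f g \<cdot>
    (copair (inl (src f) (src f)) (inr (src f) (src f)) (idn (src f)) (idn (src f)))\<^sup>\<dagger>"

lemma add_simps [simp]:
  assumes "arr f" "arr g" "src g = src f" "tgt g = tgt f"
  shows "arr (f \<boxplus> g)" "src (f \<boxplus> g) = src f" "tgt (f \<boxplus> g) = tgt f"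
proof -
  define A where "A = src f"
  have A: "A \<in> Obj C" using assms by (simp add: A_def)
  note b = chosen_biprod[OF A A]
  show "arr (f \<boxplus> g)" "src (f \<boxplus> g) = src f" "tgt (f \<boxplus> g) = tgt f"
    using copair[OF b(1), of f g] copair[OF b(1), of "idn A" "idn A"] b assms A
    by (auto simp: hom_plus_def A_def[symmetric])
qed

text \<open>All properties of the addition rest on this expansion of a composite through the middle object of
an arbitrary biproduct. The arrow \<open>w = [i \<cdot> i\<^sup>\<dagger> \<cdot> q, j \<cdot> j\<^sup>\<dagger> \<cdot> q]\<close> is defined so that \<open>p \<cdot> w\<close> is the copairing in
the definition of the right-hand side, and it composes with the diagonal to \<open>q\<close>, as is seen
after composition with \<open>i\<^sup>\<dagger>\<close> and with \<open>j\<^sup>\<dagger>\<close>.\<close>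
lemma cmp_eq_add:
  assumes b: "biprod i j" and p: "arr p" "src p = tgt i" and q: "arr q" "tgt q = tgt i"
  shows "p \<cdot> q = (p \<cdot> i) \<cdot> (i\<^sup>\<dagger> \<cdot> q) \<boxplus> (p \<cdot> j) \<cdot> (j\<^sup>\<dagger> \<cdot> q)"
proof -
  note [simp] = biprodD[OF b] p q
  define A where "A = src q"
  have A [simp]: "A \<in> Obj C" "src q = A" by (simp_all add: A_def)
  define i' j' where "i' = inl A A" and "j' = inr A A"
  have b': "biprod i' j'" and [simp]: "src i' = A" "src j' = A" using chosen_biprod[of A A] by (auto simp: i'_def j'_def)
  note [simp] = biprodD[OF b']
  define d where "d = copair i' j' (idn A) (idn A)"
  have [simp]: "arr d" "src d = tgt i'" "tgt d = A" "d \<cdot> i' = idn A" "d \<cdot> j' = idn A"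
    using copair[OF b', of "idn A" "idn A"] by (auto simp: d_def)
  have [simp]: "i'\<^sup>\<dagger> \<cdot> d\<^sup>\<dagger> = idn A" "j'\<^sup>\<dagger> \<cdot> d\<^sup>\<dagger> = idn A"
    using dag_cmp[of i' d] dag_cmp[of j' d] by auto
  define w where "w = copair i' j' (i \<cdot> i\<^sup>\<dagger> \<cdot> q) (j \<cdot> j\<^sup>\<dagger> \<cdot> q)"
  have [simp]: "arr w" "src w = tgt i'" "tgt w = tgt i" and wi: "w \<cdot> i' = i \<cdot> i\<^sup>\<dagger> \<cdot> q" "w \<cdot> j' = j \<cdot> j\<^sup>\<dagger> \<cdot> q"
    using copair[OF b', of "i \<cdot> i\<^sup>\<dagger> \<cdot> q" "j \<cdot> j\<^sup>\<dagger> \<cdot> q"] by (auto simp: w_def)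
  have [simp]: "i\<^sup>\<dagger> \<cdot> i \<cdot> x = x" "j\<^sup>\<dagger> \<cdot> i \<cdot> x = zer (src x) (src j)" if "arr x" "tgt x = src i" for x
    using that cmp_assoc[of x i "i\<^sup>\<dagger>"] cmp_assoc[of x i "j\<^sup>\<dagger>"] by auto
  have [simp]: "j\<^sup>\<dagger> \<cdot> j \<cdot> x = x" "i\<^sup>\<dagger> \<cdot> j \<cdot> x = zer (src x) (src i)" if "arr x" "tgt x = src j" for x
    using that cmp_assoc[of x j "j\<^sup>\<dagger>"] cmp_assoc[of x j "i\<^sup>\<dagger>"] by auto
  have "i\<^sup>\<dagger> \<cdot> w = (i\<^sup>\<dagger> \<cdot> q) \<cdot> i'\<^sup>\<dagger>"
    by (rule biprod_epi[OF b']) (simp_all add: wi)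
  then have 1: "i\<^sup>\<dagger> \<cdot> (w \<cdot> d\<^sup>\<dagger>) = i\<^sup>\<dagger> \<cdot> q"
    using cmp_assoc[of "d\<^sup>\<dagger>" w "i\<^sup>\<dagger>"] by simp
  have "j\<^sup>\<dagger> \<cdot> w = (j\<^sup>\<dagger> \<cdot> q) \<cdot> j'\<^sup>\<dagger>"
    by (rule biprod_epi[OF b']) (simp_all add: wi)
  then have 2: "j\<^sup>\<dagger> \<cdot> (w \<cdot> d\<^sup>\<dagger>) = j\<^sup>\<dagger> \<cdot> q"
    using cmp_assoc[of "d\<^sup>\<dagger>" w "j\<^sup>\<dagger>"] by simp
  have wd: "w \<cdot> d\<^sup>\<dagger> = q"
    by (rule biprod_mono[OF b]) (simp_all add: 1 2)
  let ?f = "(p \<cdot> i) \<cdot> (i\<^sup>\<dagger> \<cdot> q)" and ?g = "(p \<cdot> j) \<cdot> (j\<^sup>\<dagger> \<cdot> q)"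
  have "copair i' j' ?f ?g = p \<cdot> w"
    by (rule biprod_epi[OF b']) (use copair[OF b', of ?f ?g] in \<open>simp_all add: wi\<close>)
  then have "?f \<boxplus> ?g = (p \<cdot> w) \<cdot> d\<^sup>\<dagger>"
    by (simp add: hom_plus_def i'_def[symmetric] j'_def[symmetric] d_def[symmetric])
  then show ?thesis using wd by simp
qed

lemma add_decomp:
  assumes "arr f" "arr g" "src g = src f" "tgt g = tgt f"
  obtains i j p d where "biprod i j" "src i = src f" "src j = src f" "\<guillemotleft>p : tgt i \<rightarrow> tgt f\<guillemotright>"
    "\<guillemotleft>d : tgt i \<rightarrow> src f\<guillemotright>" "p \<cdot> i = f" "p \<cdot> j = g" "i\<^sup>\<dagger> \<cdot> d\<^sup>\<dagger> = idn (src f)" "j\<^sup>\<dagger> \<cdot> d\<^sup>\<dagger> = idn (src f)"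
    "d \<cdot> i = idn (src f)" "d \<cdot> j = idn (src f)" "f \<boxplus> g = p \<cdot> d\<^sup>\<dagger>"
proof -
  define A where "A = src f"
  have A [simp]: "A \<in> Obj C" "src f = A" using assms by (simp_all add: A_def)
  define i j where "i = inl A A" and "j = inr A A"
  have b: "biprod i j" and [simp]: "src i = A" "src j = A" using chosen_biprod[of A A] by (auto simp: i_def j_def)
  note [simp] = biprodD[OF b] assms
  define d where "d = copair i j (idn A) (idn A)"
  have [simp]: "arr d" "src d = tgt i" "tgt d = A" "d \<cdot> i = idn A" "d \<cdot> j = idn A"
    using copair[OF b, of "idn A" "idn A"] by (auto simp: d_def)
  have "i\<^sup>\<dagger> \<cdot> d\<^sup>\<dagger> = idn A" "j\<^sup>\<dagger> \<cdot> d\<^sup>\<dagger> = idn A"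
    using dag_cmp[of i d] dag_cmp[of j d] by auto
  then show ?thesis
    using that[of i j "copair i j f g" d] b copair[OF b, of f g]
    by (simp add: hom_plus_def i_def[symmetric] j_def[symmetric] d_def[symmetric])
qed

lemma add_cmp:
  assumes fg: "arr f" "arr g" "src g = src f" "tgt g = tgt f" and r: "arr r" "tgt r = src f"
  shows "(f \<boxplus> g) \<cdot> r = f \<cdot> r \<boxplus> g \<cdot> r"
proof (rule add_decomp[OF fg])
  fix i j p d assume b: "biprod i j" and h: "src i = src f" "src j = src f" "\<guillemotleft>p : tgt i \<rightarrow> tgt f\<guillemotright>"
    "\<guillemotleft>d : tgt i \<rightarrow> src f\<guillemotright>" "p \<cdot> i = f" "p \<cdot> j = g" "i\<^sup>\<dagger> \<cdot> d\<^sup>\<dagger> = idn (src f)" "j\<^sup>\<dagger> \<cdot> d\<^sup>\<dagger> = idn (src f)"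
    "f \<boxplus> g = p \<cdot> d\<^sup>\<dagger>"
  note [simp] = biprodD[OF b]
  have "i\<^sup>\<dagger> \<cdot> d\<^sup>\<dagger> \<cdot> r = r" "j\<^sup>\<dagger> \<cdot> d\<^sup>\<dagger> \<cdot> r = r"
    using h r cmp_assoc[of r "d\<^sup>\<dagger>" "i\<^sup>\<dagger>"] cmp_assoc[of r "d\<^sup>\<dagger>" "j\<^sup>\<dagger>"] by auto
  moreover have "(f \<boxplus> g) \<cdot> r = p \<cdot> (d\<^sup>\<dagger> \<cdot> r)" using h r by simp
  ultimately show ?thesis
    using cmp_eq_add[OF b, of p "d\<^sup>\<dagger> \<cdot> r"] h r by (simp del: cmp_assoc)
qed

lemma cmp_add:
  assumes fg: "arr f" "arr g" "src g = src f" "tgt g = tgt f" and r: "arr r" "src r = tgt f"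
  shows "r \<cdot> (f \<boxplus> g) = r \<cdot> f \<boxplus> r \<cdot> g"
proof (rule add_decomp[OF fg])
  fix i j p d assume b: "biprod i j" and h: "src i = src f" "src j = src f" "\<guillemotleft>p : tgt i \<rightarrow> tgt f\<guillemotright>"
    "\<guillemotleft>d : tgt i \<rightarrow> src f\<guillemotright>" "p \<cdot> i = f" "p \<cdot> j = g" "i\<^sup>\<dagger> \<cdot> d\<^sup>\<dagger> = idn (src f)" "j\<^sup>\<dagger> \<cdot> d\<^sup>\<dagger> = idn (src f)"
    "f \<boxplus> g = p \<cdot> d\<^sup>\<dagger>"
  note [simp] = biprodD[OF b]
  have "(r \<cdot> p) \<cdot> i = r \<cdot> f" "(r \<cdot> p) \<cdot> j = r \<cdot> g"
    using h by auto
  moreover have "r \<cdot> (f \<boxplus> g) = (r \<cdot> p) \<cdot> d\<^sup>\<dagger>" using h r by simp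
  ultimately show ?thesis
    using cmp_eq_add[OF b, of "r \<cdot> p" "d\<^sup>\<dagger>"] h r fg by (simp del: cmp_assoc)
qed

lemma dag_add:
  assumes fg: "arr f" "arr g" "src g = src f" "tgt g = tgt f"
  shows "(f \<boxplus> g)\<^sup>\<dagger> = f\<^sup>\<dagger> \<boxplus> g\<^sup>\<dagger>"
proof (rule add_decomp[OF fg])
  fix i j p d assume b: "biprod i j" and h: "src i = src f" "src j = src f" "\<guillemotleft>p : tgt i \<rightarrow> tgt f\<guillemotright>"
    "\<guillemotleft>d : tgt i \<rightarrow> src f\<guillemotright>" "p \<cdot> i = f" "p \<cdot> j = g" "d \<cdot> i = idn (src f)" "d \<cdot> j = idn (src f)"
    "f \<boxplus> g = p \<cdot> d\<^sup>\<dagger>"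
  note [simp] = biprodD[OF b]
  have "i\<^sup>\<dagger> \<cdot> p\<^sup>\<dagger> = f\<^sup>\<dagger>" "j\<^sup>\<dagger> \<cdot> p\<^sup>\<dagger> = g\<^sup>\<dagger>" using h dag_cmp[of i p] dag_cmp[of j p] by auto
  moreover have "(f \<boxplus> g)\<^sup>\<dagger> = d \<cdot> p\<^sup>\<dagger>" using h by simp
  ultimately show ?thesis
    using cmp_eq_add[OF b, of d "p\<^sup>\<dagger>"] h fg by simp
qed

lemma add_commute:
  assumes fg: "arr f" "arr g" "src g = src f" "tgt g = tgt f"
  shows "f \<boxplus> g = g \<boxplus> f"
proof (rule add_decomp[OF fg])
  fix i j p d assume b: "biprod i j" and h: "src i = src f" "src j = src f" "\<guillemotleft>p : tgt i \<rightarrow> tgt f\<guillemotright>"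
    "\<guillemotleft>d : tgt i \<rightarrow> src f\<guillemotright>" "p \<cdot> i = f" "p \<cdot> j = g" "i\<^sup>\<dagger> \<cdot> d\<^sup>\<dagger> = idn (src f)" "j\<^sup>\<dagger> \<cdot> d\<^sup>\<dagger> = idn (src f)"
    "f \<boxplus> g = p \<cdot> d\<^sup>\<dagger>"
  note [simp] = biprodD[OF b]
  show ?thesis
    using cmp_eq_add[OF biprod_swap[OF b], of p "d\<^sup>\<dagger>"] h fg by simp
qed

lemma add_zer [simp]:
  assumes f: "arr f" "src f = X" "tgt f = Y"
  shows "f \<boxplus> zer X Y = f" "zer X Y \<boxplus> f = f"
proof -
  have X: "X \<in> Obj C" "Y \<in> Obj C" using f by auto
  define i j where "i = inl X X" and "j = inr X X"
  have b: "biprod i j" and [simp]: "src i = X" "src j = X" using chosen_biprod[of X X] X by (auto simp: i_def j_def)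
  note [simp] = biprodD[OF b]
  have "(f \<cdot> i\<^sup>\<dagger>) \<cdot> i = f" "(f \<cdot> i\<^sup>\<dagger>) \<cdot> j = zer X Y" using f X by auto
  then have "(f \<cdot> i\<^sup>\<dagger>) \<cdot> i = f \<boxplus> zer X Y"
    using cmp_eq_add[OF b, of "f \<cdot> i\<^sup>\<dagger>" "i"] f X by (simp del: cmp_assoc)
  then show "f \<boxplus> zer X Y = f" using f X by simp
  then show "zer X Y \<boxplus> f = f" using add_commute[of f "zer X Y"] f X by simp
qed

text \<open>The Eckmann-Hilton argument: copairing is additive, hence sums may be interchanged, and
associativity is the case in which one summand is zero.\<close>
lemma add_interchange:
  assumes "arr a" "arr b" "arr c" "arr d" "src b = src a" "src c = src a" "src d = src a"
    "tgt b = tgt a" "tgt c = tgt a" "tgt d = tgt a"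
  shows "(a \<boxplus> b) \<boxplus> (c \<boxplus> d) = (a \<boxplus> c) \<boxplus> (b \<boxplus> d)"
proof -
  define A where "A = src a"
  have A [simp]: "A \<in> Obj C" "src a = A" using assms by (simp_all add: A_def)
  note [simp] = assms
  define i j where "i = inl A A" and "j = inr A A"
  have bp: "biprod i j" and [simp]: "src i = A" "src j = A" using chosen_biprod[of A A] by (auto simp: i_def j_def)
  note [simp] = biprodD[OF bp]
  define e where "e = copair i j (idn A) (idn A)"
  have [simp]: "arr e" "src e = tgt i" "tgt e = A"
    using copair[OF bp, of "idn A" "idn A"] by (auto simp: e_def)
  have plus: "f \<boxplus> g = copair i j f g \<cdot> e\<^sup>\<dagger>" if "src f = A" for f g
    using that by (simp add: hom_plus_def i_def[symmetric] j_def[symmetric] e_def[symmetric])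
  note ab = copair[OF bp, of a b] and cd = copair[OF bp, of c d] and acbd = copair[OF bp, of "a \<boxplus> c" "b \<boxplus> d"]
  have "copair i j a b \<boxplus> copair i j c d = copair i j (a \<boxplus> c) (b \<boxplus> d)"
    by (rule biprod_epi[OF bp]) (use ab cd acbd in \<open>simp_all add: add_cmp\<close>)
  then have "(a \<boxplus> c) \<boxplus> (b \<boxplus> d) = (copair i j a b \<boxplus> copair i j c d) \<cdot> e\<^sup>\<dagger>"
    by (simp add: plus)
  also have "\<dots> = (a \<boxplus> b) \<boxplus> (c \<boxplus> d)"
    using ab cd by (subst add_cmp) (simp_all add: plus)
  finally show ?thesis by simp
qed

lemma add_assoc:
  assumes "arr a" "arr b" "arr c" "src b = src a" "src c = src a" "tgt b = tgt a" "tgt c = tgt a"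
  shows "(a \<boxplus> b) \<boxplus> c = a \<boxplus> (b \<boxplus> c)"
  using add_interchange[of a b "zer (src a) (tgt a)" c] assms by simp

lemma biprod_idn:
  assumes b: "biprod i j" shows "i \<cdot> i\<^sup>\<dagger> \<boxplus> j \<cdot> j\<^sup>\<dagger> = idn (tgt i)"
  using cmp_eq_add[OF b, of "idn (tgt i)" "idn (tgt i)"] biprodD[OF b] by simp

end

section \<open>A unital object and its endomorphisms\<close>

locale unit_orthocat = splitting_orthocat C for C :: "'a orthocat" +
  fixes U :: "'a orthoset" and e :: 'a
  assumes unital_simple: "\<lbrakk>X \<in> Obj C; unital X\<rbrakk> \<Longrightarrow> dagger_simple C X"
    and unital_iso: "\<lbrakk>X \<in> Obj C; Y \<in> Obj C; unital X; unital Y\<rbrakk> \<Longrightarrow> \<exists>f. dagger_iso C X Y f"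
    and U [simp]: "U \<in> Obj C"
    and e: "proper U e"
    and unital_U: "unital U"
begin

lemma dagger_iso_arr:
  assumes "X \<in> Obj C" "Y \<in> Obj C"
  shows "dagger_iso C X Y f \<longleftrightarrow> arr (Arrow X Y f) \<and> (Arrow X Y f)\<^sup>\<dagger> \<cdot> Arrow X Y f = idn X
    \<and> Arrow X Y f \<cdot> (Arrow X Y f)\<^sup>\<dagger> = idn Y"
  using assms isometry_arr[OF assms, of f]
  by (auto simp: dagger_iso_def dag_def cmp_def idn_def simp del: arr_Obj)

text \<open>The closure of a proper \<open>y\<close> is a nonzero object whose inclusion into \<open>W\<close> is an isometry. Dagger
simplicity makes it an isomorphism, so that \<open>{y}\<^sup>\<bottom>\<^sup>\<bottom> = W\<close>.\<close>
lemma unital_perp: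
  assumes W: "W \<in> Obj C" "unital W" and y: "proper W y" and xy: "orth W x y"
  shows "x = origin W"
proof -
  interpret W: orthoset W using W obj_orthoset by simp
  define A where "A = ocomp W (ocomp W {y})"
  have yW: "{y} \<subseteq> carrier W" using y by (simp add: proper_def)
  have A: "orthoclosed W A" unfolding A_def by (rule W.orthoclosed_ocomp[OF W.ocomp_subset])
  have yA: "y \<in> A" using W.subset_ocomp_ocomp[OF yW] by (simp add: A_def)
  have "\<not> zero_object C (restr W A)"
    using zero_object_carrier[of "restr W A"] yA y by (auto simp: proper_def)
  moreover have "isometry C (restr W A) W (incl A)"
    using biprodD(4)[OF biprod_emb[OF W(1) A]] arr_emb[OF W(1) A] W(1) A
    by (subst isometry_arr) (auto simp: emb_def)
  ultimately have "dagger_iso C (restr W A) W (incl A)"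
    using unital_simple[OF W] W(1) A by (auto simp: dagger_simple_def)
  then have iso: "emb W A \<cdot> (emb W A)\<^sup>\<dagger> = idn W"
    using W A by (simp add: dagger_iso_arr emb_def)
  have "w \<in> A" if "w \<in> carrier W" for w
  proof -
    have "fn ((emb W A)\<^sup>\<dagger>) w \<in> A"
      using fn_closed[OF arr_dag[OF arr_emb[OF W(1) A]], of w] that by simp
    moreover have "fn (emb W A \<cdot> (emb W A)\<^sup>\<dagger>) w = w" using iso that by simp
    ultimately show ?thesis using that by simp
  qed
  then have "A = carrier W" using W.orthoclosed_subset[OF A] by blast
  then have "ocomp W {y} = {origin W}"
    using W.ocomp3[OF yW] by (simp add: A_def W.ocomp_carrier)
  moreover have "x \<in> ocomp W {y}" using xy W.perp_carrier by (auto simp: ocomp_def)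
  ultimately show ?thesis by simp
qed

lemma e_closed [simp]: "e \<in> carrier U" and e_proper [simp]: "e \<noteq> origin U"
  using e by (auto simp: proper_def)

lemma U_perp: "proper U y \<Longrightarrow> orth U x y \<Longrightarrow> x = origin U"
  by (rule unital_perp[OF U unital_U])

lemma U_parallel: assumes "proper U x" "proper U y" shows "parallel U x y"
proof -
  interpret U: orthoset U by (rule obj_orthoset) simp
  have "orth U z y" if "proper U x" "proper U y" "orth U z x" for x y z
    using U_perp[OF that(1,3)] that(2) by (simp add: proper_def U.origin_perp)
  then show ?thesis using assms by (intro U.parallelI) blast
qed

text \<open>If \<open>f x = 0\<close>, then every value of \<open>f\<^sup>\<dagger>\<close> is orthogonal to the proper element \<open>x\<close> of \<open>U\<close>, so \<open>f\<^sup>\<dagger>\<close> and with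
it \<open>f\<close> vanish. A morphism from \<open>U\<close> is thus tested at the single element \<open>e\<close>.\<close>
lemma zer_if_fn_origin:
  assumes f: "arr f" "src f = U" and x: "proper U x" "fn f x = origin (tgt f)"
  shows "f = zer U (tgt f)"
proof (rule arr_eqI)
  interpret U: orthoset U by (rule obj_orthoset) simp
  interpret T: orthoset "tgt f" using f by (intro obj_orthoset) simp
  have x': "x \<in> carrier U" using x by (simp add: proper_def)
  have fd: "fn (f\<^sup>\<dagger>) y = origin U" if "y \<in> carrier (tgt f)" for y
  proof -
    have "orth U x (fn (f\<^sup>\<dagger>) y)"
      using adjoint[OF f(1), of x y] f x x' that T.origin_perp by simp
    then show ?thesis using U_perp[OF x(1)] U.perp_sym by blast
  qed
  fix z assume "z \<in> carrier (src f)"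
  then have z: "z \<in> carrier U" using f by simp
  have "orth (tgt f) (fn f z) y" if "y \<in> carrier (tgt f)" for y
    using adjoint[OF f(1), of z y] fd[OF that] that z f U.perp_origin by simp
  then have "fn f z = origin (tgt f)" using f z by (intro T.perp_all_origin) auto
  then show "fn f z = fn (zer U (tgt f)) z" using z by simp
qed (use f in auto)

lemma zer_iff:
  assumes "\<guillemotleft>f : U \<rightarrow> X\<guillemotright>" shows "f = zer U X \<longleftrightarrow> fn f e = origin X"
proof
  show "fn f e = origin X" if "f = zer U X" using that by simp
  show "f = zer U X" if "fn f e = origin X" using zer_if_fn_origin[of f e] e assms that by simp
qed

lemma idn_neq_zer [simp]: "idn U \<noteq> zer U U"
  using zer_iff[of "idn U" U] by simp

lemma fn_e_proper: "\<guillemotleft>f : U \<rightarrow> X\<guillemotright> \<Longrightarrow> f \<noteq> zer U X \<Longrightarrow> proper X (fn f e)"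
  using zer_iff[of f X] fn_closed[of f e] by (simp add: proper_def)

lemma cmp_eq_zer:
  assumes f: "\<guillemotleft>f : U \<rightarrow> X\<guillemotright>" and r: "\<guillemotleft>r : U \<rightarrow> U\<guillemotright>" and fr: "f \<cdot> r = zer U X"
  shows "f = zer U X \<or> r = zer U U"
proof -
  have "f = zer U X" if "r \<noteq> zer U U"
  proof -
    have "fn f (fn r e) = fn (f \<cdot> r) e" using r by simp
    then have "fn f (fn r e) = origin X" using fr by simp
    then show ?thesis using zer_if_fn_origin[of f "fn r e"] fn_e_proper[OF r that] f by simp
  qed
  then show ?thesis by blast
qed

lemma fn_scalar_parallel:
  assumes f: "\<guillemotleft>f : U \<rightarrow> X\<guillemotright>" and r: "\<guillemotleft>r : U \<rightarrow> U\<guillemotright>" "r \<noteq> zer U U"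
  shows "parallel X (fn (f \<cdot> r) e) (fn f e)"
  using fn_parallel[of f "fn r e" e] U_parallel[OF fn_e_proper[OF r] e] fn_closed[of r e] f r by auto

text \<open>The bridge between orthogonality of elements and the form on vectors.\<close>
lemma perp_iff:
  assumes f: "\<guillemotleft>f : U \<rightarrow> X\<guillemotright>" and g: "\<guillemotleft>g : U \<rightarrow> X\<guillemotright>"
  shows "orth X (fn f e) (fn g e) \<longleftrightarrow> g\<^sup>\<dagger> \<cdot> f = zer U U"
proof -
  interpret U: orthoset U by (rule obj_orthoset) simp
  have c: "fn (g\<^sup>\<dagger> \<cdot> f) e \<in> carrier U" using f g fn_closed[of "g\<^sup>\<dagger> \<cdot> f" e] by simp
  have "orth X (fn f e) (fn g e) \<longleftrightarrow> orth U (fn (g\<^sup>\<dagger> \<cdot> f) e) e"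
    using adjoint'[of g e "fn f e"] fn_closed[of f e] f g by simp
  also have "\<dots> \<longleftrightarrow> fn (g\<^sup>\<dagger> \<cdot> f) e = origin U"
    using U_perp[OF e] U.origin_perp by auto
  also have "\<dots> \<longleftrightarrow> g\<^sup>\<dagger> \<cdot> f = zer U U" using zer_iff[of "g\<^sup>\<dagger> \<cdot> f" U] f g by simp
  finally show ?thesis .
qed

lemma emb_dag_origin:
  assumes X: "X \<in> Obj C" "orthoclosed X A" and x: "x \<in> ocomp X A"
  shows "fn ((emb X A)\<^sup>\<dagger>) x = origin X"
proof -
  interpret X: orthoset X using X obj_orthoset by simp
  interpret A: orthoset "restr X A" using X by (intro obj_orthoset) simp
  have x': "x \<in> carrier X" using x by (simp add: ocomp_def)
  have "fn ((emb X A)\<^sup>\<dagger>) x \<in> carrier (restr X A)"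
    using X x' fn_closed[of "(emb X A)\<^sup>\<dagger>" x] by simp
  moreover have "orth (restr X A) (fn ((emb X A)\<^sup>\<dagger>) x) a" if "a \<in> carrier (restr X A)" for a
    using adjoint'[of "emb X A" a x] that X x x' by (auto simp: ocomp_def)
  ultimately show ?thesis using A.perp_all_origin by force
qed

text \<open>The component of \<open>g\<close> in \<open>A\<^sup>\<bottom>\<close> vanishes at \<open>e\<close>, hence everywhere.\<close>
lemma factor_through_subspace:
  assumes X: "X \<in> Obj C" "orthoclosed X A" and g: "\<guillemotleft>g : U \<rightarrow> X\<guillemotright>" "fn g e \<in> A"
  shows "emb X A \<cdot> (emb X A)\<^sup>\<dagger> \<cdot> g = g"
proof -
  interpret X: orthoset X using X obj_orthoset by simp
  let ?B = "ocomp X A"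
  have B: "orthoclosed X ?B" using X X.orthoclosed_ocomp X.orthoclosed_subset by blast
  have "fn ((emb X ?B)\<^sup>\<dagger>) (fn g e) = origin X"
    using emb_dag_origin[OF X(1) B, of "fn g e"] g(2) X(2) by (simp add: orthoclosed_def)
  then have 0: "(emb X ?B)\<^sup>\<dagger> \<cdot> g = zer U (restr X ?B)"
    using X B g by (subst zer_iff) auto
  have "g = (emb X A \<cdot> (emb X A)\<^sup>\<dagger> \<boxplus> emb X ?B \<cdot> (emb X ?B)\<^sup>\<dagger>) \<cdot> g"
    using biprod_idn[OF biprod_emb[OF X]] g X by simp
  also have "\<dots> = emb X A \<cdot> (emb X A)\<^sup>\<dagger> \<cdot> g"
    using X B g 0 by (subst add_cmp) auto
  finally show ?thesis by simp
qed

text \<open>The isometry is the composite of a dagger isomorphism from \<open>U\<close> onto the unital object \<open>{x}\<^sup>\<bottom>\<^sup>\<bottom>\<close> with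
the inclusion of the latter into \<open>X\<close>.\<close>
lemma line_isometry:
  assumes X: "X \<in> Obj C" and x: "proper X x"
  obtains v where "\<guillemotleft>v : U \<rightarrow> X\<guillemotright>" "v\<^sup>\<dagger> \<cdot> v = idn U" "parallel X (fn v e) x"
    "\<And>g. \<guillemotleft>g : U \<rightarrow> X\<guillemotright> \<Longrightarrow> fn g e \<in> ocomp X (ocomp X {x}) \<Longrightarrow> v \<cdot> v\<^sup>\<dagger> \<cdot> g = g"
proof -
  interpret X: orthoset X using X obj_orthoset by simp
  define A where "A = ocomp X (ocomp X {x})"
  have A: "orthoclosed X A" unfolding A_def by (rule X.orthoclosed_ocomp[OF X.ocomp_subset])
  have xA: "x \<in> A" using x X.subset_ocomp_ocomp[of "{x}"] by (auto simp: proper_def A_def)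
  have unA: "unital (restr X A)" using X.unital_restr[OF x] by (simp add: A_def)
  obtain u' where u': "dagger_iso C U (restr X A) u'" using unital_iso[OF _ _ unital_U unA] X A by auto
  define u where "u = Arrow U (restr X A) u'"
  have u: "\<guillemotleft>u : U \<rightarrow> restr X A\<guillemotright>" "u\<^sup>\<dagger> \<cdot> u = idn U" "u \<cdot> u\<^sup>\<dagger> = idn (restr X A)"
    using dagger_iso_arr[of U "restr X A" u'] u' X A by (auto simp: u_def)
  define i where "i = emb X A"
  have i: "\<guillemotleft>i : restr X A \<rightarrow> X\<guillemotright>" "i\<^sup>\<dagger> \<cdot> i = idn (restr X A)"
    using biprodD(4)[OF biprod_emb[OF X A]] X A by (auto simp: i_def)
  define v where "v = i \<cdot> u"
  have v: "\<guillemotleft>v : U \<rightarrow> X\<guillemotright>" using u i by (simp add: v_def)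
  have "i\<^sup>\<dagger> \<cdot> i \<cdot> u = u" using u i cmp_assoc[of u i "i\<^sup>\<dagger>"] by simp
  then have vv: "v\<^sup>\<dagger> \<cdot> v = idn U" using u i by (simp add: v_def)
  have fac: "v \<cdot> v\<^sup>\<dagger> \<cdot> g = g" if g: "\<guillemotleft>g : U \<rightarrow> X\<guillemotright>" "fn g e \<in> A" for g
  proof -
    have "u \<cdot> u\<^sup>\<dagger> \<cdot> i\<^sup>\<dagger> \<cdot> g = i\<^sup>\<dagger> \<cdot> g"
      using u i g cmp_assoc[of "i\<^sup>\<dagger> \<cdot> g" "u\<^sup>\<dagger>" u] by simp
    then show ?thesis using factor_through_subspace[OF X A g] u i g by (simp add: v_def i_def[symmetric])
  qed
  have vA: "fn v e \<in> A" using u i fn_closed[of u e] X A by (simp add: v_def i_def)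
  have "v \<noteq> zer U X"
  proof
    assume "v = zer U X"
    then have "v\<^sup>\<dagger> \<cdot> v = zer U U" using v X by simp
    then show False using vv by simp
  qed
  then have vp: "proper X (fn v e)" using v fn_e_proper by blast
  have "parallel X (fn v e) x"
  proof (rule X.parallelI)
    fix z assume z: "z \<in> carrier X"
    have i_dag: "orth X z a \<longleftrightarrow> orth (restr X A) (fn (i\<^sup>\<dagger>) z) a" if "a \<in> A" for a
      using adjoint'[of i a z] i that z by (simp add: i_def)
    show "orth X z (fn v e) \<longleftrightarrow> orth X z x"
    proof
      \<comment> \<open>The projection of \<open>z\<close> to the line is orthogonal to a proper element of a unital object.\<close>
      assume "orth X z (fn v e)"
      then have "orth (restr X A) (fn (i\<^sup>\<dagger>) z) (fn v e)" using i_dag vA by simp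
      then have "fn (i\<^sup>\<dagger>) z = origin X"
        using unital_perp[OF _ unA, of "fn v e"] vp vA X A by (auto simp: proper_def)
      then show "orth X z x"
        using i_dag[OF xA] X.origin_in_orthoclosed[OF A] xA x by (simp add: proper_def X.origin_perp)
    next
      assume "orth X z x"
      then have "z \<in> ocomp X {x}" using z by (simp add: ocomp_def)
      then show "orth X z (fn v e)" using vA by (auto simp: A_def ocomp_def intro: X.perp_sym)
    qed
  qed
  then show thesis using that v vv fac by (simp add: A_def)
qed

text \<open>Let \<open>n = (f, g) : U \<rightarrow> U \<oplus> U\<close>, so that \<open>n e\<close> is proper because \<open>f \<noteq> 0\<close>. As \<open>U \<oplus> U\<close> contains two orthogonal proper elements, it is not unital, so
there is an isometry \<open>w\<close> onto a line orthogonal to \<open>n e\<close>. The relation is \<open>w\<^sup>\<dagger> \<cdot> n = 0\<close> with the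
components \<open>p\<close> and \<open>q\<close> of \<open>w\<^sup>\<dagger>\<close>, and the last equation is \<open>w\<^sup>\<dagger> \<cdot> w = 1\<close>.\<close>
lemma annihilator:
  assumes f: "\<guillemotleft>f : U \<rightarrow> U\<guillemotright>" "f \<noteq> zer U U" and g: "\<guillemotleft>g : U \<rightarrow> U\<guillemotright>"
  obtains p q where "\<guillemotleft>p : U \<rightarrow> U\<guillemotright>" "\<guillemotleft>q : U \<rightarrow> U\<guillemotright>" "p \<cdot> f \<boxplus> q \<cdot> g = zer U U"
    "p \<cdot> p\<^sup>\<dagger> \<boxplus> q \<cdot> q\<^sup>\<dagger> = idn U"
proof -
  define i j S where "i = inl U U" and "j = inr U U" and "S = tgt i"
  have b: "biprod i j" and ij: "\<guillemotleft>i : U \<rightarrow> S\<guillemotright>" "\<guillemotleft>j : U \<rightarrow> S\<guillemotright>" and S: "S \<in> Obj C"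
    using chosen_biprod[of U U] biprodD[OF chosen_biprod(1)[of U U]] by (auto simp: i_def j_def S_def)
  note d = biprodD(4-7)[OF b]
  interpret S: orthoset S using S obj_orthoset by simp
  interpret U: orthoset U by (rule obj_orthoset) simp
  define n where "n = i \<cdot> f \<boxplus> j \<cdot> g"
  have n: "\<guillemotleft>n : U \<rightarrow> S\<guillemotright>" using f g ij by (simp add: n_def)
  have nz_if: "h \<noteq> zer U S" if "\<guillemotleft>k : U \<rightarrow> S\<guillemotright>" "k\<^sup>\<dagger> \<cdot> h \<noteq> zer U U" for h k
    using that by auto
  have "i\<^sup>\<dagger> \<cdot> i \<cdot> f = f" "i\<^sup>\<dagger> \<cdot> j \<cdot> g = zer U U"
    using ij f g d cmp_assoc[of f i "i\<^sup>\<dagger>"] cmp_assoc[of g j "i\<^sup>\<dagger>"] by auto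
  then have "i\<^sup>\<dagger> \<cdot> n = f" unfolding n_def using f g ij by (subst cmp_add) auto
  then have "proper S (fn n e)" using nz_if[OF ij(1), of n] f(2) n fn_e_proper[OF n] by simp
  have "i \<noteq> zer U S" "j \<noteq> zer U S" using nz_if[OF ij(1), of i] nz_if[OF ij(2), of j] d ij by simp_all
  then have pij: "proper S (fn i e)" "proper S (fn j e)" using ij fn_e_proper by blast+
  have oij: "orth S (fn i e) (fn j e)" using perp_iff[OF ij(1,2)] d ij by simp
  have "\<not> unital S"
    using unital_perp[OF S _ pij(2) oij] pij(1) by (auto simp: proper_def)
  then obtain y where y: "proper S y" "orth S y (fn n e)"
    using \<open>proper S (fn n e)\<close> unfolding unital_def by blast
  obtain w where w: "\<guillemotleft>w : U \<rightarrow> S\<guillemotright>" "w\<^sup>\<dagger> \<cdot> w = idn U" "parallel S (fn w e) y"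
    using line_isometry[OF S y(1)] by blast
  have "orth S (fn n e) (fn w e)"
    using S.parallel_perp[OF w(3)] S.perp_sym[OF y(2)] by blast
  then have wn: "w\<^sup>\<dagger> \<cdot> n = zer U U" using perp_iff[OF n w(1)] by simp
  show thesis
  proof (rule that[of "w\<^sup>\<dagger> \<cdot> i" "w\<^sup>\<dagger> \<cdot> j"])
    have "w\<^sup>\<dagger> \<cdot> n = w\<^sup>\<dagger> \<cdot> i \<cdot> f \<boxplus> w\<^sup>\<dagger> \<cdot> j \<cdot> g"
      unfolding n_def using f g ij w by (subst cmp_add) auto
    then show "(w\<^sup>\<dagger> \<cdot> i) \<cdot> f \<boxplus> (w\<^sup>\<dagger> \<cdot> j) \<cdot> g = zer U U" using wn f g ij w by simp
    show "(w\<^sup>\<dagger> \<cdot> i) \<cdot> (w\<^sup>\<dagger> \<cdot> i)\<^sup>\<dagger> \<boxplus> (w\<^sup>\<dagger> \<cdot> j) \<cdot> (w\<^sup>\<dagger> \<cdot> j)\<^sup>\<dagger> = idn U"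
      using cmp_eq_add[OF b, of "w\<^sup>\<dagger>" w] w ij by simp
  qed (use w ij in auto)
qed

text \<open>From \<open>p + q = 0\<close> it follows that \<open>p q\<^sup>\<dagger>\<close> is inverse to both \<open>p p\<^sup>\<dagger>\<close> and \<open>q q\<^sup>\<dagger>\<close>, whose sum is 1. Hence
\<open>p q\<^sup>\<dagger> + p q\<^sup>\<dagger>\<close> is inverse to 1.\<close>
lemma negative_exists: "\<exists>m. \<guillemotleft>m : U \<rightarrow> U\<guillemotright> \<and> idn U \<boxplus> m = zer U U"
proof -
  obtain p q where pq: "\<guillemotleft>p : U \<rightarrow> U\<guillemotright>" "\<guillemotleft>q : U \<rightarrow> U\<guillemotright>" "p \<cdot> idn U \<boxplus> q \<cdot> idn U = zer U U"
    "p \<cdot> p\<^sup>\<dagger> \<boxplus> q \<cdot> q\<^sup>\<dagger> = idn U"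
    using annihilator[of "idn U" "idn U"] by auto
  then have 0: "p \<boxplus> q = zer U U" by simp
  have 1: "p \<cdot> q\<^sup>\<dagger> \<boxplus> q \<cdot> q\<^sup>\<dagger> = zer U U"
    using pq add_cmp[of p q "q\<^sup>\<dagger>"] 0 by simp
  have "p\<^sup>\<dagger> \<boxplus> q\<^sup>\<dagger> = zer U U" using pq dag_add[of p q] 0 by simp
  then have 2: "p \<cdot> p\<^sup>\<dagger> \<boxplus> p \<cdot> q\<^sup>\<dagger> = zer U U" using pq cmp_add[of "p\<^sup>\<dagger>" "q\<^sup>\<dagger>" p] by simp
  have "idn U \<boxplus> (p \<cdot> q\<^sup>\<dagger> \<boxplus> p \<cdot> q\<^sup>\<dagger>) = (p \<cdot> p\<^sup>\<dagger> \<boxplus> q \<cdot> q\<^sup>\<dagger>) \<boxplus> (p \<cdot> q\<^sup>\<dagger> \<boxplus> p \<cdot> q\<^sup>\<dagger>)" using pq by simp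
  also have "\<dots> = (p \<cdot> p\<^sup>\<dagger> \<boxplus> p \<cdot> q\<^sup>\<dagger>) \<boxplus> (q \<cdot> q\<^sup>\<dagger> \<boxplus> p \<cdot> q\<^sup>\<dagger>)" using pq(1,2) by (intro add_interchange) auto
  also have "\<dots> = zer U U" using pq(1,2) 1 2 add_commute[of "q \<cdot> q\<^sup>\<dagger>" "p \<cdot> q\<^sup>\<dagger>"] by simp
  finally show ?thesis using pq by (intro exI[of _ "p \<cdot> q\<^sup>\<dagger> \<boxplus> p \<cdot> q\<^sup>\<dagger>"]) simp
qed

definition minus_one :: "'a arrow"
  where "minus_one = (SOME m. \<guillemotleft>m : U \<rightarrow> U\<guillemotright> \<and> idn U \<boxplus> m = zer U U)"

lemma minus_one [simp]: "arr minus_one" "src minus_one = U" "tgt minus_one = U"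
    "idn U \<boxplus> minus_one = zer U U"
  using someI_ex[OF negative_exists] by (auto simp: minus_one_def)

lemma add_minus [simp]: "\<guillemotleft>f : U \<rightarrow> X\<guillemotright> \<Longrightarrow> f \<boxplus> f \<cdot> minus_one = zer U X"
  using cmp_add[of "idn U" minus_one f] by simp

lemma eq_if_diff_zer:
  assumes f: "\<guillemotleft>f : U \<rightarrow> X\<guillemotright>" "\<guillemotleft>g : U \<rightarrow> X\<guillemotright>" and 0: "f \<boxplus> g \<cdot> minus_one = zer U X"
  shows "f = g"
proof -
  have "f = f \<boxplus> (g \<cdot> minus_one \<boxplus> g)" using f add_commute[of "g \<cdot> minus_one" g] by simp
  also have "\<dots> = (f \<boxplus> g \<cdot> minus_one) \<boxplus> g" using f by (subst add_assoc) auto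
  also have "\<dots> = g" using f 0 by simp
  finally show ?thesis .
qed

lemma cancel_right:
  assumes f: "\<guillemotleft>f : U \<rightarrow> X\<guillemotright>" "\<guillemotleft>g : U \<rightarrow> X\<guillemotright>" and r: "\<guillemotleft>r : U \<rightarrow> U\<guillemotright>" "r \<noteq> zer U U"
    and eq: "f \<cdot> r = g \<cdot> r"
  shows "f = g"
proof -
  have "(f \<boxplus> g \<cdot> minus_one) \<cdot> r = (g \<boxplus> g \<cdot> minus_one) \<cdot> r"
    using f r eq add_cmp[of f "g \<cdot> minus_one" r] add_cmp[of g "g \<cdot> minus_one" r] by simp
  also have "\<dots> = zer U X" using f r by auto
  finally have "f \<boxplus> g \<cdot> minus_one = zer U X"
    using cmp_eq_zer[of "f \<boxplus> g \<cdot> minus_one" X r] f r by auto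
  then show ?thesis by (rule eq_if_diff_zer[OF f])
qed

lemma cancel_left:
  assumes f: "\<guillemotleft>f : U \<rightarrow> X\<guillemotright>" "f \<noteq> zer U X" and r: "\<guillemotleft>r : U \<rightarrow> U\<guillemotright>" "\<guillemotleft>s : U \<rightarrow> U\<guillemotright>"
    and eq: "f \<cdot> r = f \<cdot> s"
  shows "r = s"
proof -
  have "f \<cdot> (r \<boxplus> s \<cdot> minus_one) = f \<cdot> s \<boxplus> (f \<cdot> s) \<cdot> minus_one"
    using f r eq cmp_add[of r "s \<cdot> minus_one" f] by simp
  also have "\<dots> = zer U X" using f r add_minus[of "f \<cdot> s" X] by (simp del: cmp_assoc)
  finally have "r \<boxplus> s \<cdot> minus_one = zer U U"
    using cmp_eq_zer[of f X "r \<boxplus> s \<cdot> minus_one"] f r by auto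
  then show ?thesis by (rule eq_if_diff_zer[OF r])
qed

abbreviation scalar :: "'a arrow \<Rightarrow> bool" where "scalar r \<equiv> \<guillemotleft>r : U \<rightarrow> U\<guillemotright>"

abbreviation nonzero :: "'a arrow \<Rightarrow> bool"
  where "nonzero r \<equiv> scalar r \<and> r \<noteq> zer U U"

lemma nonzero_idn: "nonzero (idn U)" by simp

lemma cmp_eq_zer_iff [simp]:
  assumes "\<guillemotleft>f : U \<rightarrow> X\<guillemotright>" "scalar r"
  shows "f \<cdot> r = zer U X \<longleftrightarrow> f = zer U X \<or> r = zer U U"
  using cmp_eq_zer[OF assms] assms arr_Obj(2)[of f] by (elim conjE) (metis U cmp_zer zer_cmp)

lemma dag_eq_zer_iff [simp]:
  assumes "\<guillemotleft>f : X \<rightarrow> Y\<guillemotright>" shows "f\<^sup>\<dagger> = zer Y X \<longleftrightarrow> f = zer X Y"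
proof
  have XY: "X \<in> Obj C" "Y \<in> Obj C" using arr_Obj[of f] assms by simp_all
  show "f = zer X Y" if "f\<^sup>\<dagger> = zer Y X"
  proof -
    have "f = (f\<^sup>\<dagger>)\<^sup>\<dagger>" using assms by simp
    then show ?thesis unfolding that using XY by simp
  qed
  show "f\<^sup>\<dagger> = zer Y X" if "f = zer X Y"
    using that assms arr_Obj[of f] by simp
qed

lemma minus_one_neq_zer [simp]: "minus_one \<noteq> zer U U"
proof
  assume "minus_one = zer U U"
  then have "idn U = zer U U" using minus_one(4) by simp
  then show False by simp
qed

lemma minus_minus [simp]: "minus_one \<cdot> minus_one = idn U"
proof (rule eq_if_diff_zer[of _ U])
  show "minus_one \<cdot> minus_one \<boxplus> idn U \<cdot> minus_one = zer U U"
    using add_minus[of minus_one U] add_commute[of "minus_one \<cdot> minus_one" minus_one] by simp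
qed auto

text \<open>The right Ore condition. The annihilator of \<open>(c\<^sup>\<dagger>, r\<^sup>\<dagger>)\<close> gives a common left multiple of these two
daggers, and the dagger turns it into a common right multiple.\<close>
lemma ore:
  assumes r: "scalar r" and c: "nonzero c"
  obtains s t where "scalar s" "nonzero t" "c \<cdot> s = r \<cdot> t" "r \<noteq> zer U U \<Longrightarrow> s \<noteq> zer U U"
proof (cases "r = zer U U")
  case True
  show ?thesis
    by (rule that[of "zer U U" "idn U"]) (use True c in simp_all)
next
  case False
  obtain p q where pq: "scalar p" "scalar q" "p \<cdot> c\<^sup>\<dagger> \<boxplus> q \<cdot> r\<^sup>\<dagger> = zer U U"
    "p \<cdot> p\<^sup>\<dagger> \<boxplus> q \<cdot> q\<^sup>\<dagger> = idn U"
    using annihilator[of "c\<^sup>\<dagger>" "r\<^sup>\<dagger>"] c r by (metis arr_dag dag_eq_zer_iff dag_simps)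
  have pc: "c \<cdot> p\<^sup>\<dagger> \<boxplus> r \<cdot> q\<^sup>\<dagger> = zer U U"
    using arg_cong[OF pq(3), of dag] pq(1,2) c r dag_add[of "p \<cdot> c\<^sup>\<dagger>" "q \<cdot> r\<^sup>\<dagger>"] by simp
  have q: "q \<noteq> zer U U"
  proof
    assume q: "q = zer U U"
    then have "c \<cdot> p\<^sup>\<dagger> = zer U U" using pc pq(1) c r by simp
    then have "p = zer U U" using c pq(1) by simp
    then have "zer U U = idn U" using pq(4) q by simp
    then show False using idn_neq_zer by metis
  qed
  have eq: "c \<cdot> p\<^sup>\<dagger> = r \<cdot> q\<^sup>\<dagger> \<cdot> minus_one"
    by (rule eq_if_diff_zer[of _ U]) (use c r pq pc in simp_all)
  have "c \<cdot> p\<^sup>\<dagger> \<noteq> zer U U" using q r pq False by (simp add: eq)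
  then have "p \<noteq> zer U U" using c pq by simp
  then show ?thesis
    using pq r c q by (intro that[OF _ _ eq]) simp_all
qed

end

section \<open>Vectors as fractions\<close>

context unit_orthocat
begin

abbreviation vec :: "'a orthoset \<Rightarrow> 'a arrow \<Rightarrow> bool" where "vec X f \<equiv> \<guillemotleft>f : U \<rightarrow> X\<guillemotright>"

lemma cmp_extend:
  assumes "f \<cdot> s = g \<cdot> t" "arr s" "arr t" "arr m" "tgt s = src f" "tgt t = src g" "tgt m = src s" "tgt m = src t"
  shows "f \<cdot> s \<cdot> m = g \<cdot> t \<cdot> m"
  using arg_cong[OF assms(1), of "\<lambda>x. x \<cdot> m"] assms(2-) by simp

definition pairing :: "'a orthoset \<Rightarrow> 'a arrow \<Rightarrow> 'a arrow \<Rightarrow> 'a arrow"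
  where "pairing X f c = inl X U \<cdot> f \<boxplus> inr X U \<cdot> c"

text \<open>The fraction \<open>f / c\<close>, encoded by a chosen point on the line of \<open>(f, c)\<close> in the biproduct of \<open>X\<close> and \<open>U\<close>.\<close>
definition ratio :: "'a orthoset \<Rightarrow> 'a arrow \<Rightarrow> 'a arrow \<Rightarrow> 'a"
  where "ratio X f c = (SOME y. y \<in> pclass (tgt (inl X U)) (fn (pairing X f c) e))"

lemma pairing:
  assumes X: "X \<in> Obj C" and f: "vec X f" "scalar c"
  shows "\<guillemotleft>pairing X f c : U \<rightarrow> tgt (inl X U)\<guillemotright>"
    "(inl X U)\<^sup>\<dagger> \<cdot> pairing X f c = f" "(inr X U)\<^sup>\<dagger> \<cdot> pairing X f c = c"
    "scalar s \<Longrightarrow> pairing X f c \<cdot> s = pairing X (f \<cdot> s) (c \<cdot> s)"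
proof -
  define i j where "i = inl X U" and "j = inr X U"
  have b: "biprod i j" and ij: "src i = X" "src j = U" using chosen_biprod[OF X U] by (auto simp: i_def j_def)
  note d = biprodD[OF b]
  have p: "pairing X f c = i \<cdot> f \<boxplus> j \<cdot> c" by (simp add: pairing_def i_def j_def)
  show "\<guillemotleft>pairing X f c : U \<rightarrow> tgt (inl X U)\<guillemotright>"
    unfolding p i_def[symmetric] using f d ij by simp
  have 1: "i\<^sup>\<dagger> \<cdot> i \<cdot> f = f" "i\<^sup>\<dagger> \<cdot> j \<cdot> c = zer U X" "j\<^sup>\<dagger> \<cdot> i \<cdot> f = zer U U" "j\<^sup>\<dagger> \<cdot> j \<cdot> c = c"
    using cmp_assoc[of f i "i\<^sup>\<dagger>"] cmp_assoc[of c j "i\<^sup>\<dagger>"] cmp_assoc[of f i "j\<^sup>\<dagger>"] cmp_assoc[of c j "j\<^sup>\<dagger>"]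
      f d ij X by simp_all
  show "(inl X U)\<^sup>\<dagger> \<cdot> pairing X f c = f" "(inr X U)\<^sup>\<dagger> \<cdot> pairing X f c = c"
    unfolding p i_def[symmetric] j_def[symmetric] using f d ij by (simp_all add: cmp_add 1)
  show "pairing X f c \<cdot> s = pairing X (f \<cdot> s) (c \<cdot> s)" if "scalar s"
    using that f d ij by (simp add: pairing_def i_def[symmetric] j_def[symmetric] add_cmp)
qed

lemma ratio_eq_parallel:
  assumes X: "X \<in> Obj C" and f: "vec X f" "scalar c" and g: "vec X g" "scalar d"
  shows "ratio X f c = ratio X g d \<longleftrightarrow>
    parallel (tgt (inl X U)) (fn (pairing X f c) e) (fn (pairing X g d) e)"
proof -
  let ?S = "tgt (inl X U)"
  let ?x = "fn (pairing X f c) e" and ?y = "fn (pairing X g d) e"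
  have x: "?x \<in> carrier ?S" using fn_closed[of "pairing X f c" e] pairing(1)[OF X f] by simp
  have y: "?y \<in> carrier ?S" using fn_closed[of "pairing X g d" e] pairing(1)[OF X g] by simp
  have "?x \<in> pclass ?S ?x" "?y \<in> pclass ?S ?y" using x y by (auto simp: pclass_def)
  then have s: "ratio X f c \<in> pclass ?S ?x" "ratio X g d \<in> pclass ?S ?y"
    unfolding ratio_def by (metis someI)+
  show ?thesis
  proof
    assume "ratio X f c = ratio X g d"
    then show "parallel ?S ?x ?y" using s by (auto simp: pclass_def parallel_def)
  next
    assume "parallel ?S ?x ?y"
    then have "pclass ?S ?x = pclass ?S ?y" using pclass_eq_iff[OF y] by simp
    then show "ratio X f c = ratio X g d" by (simp add: ratio_def)
  qed
qed

text \<open>Equality of the encodings is the usual equality of right fractions. If \<open>(f, c)\<close> and \<open>(g, d)\<close> lie on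
the same line, both are multiples \<open>v \<cdot> a\<close> and \<open>v \<cdot> b\<close> of the isometry onto it, and a common right
multiple of \<open>a\<close> and \<open>b\<close> exists by the Ore condition.\<close>
lemma ratio_eq_iff:
  assumes X: "X \<in> Obj C" and f: "vec X f" "nonzero c" and g: "vec X g" "nonzero d"
  shows "ratio X f c = ratio X g d \<longleftrightarrow>
    (\<exists>s t. nonzero s \<and> nonzero t \<and> f \<cdot> s = g \<cdot> t \<and> c \<cdot> s = d \<cdot> t)"
proof
  let ?S = "tgt (inl X U)" and ?m = "pairing X f c" and ?n = "pairing X g d"
  have S: "?S \<in> Obj C" using biprodD[OF chosen_biprod(1)[OF X U]] by simp
  interpret S: orthoset ?S using S by (rule obj_orthoset)
  note b = biprodD[OF chosen_biprod(1)[OF X U]] chosen_biprod[OF X U]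
  note m = pairing[OF X f(1), of c] note n = pairing[OF X g(1), of d]
  {
    assume "\<exists>s t. nonzero s \<and> nonzero t \<and> f \<cdot> s = g \<cdot> t \<and> c \<cdot> s = d \<cdot> t"
    then obtain s t where st: "nonzero s" "nonzero t" "f \<cdot> s = g \<cdot> t" "c \<cdot> s = d \<cdot> t" by blast
    have "?m \<cdot> s = ?n \<cdot> t" using m(4) n(4) st f g by simp
    moreover have "parallel ?S (fn (?m \<cdot> s) e) (fn ?m e)" "parallel ?S (fn (?n \<cdot> t) e) (fn ?n e)"
      using fn_scalar_parallel[of ?m ?S s] fn_scalar_parallel[of ?n ?S t] m(1) n(1) f g st by simp_all
    ultimately have "parallel ?S (fn ?m e) (fn ?n e)" by (simp add: parallel_def)
    then show "ratio X f c = ratio X g d" using ratio_eq_parallel[OF X, of f c g d] f g by simp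
  next
    assume "ratio X f c = ratio X g d"
    then have par: "parallel ?S (fn ?m e) (fn ?n e)" using ratio_eq_parallel[OF X, of f c g d] f g by simp
    have m0: "?m \<noteq> zer U ?S"
    proof
      assume "?m = zer U ?S"
      then have "c = zer U U" using m(3) f b by simp
      then show False using f by simp
    qed
    have n0: "?n \<noteq> zer U ?S"
    proof
      assume "?n = zer U ?S"
      then have "d = zer U U" using n(3) g b by simp
      then show False using g by simp
    qed
    let ?x = "fn ?m e"
    have x: "proper ?S ?x" using fn_e_proper[OF _ m0] m(1) f by simp
    obtain v where v: "\<guillemotleft>v : U \<rightarrow> ?S\<guillemotright>"
      "\<And>g. \<guillemotleft>g : U \<rightarrow> ?S\<guillemotright> \<Longrightarrow> fn g e \<in> ocomp ?S (ocomp ?S {?x}) \<Longrightarrow> v \<cdot> v\<^sup>\<dagger> \<cdot> g = g"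
      using line_isometry[OF S x] by blast
    have xx: "?x \<in> ocomp ?S (ocomp ?S {?x})"
      using x S.subset_ocomp_ocomp[of "{?x}"] by (auto simp: proper_def)
    have y: "fn ?n e \<in> carrier ?S" using fn_closed[of ?n e] n(1) g by simp
    have yx: "fn ?n e \<in> ocomp ?S (ocomp ?S {?x})"
      using y S.subset_ocomp_ocomp[of "{fn ?n e}"] par by (auto simp: parallel_def)
    have vm: "v \<cdot> v\<^sup>\<dagger> \<cdot> ?m = ?m" "v \<cdot> v\<^sup>\<dagger> \<cdot> ?n = ?n" using v(2) m(1) n(1) f g xx yx by simp_all
    have 1: "scalar (v\<^sup>\<dagger> \<cdot> ?m)" "scalar (v\<^sup>\<dagger> \<cdot> ?n)" using v m(1) n(1) f g by simp_all
    have 2: "v\<^sup>\<dagger> \<cdot> ?m \<noteq> zer U U" "v\<^sup>\<dagger> \<cdot> ?n \<noteq> zer U U" using vm m0 n0 v(1) by auto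
    obtain s t where st: "scalar s" "nonzero t" "(v\<^sup>\<dagger> \<cdot> ?m) \<cdot> s = (v\<^sup>\<dagger> \<cdot> ?n) \<cdot> t" "s \<noteq> zer U U"
      using ore[of "v\<^sup>\<dagger> \<cdot> ?n" "v\<^sup>\<dagger> \<cdot> ?m"] 1 2 by metis
    have "(v \<cdot> v\<^sup>\<dagger> \<cdot> ?m) \<cdot> s = (v \<cdot> v\<^sup>\<dagger> \<cdot> ?n) \<cdot> t"
      using arg_cong[OF st(3), of "\<lambda>x. v \<cdot> x"] v(1) m(1) n(1) f g st(1,2) by simp
    then have "pairing X (f \<cdot> s) (c \<cdot> s) = pairing X (g \<cdot> t) (d \<cdot> t)"
      unfolding vm using m(4) n(4) f g st by simp
    then have "f \<cdot> s = g \<cdot> t \<and> c \<cdot> s = d \<cdot> t"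
      using pairing(2,3)[OF X, of "f \<cdot> s" "c \<cdot> s"] pairing(2,3)[OF X, of "g \<cdot> t" "d \<cdot> t"] f g st by simp
    then show "\<exists>s t. nonzero s \<and> nonzero t \<and> f \<cdot> s = g \<cdot> t \<and> c \<cdot> s = d \<cdot> t" using st by blast
  }
qed

lemma ratio_eqI:
  assumes "X \<in> Obj C" "vec X f" "nonzero c" "vec X g" "nonzero d"
    "nonzero s" "nonzero t" "f \<cdot> s = g \<cdot> t" "c \<cdot> s = d \<cdot> t"
  shows "ratio X f c = ratio X g d"
  using ratio_eq_iff[of X f c g d] assms by blast

lemma ratio_scale:
  assumes "X \<in> Obj C" "vec X f" "nonzero c" "nonzero t"
  shows "ratio X (f \<cdot> t) (c \<cdot> t) = ratio X f c"
  by (rule ratio_eqI[of _ _ _ _ _ "idn U" t]) (use assms in simp_all)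

text \<open>Two representatives of a fraction agree as partial maps \<open>c a \<mapsto> f a\<close>, and not only for one common
multiple of the denominators. This is what makes the operations below well defined.\<close>
lemma ratio_eqD:
  assumes X: "X \<in> Obj C" and f: "vec X f" "nonzero c" and g: "vec X g" "nonzero d"
    and ab: "scalar a" "scalar b" and eq: "ratio X f c = ratio X g d" "c \<cdot> a = d \<cdot> b"
  shows "f \<cdot> a = g \<cdot> b"
proof -
  obtain p q where pq: "nonzero p" "nonzero q" "f \<cdot> p = g \<cdot> q" "c \<cdot> p = d \<cdot> q"
    using ratio_eq_iff[OF X f g] eq by blast
  obtain m n where mn: "scalar m" "nonzero n" "p \<cdot> m = a \<cdot> n"
    using ore[OF ab(1) pq(1)] by metis
  have "d \<cdot> q \<cdot> m = c \<cdot> p \<cdot> m" by (rule cmp_extend[symmetric]) (use pq mn f g in simp_all)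
  also have "\<dots> = d \<cdot> b \<cdot> n" unfolding mn(3) by (rule cmp_extend) (use ab eq mn f g in simp_all)
  finally have qm: "q \<cdot> m = b \<cdot> n"
    by (rule cancel_left[of d U, rotated -1]) (use ab pq mn g in simp_all)
  have "f \<cdot> a \<cdot> n = g \<cdot> q \<cdot> m"
    unfolding mn(3)[symmetric] by (rule cmp_extend) (use pq mn f g in simp_all)
  then have "(f \<cdot> a) \<cdot> n = (g \<cdot> b) \<cdot> n" unfolding qm using ab mn f g by simp
  then show ?thesis by (rule cancel_right[rotated -1]) (use ab mn f g in simp_all)
qed

definition elems :: "'a orthoset \<Rightarrow> 'a set"
  where "elems X = {ratio X f c | f c. vec X f \<and> nonzero c}"

lemma ratio_elems [simp]: "vec X f \<Longrightarrow> nonzero c \<Longrightarrow> ratio X f c \<in> elems X"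
  by (auto simp: elems_def)

lemma elemsE:
  assumes "x \<in> elems X" obtains f c where "vec X f" "nonzero c" "x = ratio X f c"
  using assms by (auto simp: elems_def)

lemma multiple_denominator:
  assumes X: "X \<in> Obj C" and x: "x \<in> elems X" and d: "nonzero d"
  obtains f t where "vec X f" "nonzero t" "x = ratio X f (d \<cdot> t)"
proof -
  obtain g c where g: "vec X g" "nonzero c" "x = ratio X g c" using x by (rule elemsE)
  obtain s t where st: "scalar s" "nonzero t" "d \<cdot> s = c \<cdot> t" "s \<noteq> zer U U"
    using ore[of c d] g d by metis
  have "x = ratio X (g \<cdot> t) (d \<cdot> s)" using ratio_scale[OF X g(1,2) st(2)] g(3) st(3) by simp
  then show thesis using that[of "g \<cdot> t" s] g st by simp
qed

lemma common_denominator: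
  assumes "X \<in> Obj C" "Y \<in> Obj C" and "x \<in> elems X" "y \<in> elems Y"
  obtains f g c where "vec X f" "vec Y g" "nonzero c" "x = ratio X f c" "y = ratio Y g c"
proof -
  obtain g d where g: "vec Y g" "nonzero d" "y = ratio Y g d" using assms(4) by (rule elemsE)
  obtain f t where f: "vec X f" "nonzero t" "x = ratio X f (d \<cdot> t)"
    using multiple_denominator[OF assms(1,3) g(2)] by blast
  have "y = ratio Y (g \<cdot> t) (d \<cdot> t)" using ratio_scale[OF assms(2) g(1,2) f(2)] g(3) by simp
  then show thesis using that[of f "g \<cdot> t" "d \<cdot> t"] f g by simp
qed

lemma common_denominator3:
  assumes X: "X \<in> Obj C" and "x \<in> elems X" "y \<in> elems X" "z \<in> elems X"
  obtains f g h c where "vec X f" "vec X g" "vec X h" "nonzero c"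
    "x = ratio X f c" "y = ratio X g c" "z = ratio X h c"
proof -
  obtain f g d where g: "vec X f" "vec X g" "nonzero d" "x = ratio X f d" "y = ratio X g d"
    using common_denominator[OF X X assms(2,3)] by blast
  obtain h t where h: "vec X h" "nonzero t" "z = ratio X h (d \<cdot> t)"
    using multiple_denominator[OF X assms(4) g(3)] by blast
  show thesis
    using that[of "f \<cdot> t" "g \<cdot> t" h "d \<cdot> t"] ratio_scale[OF X g(1,3) h(2)] ratio_scale[OF X g(2,3) h(2)] g h by simp
qed

text \<open>The product of \<open>f / c\<close> by \<open>(c s) / d\<close> can be read off after cancelling \<open>c\<close>; any scalar has such a
numerator, and multiples of \<open>d\<close> as denominators permit several scalars to be treated at once.\<close>
lemma composable_fraction:
  assumes k: "k \<in> elems U" and c: "nonzero c" and d: "nonzero d"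
  obtains s t where "scalar s" "nonzero t" "k = ratio U (c \<cdot> s) (d \<cdot> t)"
proof -
  obtain r t where r: "scalar r" "nonzero t" "k = ratio U r (d \<cdot> t)"
    using multiple_denominator[OF U k d] by blast
  obtain s t' where s: "scalar s" "nonzero t'" "c \<cdot> s = r \<cdot> t'"
    using ore[OF r(1) c] by metis
  have "k = ratio U (c \<cdot> s) (d \<cdot> t \<cdot> t')"
    using ratio_scale[OF U r(1), of "d \<cdot> t" t'] r s d by simp
  then show thesis using that[of s "t \<cdot> t'"] s r by simp
qed

section \<open>Addition, scaling and form on fractions\<close>

definition hzero :: "'a orthoset \<Rightarrow> 'a"
  where "hzero X = ratio X (zer U X) (idn U)"

definition hone :: 'a
  where "hone = ratio U (idn U) (idn U)"

text \<open>Each operation is given by a formula for representatives in a suitable position. In composition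
order, \<open>hsmult X k x\<close> is \<open>x \<cdot> k\<close>: scalars act on vectors from the right, so a left linear space
arises over the opposite ring. The form of \<open>f / c\<close> and \<open>g / d\<close> is
\<open>(g / d)\<^sup>\<dagger> (f / c)\<close>, and \<open>d\<^sup>\<dagger> \<cdot> p = g\<^sup>\<dagger> \<cdot> f\<close> expresses that moving the left denominator \<open>d\<^sup>\<dagger>\<close> across
yields \<open>p / c\<close>.\<close>
definition hadd :: "'a orthoset \<Rightarrow> 'a \<Rightarrow> 'a \<Rightarrow> 'a"
  where "hadd X x y = (SOME z. \<exists>f g c. vec X f \<and> vec X g \<and> nonzero c \<and>
    x = ratio X f c \<and> y = ratio X g c \<and> z = ratio X (f \<boxplus> g) c)"

definition hsmult :: "'a orthoset \<Rightarrow> 'a \<Rightarrow> 'a \<Rightarrow> 'a"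
  where "hsmult X k x = (SOME z. \<exists>f c s d. vec X f \<and> nonzero c \<and> scalar s \<and> nonzero d \<and>
    x = ratio X f c \<and> k = ratio U (c \<cdot> s) d \<and> z = ratio X (f \<cdot> s) d)"

definition hform :: "'a orthoset \<Rightarrow> 'a \<Rightarrow> 'a \<Rightarrow> 'a"
  where "hform X x y = (SOME z. \<exists>f c g d p. vec X f \<and> nonzero c \<and> vec X g \<and> nonzero d \<and> scalar p \<and>
    x = ratio X f c \<and> y = ratio X g d \<and> d\<^sup>\<dagger> \<cdot> p = g\<^sup>\<dagger> \<cdot> f \<and> z = ratio U p c)"

lemma hadd_ratio:
  assumes X: "X \<in> Obj C" and f: "vec X f" and g: "vec X g" and c: "nonzero c"
  shows "hadd X (ratio X f c) (ratio X g c) = ratio X (f \<boxplus> g) c"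
  unfolding hadd_def
proof (rule some_equality)
  show "\<exists>f' g' c'. vec X f' \<and> vec X g' \<and> nonzero c' \<and> ratio X f c = ratio X f' c' \<and>
    ratio X g c = ratio X g' c' \<and> ratio X (f \<boxplus> g) c = ratio X (f' \<boxplus> g') c'"
    using f g c by blast
next
  fix z assume "\<exists>f' g' c'. vec X f' \<and> vec X g' \<and> nonzero c' \<and> ratio X f c = ratio X f' c' \<and>
    ratio X g c = ratio X g' c' \<and> z = ratio X (f' \<boxplus> g') c'"
  then obtain f' g' c' where f': "vec X f'" and g': "vec X g'" and c': "nonzero c'"
    and eq: "ratio X f c = ratio X f' c'" "ratio X g c = ratio X g' c'" and z: "z = ratio X (f' \<boxplus> g') c'" by blast
  obtain s t where st: "nonzero s" "nonzero t" "f \<cdot> s = f' \<cdot> t" "c \<cdot> s = c' \<cdot> t"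
    using ratio_eq_iff[OF X f c f' c'] eq(1) by blast
  have "g \<cdot> s = g' \<cdot> t" using ratio_eqD[OF X g c g' c' _ _ eq(2) st(4)] st(1,2) by simp
  then have "(f \<boxplus> g) \<cdot> s = (f' \<boxplus> g') \<cdot> t"
    using st f g f' g' by (simp add: add_cmp)
  then show "z = ratio X (f \<boxplus> g) c"
    unfolding z using st f g f' g' c c' by (intro ratio_eqI[OF X, of _ _ _ _ t s]) simp_all
qed

lemma hsmult_ratio:
  assumes X: "X \<in> Obj C" and f: "vec X f" and c: "nonzero c" and s: "scalar s" and d: "nonzero d"
  shows "hsmult X (ratio U (c \<cdot> s) d) (ratio X f c) = ratio X (f \<cdot> s) d"
  unfolding hsmult_def
proof (rule some_equality)
  show "\<exists>f' c' s' d'. vec X f' \<and> nonzero c' \<and> scalar s' \<and> nonzero d' \<and> ratio X f c = ratio X f' c' \<and>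
    ratio U (c \<cdot> s) d = ratio U (c' \<cdot> s') d' \<and> ratio X (f \<cdot> s) d = ratio X (f' \<cdot> s') d'"
    using f c s d by blast
next
  fix z assume "\<exists>f' c' s' d'. vec X f' \<and> nonzero c' \<and> scalar s' \<and> nonzero d' \<and> ratio X f c = ratio X f' c' \<and>
    ratio U (c \<cdot> s) d = ratio U (c' \<cdot> s') d' \<and> z = ratio X (f' \<cdot> s') d'"
  then obtain f' c' s' d' where f': "vec X f'" and c': "nonzero c'" and s': "scalar s'" and d': "nonzero d'"
    and eq: "ratio X f c = ratio X f' c'" "ratio U (c \<cdot> s) d = ratio U (c' \<cdot> s') d'"
    and z: "z = ratio X (f' \<cdot> s') d'" by blast
  obtain a b where ab: "nonzero a" "nonzero b" "(c \<cdot> s) \<cdot> a = (c' \<cdot> s') \<cdot> b" "d \<cdot> a = d' \<cdot> b"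
    using ratio_eq_iff[OF U, of "c \<cdot> s" d "c' \<cdot> s'" d'] eq(2) c s d c' s' d' by (auto simp del: cmp_assoc)
  have "f \<cdot> s \<cdot> a = f' \<cdot> s' \<cdot> b"
    by (rule ratio_eqD[OF X f c f' c' _ _ eq(1)]) (use ab s s' c c' in simp_all)
  then show "z = ratio X (f \<cdot> s) d"
    unfolding z using ab f f' s s' d d' by (intro ratio_eqI[OF X, of _ _ _ _ b a]) simp_all
qed

lemma hform_ratio:
  assumes X: "X \<in> Obj C" and f: "vec X f" and c: "nonzero c" and g: "vec X g" and d: "nonzero d"
    and p: "scalar p" "d\<^sup>\<dagger> \<cdot> p = g\<^sup>\<dagger> \<cdot> f"
  shows "hform X (ratio X f c) (ratio X g d) = ratio U p c"
  unfolding hform_def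
proof (rule some_equality)
  show "\<exists>f' c' g' d' p'. vec X f' \<and> nonzero c' \<and> vec X g' \<and> nonzero d' \<and> scalar p' \<and>
    ratio X f c = ratio X f' c' \<and> ratio X g d = ratio X g' d' \<and> d'\<^sup>\<dagger> \<cdot> p' = g'\<^sup>\<dagger> \<cdot> f' \<and> ratio U p c = ratio U p' c'"
    using f c g d p by blast
next
  fix z assume "\<exists>f' c' g' d' p'. vec X f' \<and> nonzero c' \<and> vec X g' \<and> nonzero d' \<and> scalar p' \<and>
    ratio X f c = ratio X f' c' \<and> ratio X g d = ratio X g' d' \<and> d'\<^sup>\<dagger> \<cdot> p' = g'\<^sup>\<dagger> \<cdot> f' \<and> z = ratio U p' c'"
  then obtain f' c' g' d' p' where f': "vec X f'" and c': "nonzero c'" and g': "vec X g'" and d': "nonzero d'"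
    and p': "scalar p'" "d'\<^sup>\<dagger> \<cdot> p' = g'\<^sup>\<dagger> \<cdot> f'"
    and eq: "ratio X f c = ratio X f' c'" "ratio X g d = ratio X g' d'" and z: "z = ratio U p' c'" by blast
  obtain a b where ab: "nonzero a" "nonzero b" "f \<cdot> a = f' \<cdot> b" "c \<cdot> a = c' \<cdot> b"
    using ratio_eq_iff[OF X f c f' c'] eq(1) by blast
  obtain m n where mn: "nonzero m" "nonzero n" "g \<cdot> m = g' \<cdot> n" "d \<cdot> m = d' \<cdot> n"
    using ratio_eq_iff[OF X g d g' d'] eq(2) by blast
  have "(d \<cdot> m)\<^sup>\<dagger> \<cdot> p \<cdot> a = m\<^sup>\<dagger> \<cdot> (d\<^sup>\<dagger> \<cdot> p) \<cdot> a" using d mn(1) p(1) ab(1) by simp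
  also have "\<dots> = (g \<cdot> m)\<^sup>\<dagger> \<cdot> f \<cdot> a" unfolding p(2) using g mn(1) f ab(1) by simp
  also have "\<dots> = n\<^sup>\<dagger> \<cdot> (g'\<^sup>\<dagger> \<cdot> f') \<cdot> b" unfolding mn(3) ab(3) using g' mn(2) f' ab(2) by simp
  also have "\<dots> = (d \<cdot> m)\<^sup>\<dagger> \<cdot> p' \<cdot> b" unfolding p'(2)[symmetric] mn(4) using d' mn(2) p'(1) ab(2) by simp
  finally have "p \<cdot> a = p' \<cdot> b"
    by (rule cancel_left[of "(d \<cdot> m)\<^sup>\<dagger>" U, rotated -1]) (use d mn(1) p(1) p'(1) ab(1,2) in simp_all)
  then show "z = ratio U p c"
    unfolding z using ab p p' c c' by (intro ratio_eqI[OF U, of _ _ _ _ b a]) simp_all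
qed

lemma ore_dag:
  assumes "scalar r" "nonzero c"
  obtains s t where "scalar s" "nonzero t" "c\<^sup>\<dagger> \<cdot> s = r \<cdot> t"
proof -
  have "nonzero (c\<^sup>\<dagger>)" using assms by simp
  then show thesis using ore[OF assms(1)] that by metis
qed

lemma hone_ratio: "nonzero t \<Longrightarrow> ratio U t t = hone"
  using ratio_scale[of U "idn U" "idn U" t] by (simp add: hone_def)

lemma hzero_ratio:
  assumes X: "X \<in> Obj C" and c: "nonzero c" shows "ratio X (zer U X) c = hzero X"
  unfolding hzero_def
  by (rule ratio_eqI[OF X, of _ _ _ _ "idn U" c]) (use c X in simp_all)

lemma ratio_eq_hzero_iff:
  assumes X: "X \<in> Obj C" and f: "vec X f" "nonzero c"
  shows "ratio X f c = hzero X \<longleftrightarrow> f = zer U X"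
proof
  assume "ratio X f c = hzero X"
  then obtain s t where st: "nonzero s" "nonzero t" "f \<cdot> s = zer U X \<cdot> t"
    unfolding hzero_def using ratio_eq_iff[OF X f, of "zer U X" "idn U"] X by auto
  then have "f \<cdot> s = zer U X" using X by simp
  then show "f = zer U X" using st f by simp
next
  show "f = zer U X \<Longrightarrow> ratio X f c = hzero X" using hzero_ratio[OF X f(2)] by simp
qed

lemma hzero_closed [simp]: "X \<in> Obj C \<Longrightarrow> hzero X \<in> elems X"
  unfolding hzero_def by (rule ratio_elems) simp_all

lemma hone_closed [simp]: "hone \<in> elems U"
  unfolding hone_def by (rule ratio_elems) simp_all

lemma hone_neq_hzero: "hone \<noteq> hzero U"
  unfolding hone_def using ratio_eq_hzero_iff[of U "idn U" "idn U"] by simp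

lemma hadd_closed [simp]:
  assumes X: "X \<in> Obj C" and x: "x \<in> elems X" and y: "y \<in> elems X" shows "hadd X x y \<in> elems X"
  by (rule common_denominator[OF X X x y]) (simp add: hadd_ratio[OF X])

lemma hadd_commute:
  assumes X: "X \<in> Obj C" and x: "x \<in> elems X" and y: "y \<in> elems X" shows "hadd X x y = hadd X y x"
proof (rule common_denominator[OF X X x y])
  fix f g c assume "vec X f" "vec X g" "nonzero c" "x = ratio X f c" "y = ratio X g c"
  then show ?thesis using add_commute[of f g] by (simp add: hadd_ratio[OF X])
qed

lemma hadd_assoc:
  assumes X: "X \<in> Obj C" and "x \<in> elems X" "y \<in> elems X" "z \<in> elems X"
  shows "hadd X (hadd X x y) z = hadd X x (hadd X y z)"
proof (rule common_denominator3[OF assms])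
  fix f g h c assume "vec X f" "vec X g" "vec X h" "nonzero c" "x = ratio X f c" "y = ratio X g c" "z = ratio X h c"
  then show ?thesis using add_assoc[of f g h] by (simp add: hadd_ratio[OF X])
qed

lemma hadd_hzero:
  assumes X: "X \<in> Obj C" and x: "x \<in> elems X" shows "hadd X (hzero X) x = x"
proof (rule elemsE[OF x])
  fix f c assume f: "vec X f" "nonzero c" "x = ratio X f c"
  have "hadd X (ratio X (zer U X) c) (ratio X f c) = ratio X (zer U X \<boxplus> f) c"
    by (rule hadd_ratio[OF X]) (use f X in simp_all)
  then show ?thesis using f X by (simp add: hzero_ratio)
qed

lemma hadd_inverse:
  assumes X: "X \<in> Obj C" and x: "x \<in> elems X" shows "\<exists>y\<in>elems X. hadd X y x = hzero X"
proof (rule elemsE[OF x])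
  fix f c assume f: "vec X f" "nonzero c" "x = ratio X f c"
  have "hadd X (ratio X (f \<cdot> minus_one) c) (ratio X f c) = ratio X (f \<cdot> minus_one \<boxplus> f) c"
    by (rule hadd_ratio[OF X]) (use f in simp_all)
  also have "\<dots> = hzero X" using f X add_commute[of "f \<cdot> minus_one" f] by (simp add: hzero_ratio)
  finally show ?thesis using f by (intro bexI[of _ "ratio X (f \<cdot> minus_one) c"]) simp_all
qed

lemma hsmult_fractionsE:
  assumes X: "X \<in> Obj C" and x: "x \<in> elems X" and k: "k \<in> elems U"
  obtains f c s d where "vec X f" "nonzero c" "scalar s" "nonzero d"
    "x = ratio X f c" "k = ratio U (c \<cdot> s) d" "hsmult X k x = ratio X (f \<cdot> s) d"
proof -
  obtain f c where f: "vec X f" "nonzero c" "x = ratio X f c" using x by (rule elemsE)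
  obtain s d where s: "scalar s" "nonzero d" "k = ratio U (c \<cdot> s) (idn U \<cdot> d)"
    using composable_fraction[OF k f(2) nonzero_idn] by blast
  show thesis
    by (rule that[of f c s d]) (use f s hsmult_ratio[OF X] in simp_all)
qed

lemma hsmult_closed [simp]:
  assumes X: "X \<in> Obj C" and k: "k \<in> elems U" and x: "x \<in> elems X" shows "hsmult X k x \<in> elems X"
  by (rule hsmult_fractionsE[OF X x k]) simp

lemma hsmult_hone:
  assumes X: "X \<in> Obj C" and x: "x \<in> elems X" shows "hsmult X hone x = x"
proof (rule elemsE[OF x])
  fix f c assume f: "vec X f" "nonzero c" "x = ratio X f c"
  then show ?thesis using hsmult_ratio[OF X f(1,2), of "idn U" c] hone_ratio[of c] by simp
qed

lemma hsmult_add_right: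
  assumes X: "X \<in> Obj C" and k: "k \<in> elems U" and x: "x \<in> elems X" and y: "y \<in> elems X"
  shows "hsmult X k (hadd X x y) = hadd X (hsmult X k x) (hsmult X k y)"
proof (rule common_denominator[OF X X x y])
  fix f g c assume f: "vec X f" "vec X g" "nonzero c" "x = ratio X f c" "y = ratio X g c"
  obtain s d where s: "scalar s" "nonzero d" "k = ratio U (c \<cdot> s) (idn U \<cdot> d)"
    using composable_fraction[OF k f(3) nonzero_idn] by blast
  show ?thesis using f s by (simp add: hadd_ratio[OF X] hsmult_ratio[OF X] add_cmp)
qed

lemma hsmult_add_left:
  assumes X: "X \<in> Obj C" and k: "k \<in> elems U" and l: "l \<in> elems U" and x: "x \<in> elems X"
  shows "hsmult X (hadd U k l) x = hadd X (hsmult X k x) (hsmult X l x)"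
proof (rule elemsE[OF x])
  fix f c assume f: "vec X f" "nonzero c" "x = ratio X f c"
  obtain s d where s: "scalar s" "nonzero d" "k = ratio U (c \<cdot> s) (idn U \<cdot> d)"
    using composable_fraction[OF k f(2) nonzero_idn] by blast
  obtain s' t where s': "scalar s'" "nonzero t" "l = ratio U (c \<cdot> s') (d \<cdot> t)"
    using composable_fraction[OF l f(2) s(2)] by blast
  have k: "k = ratio U (c \<cdot> s \<cdot> t) (d \<cdot> t)"
    using ratio_scale[OF U, of "c \<cdot> s" d t] f s s' by simp
  have "hadd U k l = ratio U (c \<cdot> (s \<cdot> t \<boxplus> s')) (d \<cdot> t)"
    unfolding k s'(3) using f s s' by (simp add: hadd_ratio[OF U] cmp_add)
  then have "hsmult X (hadd U k l) x = ratio X (f \<cdot> (s \<cdot> t \<boxplus> s')) (d \<cdot> t)"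
    using f s s' by (simp add: hsmult_ratio[OF X])
  moreover have "hsmult X k x = ratio X (f \<cdot> s \<cdot> t) (d \<cdot> t)"
    unfolding k f(3) using f s s' by (intro hsmult_ratio[OF X]) simp_all
  moreover have "hsmult X l x = ratio X (f \<cdot> s') (d \<cdot> t)"
    unfolding s'(3) f(3) using f s s' by (intro hsmult_ratio[OF X]) simp_all
  ultimately show ?thesis using f s s' by (simp add: hadd_ratio[OF X] cmp_add)
qed

lemma hsmult_assoc:
  assumes X: "X \<in> Obj C" and k: "k \<in> elems U" and l: "l \<in> elems U" and x: "x \<in> elems X"
  shows "hsmult X (hsmult U k l) x = hsmult X k (hsmult X l x)"
proof (rule hsmult_fractionsE[OF X x l])
  fix f c s d assume f: "vec X f" "nonzero c" "scalar s" "nonzero d"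
    "x = ratio X f c" "l = ratio U (c \<cdot> s) d" "hsmult X l x = ratio X (f \<cdot> s) d"
  obtain t e where t: "scalar t" "nonzero e" "k = ratio U (d \<cdot> t) (idn U \<cdot> e)"
    using composable_fraction[OF k f(4) nonzero_idn] by blast
  have "hsmult X k (hsmult X l x) = ratio X ((f \<cdot> s) \<cdot> t) e"
    unfolding f(7) using f t hsmult_ratio[OF X, of "f \<cdot> s" d t e] by simp
  moreover have "hsmult U k l = ratio U ((c \<cdot> s) \<cdot> t) e"
    unfolding f(6) using f t hsmult_ratio[OF U, of "c \<cdot> s" d t e] by simp
  ultimately show ?thesis using f t hsmult_ratio[OF X, of f c "s \<cdot> t" e] by simp
qed

lemma hform_fractionsE:
  assumes X: "X \<in> Obj C" and u: "u \<in> elems X" and f: "vec X f" "nonzero c"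
  obtains h d p where "vec X h" "nonzero d" "scalar p" "u = ratio X h d" "c\<^sup>\<dagger> \<cdot> p = f\<^sup>\<dagger> \<cdot> h"
    "hform X u (ratio X f c) = ratio U p d"
proof -
  obtain g e where g: "vec X g" "nonzero e" "u = ratio X g e" using u by (rule elemsE)
  have r_scalar: "scalar (f\<^sup>\<dagger> \<cdot> g)" using f g by simp
  have r_nonzero: "nonzero c" using f g by simp
  obtain p t where p: "scalar p" "nonzero t" "c\<^sup>\<dagger> \<cdot> p = (f\<^sup>\<dagger> \<cdot> g) \<cdot> t"
    using ore_dag[OF r_scalar r_nonzero] by metis
  have u: "u = ratio X (g \<cdot> t) (e \<cdot> t)" using ratio_scale[OF X g(1,2) p(2)] g(3) by simp
  have eq: "c\<^sup>\<dagger> \<cdot> p = f\<^sup>\<dagger> \<cdot> g \<cdot> t" using p f g by simp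
  show thesis
    by (rule that[OF _ _ p(1) u eq])
      (use u f g p(1,2) eq hform_ratio[OF X, of "g \<cdot> t" "e \<cdot> t" f c p] in simp_all)
qed

lemma hform_closed [simp]:
  assumes X: "X \<in> Obj C" and x: "x \<in> elems X" and y: "y \<in> elems X" shows "hform X x y \<in> elems U"
proof (rule elemsE[OF y])
  fix f c assume f: "vec X f" "nonzero c" "y = ratio X f c"
  show ?thesis unfolding f(3) by (rule hform_fractionsE[OF X x f(1,2)]) simp
qed

lemma hform_add_left:
  assumes X: "X \<in> Obj C" and x: "x \<in> elems X" and y: "y \<in> elems X" and u: "u \<in> elems X"
  shows "hform X (hadd X x y) u = hadd U (hform X x u) (hform X y u)"
proof (rule elemsE[OF u])
  fix f c assume f: "vec X f" "nonzero c" "u = ratio X f c"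
  obtain g h d where g: "vec X g" "vec X h" "nonzero d" "x = ratio X g d" "y = ratio X h d"
    using common_denominator[OF X X x y] by blast
  have r_scalar: "scalar (f\<^sup>\<dagger> \<cdot> g)" using f g by simp
  have r_nonzero: "nonzero c" using f g by simp
  obtain p t where p: "scalar p" "nonzero t" "c\<^sup>\<dagger> \<cdot> p = (f\<^sup>\<dagger> \<cdot> g) \<cdot> t"
    using ore_dag[OF r_scalar r_nonzero] by metis
  have r_scalar: "scalar (f\<^sup>\<dagger> \<cdot> h \<cdot> t)" using f g p(2) by simp
  have r_nonzero: "nonzero c" using f g p(2) by simp
  obtain q t' where q: "scalar q" "nonzero t'" "c\<^sup>\<dagger> \<cdot> q = (f\<^sup>\<dagger> \<cdot> h \<cdot> t) \<cdot> t'"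
    using ore_dag[OF r_scalar r_nonzero] by metis
  let ?t = "t \<cdot> t'"
  have t: "nonzero ?t" using p(2) q(2) by simp
  have p': "c\<^sup>\<dagger> \<cdot> p \<cdot> t' = f\<^sup>\<dagger> \<cdot> g \<cdot> ?t"
    using cmp_extend[OF p(3), of t'] f g p(1,2) q(2) by simp
  have q': "c\<^sup>\<dagger> \<cdot> q = f\<^sup>\<dagger> \<cdot> h \<cdot> ?t" using q(3) f g p(2) q(1,2) by simp
  have "c\<^sup>\<dagger> \<cdot> (p \<cdot> t' \<boxplus> q) = f\<^sup>\<dagger> \<cdot> (g \<cdot> ?t \<boxplus> h \<cdot> ?t)"
    using p' q' p(1,2) q(1,2) f g by (simp add: cmp_add)
  moreover have x: "x = ratio X (g \<cdot> ?t) (d \<cdot> ?t)" and y: "y = ratio X (h \<cdot> ?t) (d \<cdot> ?t)"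
    using ratio_scale[OF X g(1,3) t] ratio_scale[OF X g(2,3) t] g(4,5) by simp_all
  moreover have "hadd X x y = ratio X (g \<cdot> ?t \<boxplus> h \<cdot> ?t) (d \<cdot> ?t)"
    unfolding x y by (rule hadd_ratio[OF X]) (use g t in simp_all)
  ultimately have "hform X (hadd X x y) u = ratio U (p \<cdot> t' \<boxplus> q) (d \<cdot> ?t)"
    unfolding f(3) using f(1,2) g p(1,2) q(1,2) by (simp add: hform_ratio[OF X])
  moreover have "hform X x u = ratio U (p \<cdot> t') (d \<cdot> ?t)"
    unfolding f(3) x by (rule hform_ratio[OF X]) (use f g p(1,2) q(1,2) p' in simp_all)
  moreover have "hform X y u = ratio U q (d \<cdot> ?t)"
    unfolding f(3) y by (rule hform_ratio[OF X]) (use f g p(1,2) q(1,2) q' in simp_all)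
  moreover have "hadd U (ratio U (p \<cdot> t') (d \<cdot> ?t)) (ratio U q (d \<cdot> ?t)) = ratio U (p \<cdot> t' \<boxplus> q) (d \<cdot> ?t)"
    by (rule hadd_ratio[OF U]) (use p(1,2) q(1,2) g in simp_all)
  ultimately show ?thesis by simp
qed

lemma hform_smult_left:
  assumes X: "X \<in> Obj C" and k: "k \<in> elems U" and x: "x \<in> elems X" and u: "u \<in> elems X"
  shows "hform X (hsmult X k x) u = hsmult U k (hform X x u)"
proof (rule elemsE[OF u])
  fix f c assume f: "vec X f" "nonzero c" "u = ratio X f c"
  obtain h d p where h: "vec X h" "nonzero d" "scalar p" "x = ratio X h d" "c\<^sup>\<dagger> \<cdot> p = f\<^sup>\<dagger> \<cdot> h"
    "hform X x (ratio X f c) = ratio U p d" using hform_fractionsE[OF X x f(1,2)] by metis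
  obtain s e where s: "scalar s" "nonzero e" "k = ratio U (d \<cdot> s) (idn U \<cdot> e)"
    using composable_fraction[OF k h(2) nonzero_idn] by blast
  have kx: "hsmult X k x = ratio X (h \<cdot> s) e"
    unfolding h(4) using s h(1,2) by (simp add: hsmult_ratio[OF X])
  have "c\<^sup>\<dagger> \<cdot> p \<cdot> s = f\<^sup>\<dagger> \<cdot> h \<cdot> s" using cmp_extend[OF h(5), of s] h(1-3) s f by simp
  then have "hform X (hsmult X k x) u = ratio U (p \<cdot> s) e"
    unfolding kx f(3) by (intro hform_ratio[OF X]) (use h(1-3) s f in simp_all)
  moreover have "hsmult U k (ratio U p d) = ratio U (p \<cdot> s) e"
    using s h(1-3) by (simp add: hsmult_ratio[OF U])
  ultimately show ?thesis using h(6) f(3) by simp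
qed

text \<open>The star of \<open>a\<close> is \<open>a\<^sup>\<dagger> \<cdot> 1\<close>, that is, the form of 1 and \<open>a\<close>. With 1 written as \<open>(c m) / (c m)\<close>, both
sides are computed from the same equation \<open>d\<^sup>\<dagger> \<cdot> q = p\<^sup>\<dagger> \<cdot> c \<cdot> m\<close>.\<close>
lemma hform_symmetric:
  assumes X: "X \<in> Obj C" and u: "u \<in> elems X" and v: "v \<in> elems X"
  shows "hform X u v = hform U hone (hform X v u)"
proof (rule elemsE[OF u])
  fix f c assume f: "vec X f" "nonzero c" "u = ratio X f c"
  obtain g d p where g: "vec X g" "nonzero d" "scalar p" "v = ratio X g d" "c\<^sup>\<dagger> \<cdot> p = f\<^sup>\<dagger> \<cdot> g"
    "hform X v (ratio X f c) = ratio U p d" using hform_fractionsE[OF X v f(1,2)] by metis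
  have adj: "p\<^sup>\<dagger> \<cdot> c = g\<^sup>\<dagger> \<cdot> f" using arg_cong[OF g(5), of dag] f(1,2) g(1-3) by simp
  have r_scalar: "scalar (p\<^sup>\<dagger> \<cdot> c)" using f g(1-3) by simp
  have r_nonzero: "nonzero d" using f g(1-3) by simp
  obtain q m where q: "scalar q" "nonzero m" "d\<^sup>\<dagger> \<cdot> q = (p\<^sup>\<dagger> \<cdot> c) \<cdot> m"
    using ore_dag[OF r_scalar r_nonzero] by metis
  have "hform X (ratio X (f \<cdot> m) (c \<cdot> m)) v = ratio U q (c \<cdot> m)"
    unfolding g(4) by (rule hform_ratio[OF X]) (use q f(1,2) g(1-3) adj in simp_all)
  moreover have "ratio X (f \<cdot> m) (c \<cdot> m) = u" using ratio_scale[OF X f(1,2) q(2)] f(3) by simp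
  moreover have "hform U (ratio U (c \<cdot> m) (c \<cdot> m)) (ratio U p d) = ratio U q (c \<cdot> m)"
    by (rule hform_ratio[OF U]) (use q f(1,2) g(1-3) in simp_all)
  moreover have "ratio U (c \<cdot> m) (c \<cdot> m) = hone" by (rule hone_ratio) (use q f(1,2) in simp)
  ultimately show ?thesis using g(6) f(3) by simp
qed

lemma hform_hone_right:
  assumes a: "a \<in> elems U" shows "hform U a hone = a"
proof (rule elemsE[OF a])
  fix f c assume f: "scalar f" "nonzero c" "a = ratio U f c"
  show ?thesis unfolding f(3) hone_def by (rule hform_ratio[OF U]) (use f in simp_all)
qed

lemma star_star_hform: "a \<in> elems U \<Longrightarrow> hform U hone (hform U hone a) = a"
  using hform_symmetric[OF U, of a hone] hform_hone_right[of a] by simp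

text \<open>In composition order, \<open>(x k)\<^sup>\<dagger> u = k\<^sup>\<dagger> (x\<^sup>\<dagger> u)\<close>. For \<open>X = U\<close> and \<open>u = 1\<close> this is the rule for the star of
a product.\<close>
lemma hform_smult_right:
  assumes X: "X \<in> Obj C" and k: "k \<in> elems U" and x: "x \<in> elems X" and u: "u \<in> elems X"
  shows "hform X u (hsmult X k x) = hsmult U (hform X u x) (hform U hone k)"
proof (rule hsmult_fractionsE[OF X x k])
  fix f c s d assume f: "vec X f" "nonzero c" "scalar s" "nonzero d"
    "x = ratio X f c" "k = ratio U (c \<cdot> s) d" "hsmult X k x = ratio X (f \<cdot> s) d"
  obtain h e p where h: "vec X h" "nonzero e" "scalar p" "u = ratio X h e" "c\<^sup>\<dagger> \<cdot> p = f\<^sup>\<dagger> \<cdot> h"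
    "hform X u (ratio X f c) = ratio U p e" using hform_fractionsE[OF X u f(1,2)] by metis
  have r_scalar: "scalar ((c \<cdot> s)\<^sup>\<dagger>)" using f(1-4) by simp
  have r_nonzero: "nonzero d" using f(1-4) by simp
  obtain q t where q: "scalar q" "nonzero t" "d\<^sup>\<dagger> \<cdot> q = (c \<cdot> s)\<^sup>\<dagger> \<cdot> t"
    using ore_dag[OF r_scalar r_nonzero] by metis
  have "hform U (ratio U t t) k = ratio U q t"
    unfolding f(6) by (rule hform_ratio[OF U]) (use q f(1-4) in simp_all)
  then have star: "hform U hone k = ratio U q t" using hone_ratio[OF q(2)] by simp
  obtain r m where r: "scalar r" "nonzero m" "t \<cdot> r = p \<cdot> m" using ore[OF h(3) q(2)] by metis
  have "ratio U p e = ratio U (t \<cdot> r) (e \<cdot> m)" using ratio_scale[OF U h(3,2) r(2)] r(3) by simp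
  then have rhs: "hsmult U (hform X u x) (hform U hone k) = ratio U (q \<cdot> r) (e \<cdot> m)"
    unfolding star f(5) h(6) using q(1,2) r(1,2) h(2) by (simp add: hsmult_ratio[OF U])
  have "d\<^sup>\<dagger> \<cdot> q \<cdot> r = (c \<cdot> s)\<^sup>\<dagger> \<cdot> t \<cdot> r"
    by (rule cmp_extend[OF q(3)]) (use q(1,2) r(1,2) f(1-4) in simp_all)
  also have "\<dots> = s\<^sup>\<dagger> \<cdot> c\<^sup>\<dagger> \<cdot> p \<cdot> m" unfolding r(3) using f(1-4) h(1-3) r(1,2) by simp
  also have "c\<^sup>\<dagger> \<cdot> p \<cdot> m = f\<^sup>\<dagger> \<cdot> h \<cdot> m"
    by (rule cmp_extend[OF h(5)]) (use r(1,2) f(1-4) h(1-3) in simp_all)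
  finally have eq: "d\<^sup>\<dagger> \<cdot> q \<cdot> r = (f \<cdot> s)\<^sup>\<dagger> \<cdot> h \<cdot> m" using f(1-4) h(1-3) r(1,2) by simp
  have "hform X (ratio X (h \<cdot> m) (e \<cdot> m)) (ratio X (f \<cdot> s) d) = ratio U (q \<cdot> r) (e \<cdot> m)"
    by (rule hform_ratio[OF X]) (use eq f(1-4) h(1-3) r(1,2) q(1,2) in simp_all)
  moreover have "ratio X (h \<cdot> m) (e \<cdot> m) = u" using ratio_scale[OF X h(1,2) r(2)] h(4) by simp
  ultimately show ?thesis using f(7) rhs by simp
qed

lemma hform_eq_hzero_iff:
  assumes X: "X \<in> Obj C" and f: "vec X f" "nonzero c" and g: "vec X g" "nonzero d"
  shows "hform X (ratio X f c) (ratio X g d) = hzero U \<longleftrightarrow> orth X (fn f e) (fn g e)"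
proof -
  have r_scalar: "scalar (g\<^sup>\<dagger> \<cdot> f)" using f g by simp
  have r_nonzero: "nonzero d" using f g by simp
  obtain p t where p: "scalar p" "nonzero t" "d\<^sup>\<dagger> \<cdot> p = (g\<^sup>\<dagger> \<cdot> f) \<cdot> t"
    using ore_dag[OF r_scalar r_nonzero] by metis
  have "hform X (ratio X (f \<cdot> t) (c \<cdot> t)) (ratio X g d) = ratio U p (c \<cdot> t)"
    by (rule hform_ratio[OF X]) (use p f g in simp_all)
  then have "hform X (ratio X f c) (ratio X g d) = ratio U p (c \<cdot> t)"
    using ratio_scale[OF X f p(2)] by simp
  then have "hform X (ratio X f c) (ratio X g d) = hzero U \<longleftrightarrow> p = zer U U"
    using ratio_eq_hzero_iff[OF U, of p "c \<cdot> t"] p(1,2) f by simp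
  also have "\<dots> \<longleftrightarrow> d\<^sup>\<dagger> \<cdot> p = zer U U" using p(1) g by simp
  also have "\<dots> \<longleftrightarrow> g\<^sup>\<dagger> \<cdot> f = zer U U"
    unfolding p(3) using p(2) f g by (subst cmp_eq_zer_iff) simp_all
  also have "\<dots> \<longleftrightarrow> orth X (fn f e) (fn g e)" using perp_iff[OF f(1) g(1)] by simp
  finally show ?thesis .
qed

lemma hform_anisotropic:
  assumes X: "X \<in> Obj C" and x: "x \<in> elems X" and 0: "hform X x x = hzero U"
  shows "x = hzero X"
proof (rule elemsE[OF x])
  interpret X: orthoset X using X by (rule obj_orthoset)
  fix f c assume f: "vec X f" "nonzero c" "x = ratio X f c"
  then have "orth X (fn f e) (fn f e)" using hform_eq_hzero_iff[OF X f(1,2) f(1,2)] 0 by simp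
  then have "fn f e = origin X" by (rule X.perp_self)
  then show ?thesis using zer_iff[OF f(1)] hzero_ratio[OF X f(2)] f(3) by simp
qed

lemma hsmult_inverse:
  assumes a: "a \<in> elems U" "a \<noteq> hzero U"
  shows "\<exists>b\<in>elems U. hsmult U a b = hone \<and> hsmult U b a = hone"
proof (rule elemsE[OF a(1)])
  fix f c assume f: "scalar f" "nonzero c" "a = ratio U f c"
  then have f0: "nonzero f" using a(2) hzero_ratio[OF U f(2)] by auto
  have "hsmult U a (ratio U c f) = hone"
    using hsmult_ratio[OF U, of c f "idn U" c] f f0 hone_ratio[OF f(2)] by simp
  moreover have "hsmult U (ratio U c f) a = hone"
    using hsmult_ratio[OF U, of f c "idn U" f] f f0 hone_ratio[OF f0] by simp
  ultimately show ?thesis using f f0 by (intro bexI[of _ "ratio U c f"]) simp_all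
qed

text \<open>The fractions over \<open>U\<close> act on themselves as on any space, so the multiplication is the scaling. The
star of \<open>a\<close> is \<open>a\<^sup>\<dagger> \<cdot> 1\<close>.\<close>
definition scalars :: "'a star_ring"
  where "scalars = \<lparr>carrier = elems U, mult = hsmult U, one = hone, zero = hzero U, add = hadd U,
    star = hform U hone\<rparr>"

definition hspace :: "'a orthoset \<Rightarrow> ('a, 'a) form_space"
  where "hspace X = \<lparr>carrier = elems X, mult = (\<lambda>_ _. hzero X), one = hzero X, zero = hzero X,
    add = hadd X, smult = hsmult X, form = hform X\<rparr>"

lemma scalars_simps [simp]: "carrier scalars = elems U" "mult scalars = hsmult U" "one scalars = hone"
    "zero scalars = hzero U" "add scalars = hadd U" "star scalars = hform U hone"
  by (simp_all add: scalars_def)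

lemma hspace_simps [simp]: "carrier (hspace X) = elems X" "zero (hspace X) = hzero X"
    "add (hspace X) = hadd X" "smult (hspace X) = hsmult X" "form (hspace X) = hform X"
  by (simp_all add: hspace_def)

lemma abelian_group_hspace: "X \<in> Obj C \<Longrightarrow> abelian_group (hspace X)"
  by (rule abelian_groupI)
    (auto simp: hadd_assoc hadd_hzero hadd_inverse intro: hadd_commute)

lemma hform_add_right:
  assumes X: "X \<in> Obj C" and x: "x \<in> elems X" and y: "y \<in> elems X" and u: "u \<in> elems X"
  shows "hform X u (hadd X x y) = hadd U (hform X u x) (hform X u y)"
proof (rule common_denominator[OF X X x y])
  fix f g c assume f: "vec X f" "vec X g" "nonzero c" "x = ratio X f c" "y = ratio X g c"
  obtain h d p where h: "vec X h" "nonzero d" "scalar p" "u = ratio X h d" "c\<^sup>\<dagger> \<cdot> p = f\<^sup>\<dagger> \<cdot> h"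
    using hform_fractionsE[OF X u f(1,3)] by metis
  have r_scalar: "scalar (g\<^sup>\<dagger> \<cdot> h)" using f(1-3) h(1-3) by simp
  have r_nonzero: "nonzero c" using f(1-3) h(1-3) by simp
  obtain q t where q: "scalar q" "nonzero t" "c\<^sup>\<dagger> \<cdot> q = (g\<^sup>\<dagger> \<cdot> h) \<cdot> t"
    using ore_dag[OF r_scalar r_nonzero] by metis
  have u: "u = ratio X (h \<cdot> t) (d \<cdot> t)" using ratio_scale[OF X h(1,2) q(2)] h(4) by simp
  have 1: "c\<^sup>\<dagger> \<cdot> p \<cdot> t = f\<^sup>\<dagger> \<cdot> h \<cdot> t"
    using cmp_extend[OF h(5), of t] f(1-3) h(1-3) q(1,2) by simp
  have 2: "c\<^sup>\<dagger> \<cdot> q = g\<^sup>\<dagger> \<cdot> h \<cdot> t" using q(3) f(1-3) h(1-3) q(1,2) by simp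
  have 3: "c\<^sup>\<dagger> \<cdot> (p \<cdot> t \<boxplus> q) = (f \<boxplus> g)\<^sup>\<dagger> \<cdot> h \<cdot> t"
    using 1 2 f(1-3) h(1-3) q(1,2) by (simp add: cmp_add dag_add add_cmp)
  have "hform X u (hadd X x y) = ratio U (p \<cdot> t \<boxplus> q) (d \<cdot> t)"
    unfolding f(4,5) hadd_ratio[OF X f(1-3)] u
    by (rule hform_ratio[OF X]) (use f(1-3) h(1-3) q(1,2) 3 in simp_all)
  moreover have "hform X u x = ratio U (p \<cdot> t) (d \<cdot> t)"
    unfolding f(4) u by (rule hform_ratio[OF X]) (use f(1-3) h(1-3) q(1,2) 1 in simp_all)
  moreover have "hform X u y = ratio U q (d \<cdot> t)"
    unfolding f(5) u by (rule hform_ratio[OF X]) (use f(1-3) h(1-3) q(1,2) 2 in simp_all)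
  moreover have "hadd U (ratio U (p \<cdot> t) (d \<cdot> t)) (ratio U q (d \<cdot> t)) = ratio U (p \<cdot> t \<boxplus> q) (d \<cdot> t)"
    by (rule hadd_ratio[OF U]) (use h(1-3) q(1,2) in simp_all)
  ultimately show ?thesis by simp
qed

lemma ring_scalars: "ring scalars"
proof (rule ringI)
  show "abelian_group scalars"
    by (rule abelian_groupI) (auto simp: hadd_assoc hadd_hzero hadd_inverse intro: hadd_commute)
  show "Group.monoid scalars"
  proof (rule monoidI)
    fix a assume "a \<in> carrier scalars"
    then have a: "a \<in> elems U" by simp
    show "\<one>\<^bsub>scalars\<^esub> \<otimes>\<^bsub>scalars\<^esub> a = a" using a by (simp add: hsmult_hone)
    obtain f c where f: "scalar f" "nonzero c" "a = ratio U f c" using a by (rule elemsE)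
    show "a \<otimes>\<^bsub>scalars\<^esub> \<one>\<^bsub>scalars\<^esub> = a"
      using hsmult_ratio[OF U, of "idn U" "idn U" f c] f by (simp add: hone_def)
  qed (simp_all add: hsmult_assoc)
qed (simp_all add: hsmult_add_left hsmult_add_right)

lemma star_sfield_scalars: "star_sfield scalars"
proof -
  interpret ring scalars by (rule ring_scalars)
  have "Units scalars = carrier scalars - {\<zero>\<^bsub>scalars\<^esub>}"
  proof (intro equalityI subsetI)
    fix a assume a: "a \<in> Units scalars"
    have "a \<noteq> \<zero>\<^bsub>scalars\<^esub>"
    proof
      assume "a = \<zero>\<^bsub>scalars\<^esub>"
      then have "\<zero>\<^bsub>scalars\<^esub> = \<one>\<^bsub>scalars\<^esub>" using a Units_r_inv[OF a] by (metis Units_inv_closed l_null)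
      then show False using hone_neq_hzero by simp
    qed
    then show "a \<in> carrier scalars - {\<zero>\<^bsub>scalars\<^esub>}" using a by (auto simp: Units_def)
  next
    fix a assume "a \<in> carrier scalars - {\<zero>\<^bsub>scalars\<^esub>}"
    then show "a \<in> Units scalars" using hsmult_inverse[of a] by (auto simp: Units_def)
  qed
  then show ?thesis
    by unfold_locales
      (simp_all add: hform_add_right hform_smult_right star_star_hform)
qed

end

section \<open>The spaces of fractions\<close>

context unit_orthocat
begin

abbreviation hortho :: "'a orthoset \<Rightarrow> 'a orthoset"
  where "hortho X \<equiv> orthoset_of (hspace X) scalars"

lemma orth_ratio_iff:
  assumes X: "X \<in> Obj C" and f: "vec X f" "nonzero c" and g: "vec X g" "nonzero d"
  shows "orth (hortho X) (ratio X f c) (ratio X g d) \<longleftrightarrow> orth X (fn f e) (fn g e)"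
  using hform_eq_hzero_iff[OF assms] f g by simp

lemma hortho_orthoset:
  assumes X: "X \<in> Obj C" shows "orthoset (hortho X)"
proof
  interpret X: orthoset X using X by (rule obj_orthoset)
  show "origin (hortho X) \<in> carrier (hortho X)" using X by simp
  show "perp (hortho X) \<subseteq> carrier (hortho X) \<times> carrier (hortho X)" by (auto simp: orthoset_of_def)
  fix x y
  show "orth (hortho X) y x" if xy: "orth (hortho X) x y"
  proof -
    obtain f c where f: "vec X f" "nonzero c" "x = ratio X f c" using xy by (auto elim: elemsE)
    obtain g d where g: "vec X g" "nonzero d" "y = ratio X g d" using xy by (auto elim: elemsE)
    show ?thesis
      using xy X.perp_sym unfolding f(3) g(3) orth_ratio_iff[OF X f(1,2) g(1,2)] orth_ratio_iff[OF X g(1,2) f(1,2)] by blast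
  qed
  show "x = origin (hortho X)" if "orth (hortho X) x x"
    using that hform_anisotropic[OF X] by simp
  show "orth (hortho X) (origin (hortho X)) x" if x: "x \<in> carrier (hortho X)"
  proof -
    obtain f c where f: "vec X f" "nonzero c" "x = ratio X f c" using x by (auto elim: elemsE)
    have "orth (hortho X) (ratio X (zer U X) (idn U)) (ratio X f c)"
      using orth_ratio_iff[OF X _ nonzero_idn f(1,2), of "zer U X"] X f fn_closed[of f e]
      by (simp add: X.origin_perp)
    then show ?thesis by (simp add: f(3) hzero_def)
  qed
qed

lemma ratio_parallel:
  assumes X: "X \<in> Obj C" and f: "vec X f" "nonzero c" and g: "vec X g" "nonzero d"
    and par: "parallel X (fn f e) (fn g e)"
  shows "parallel (hortho X) (ratio X f c) (ratio X g d)"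
proof (rule orthoset.parallelI[OF hortho_orthoset[OF X]])
  interpret X: orthoset X using X by (rule obj_orthoset)
  fix z assume "z \<in> carrier (hortho X)"
  then obtain h b where h: "vec X h" "nonzero b" "z = ratio X h b" by (auto elim: elemsE)
  show "orth (hortho X) z (ratio X f c) \<longleftrightarrow> orth (hortho X) z (ratio X g d)"
    unfolding h(3) orth_ratio_iff[OF X h(1,2) f] orth_ratio_iff[OF X h(1,2) g]
    by (rule X.parallel_perp[OF par])
qed

text \<open>A vector whose value at \<open>e\<close> represents the line of \<open>x\<close>; with denominator 1 it becomes the coordinate
of \<open>x\<close>.\<close>
definition vector_on :: "'a orthoset \<Rightarrow> 'a \<Rightarrow> 'a arrow"
  where "vector_on X x = (SOME f. vec X f \<and> parallel X (fn f e) x)"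

lemma vector_on:
  assumes X: "X \<in> Obj C" and x: "x \<in> carrier X"
  shows "vec X (vector_on X x)" "parallel X (fn (vector_on X x) e) x"
proof -
  have "\<exists>f. vec X f \<and> parallel X (fn f e) x"
  proof (cases "x = origin X")
    case True
    then show ?thesis using X by (intro exI[of _ "zer U X"]) simp
  next
    case False
    then have "proper X x" using x by (simp add: proper_def)
    then show ?thesis using line_isometry[OF X] by metis
  qed
  from someI_ex[OF this] show "vec X (vector_on X x)" "parallel X (fn (vector_on X x) e) x"
    by (simp_all add: vector_on_def)
qed

definition coord :: "'a orthoset \<Rightarrow> 'a \<Rightarrow> 'a"
  where "coord X x = ratio X (vector_on X x) (idn U)"

lemma orthoset_rep_coord:
  assumes X: "X \<in> Obj C" shows "orthoset_rep X (hortho X) (coord X)"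
proof -
  interpret X: orthoset X using X by (rule obj_orthoset)
  interpret H: orthoset "hortho X" by (rule hortho_orthoset[OF X])
  show ?thesis
  proof
    fix x assume x: "x \<in> carrier X"
    show "coord X x \<in> carrier (hortho X)"
      unfolding coord_def using ratio_elems[OF vector_on(1)[OF X x] nonzero_idn] by simp
    fix y assume y: "y \<in> carrier X"
    show "orth (hortho X) (coord X x) (coord X y) \<longleftrightarrow> orth X x y"
      unfolding coord_def orth_ratio_iff[OF X vector_on(1)[OF X x] nonzero_idn vector_on(1)[OF X y] nonzero_idn]
      using X.parallel_perp'[OF vector_on(2)[OF X x]] X.parallel_perp[OF vector_on(2)[OF X y]] by blast
  next
    fix y assume "y \<in> carrier (hortho X)"
    then obtain f c where f: "vec X f" "nonzero c" "y = ratio X f c" by (auto elim: elemsE)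
    have x: "fn f e \<in> carrier X" using f(1) fn_closed[of f e] by simp
    show "\<exists>x\<in>carrier X. parallel (hortho X) (coord X x) y"
      unfolding f(3) coord_def using x f vector_on[OF X x]
      by (intro bexI[OF _ x] ratio_parallel[OF X _ nonzero_idn]) simp_all
  qed
qed

lemma hermitian_hspace:
  assumes X: "X \<in> Obj C" shows "hermitian_space scalars (hspace X)"
proof -
  interpret F: star_sfield scalars by (rule star_sfield_scalars)
  interpret H: abelian_group "hspace X" by (rule abelian_group_hspace[OF X])
  interpret R: orthoset_rep X "hortho X" "coord X" by (rule orthoset_rep_coord[OF X])
  show ?thesis
  proof unfold_locales
    show "countable_rank (hortho X)" using R.countable_rank_rep obj_countable_rank[OF X] by blast
  next
    fix u v assume u: "u \<in> carrier (hspace X)" and v: "v \<in> carrier (hspace X)"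
    show "form (hspace X) u v = star scalars (form (hspace X) v u)"
      using hform_symmetric[OF X, of u v] u v by simp
  next
    fix u assume "u \<in> carrier (hspace X)" "form (hspace X) u u = \<zero>\<^bsub>scalars\<^esub>"
    then show "u = \<zero>\<^bsub>hspace X\<^esub>" using hform_anisotropic[OF X, of u] by simp
  qed (simp_all add: X hsmult_add_left hsmult_add_right hsmult_assoc hsmult_hone hform_add_left
      hform_add_right hform_smult_left hform_smult_right)
qed

text \<open>The orthoclosed sets of fractions are those of the form \<open>hsub X A\<close> with \<open>A\<close> orthoclosed in \<open>X\<close>, because
orthogonality of fractions only depends on the lines of their numerators.\<close>
definition hsub :: "'a orthoset \<Rightarrow> 'a set \<Rightarrow> 'a set"
  where "hsub X A = {ratio X f c | f c. vec X f \<and> nonzero c \<and> fn f e \<in> A}"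

lemma ratio_hsub_iff:
  assumes X: "X \<in> Obj C" and A: "orthoclosed X A" and f: "vec X f" "nonzero c"
  shows "ratio X f c \<in> hsub X A \<longleftrightarrow> fn f e \<in> A"
proof
  interpret X: orthoset X using X by (rule obj_orthoset)
  assume "ratio X f c \<in> hsub X A"
  then obtain g d where g: "vec X g" "nonzero d" "fn g e \<in> A" "ratio X f c = ratio X g d"
    by (auto simp: hsub_def)
  obtain s t where st: "nonzero s" "nonzero t" "f \<cdot> s = g \<cdot> t"
    using ratio_eq_iff[OF X f g(1,2)] g(4) by blast
  have "parallel X (fn (f \<cdot> s) e) (fn f e)" "parallel X (fn (f \<cdot> s) e) (fn g e)"
    using fn_scalar_parallel[OF f(1), of s] fn_scalar_parallel[OF g(1), of t] st by simp_all
  then have "parallel X (fn g e) (fn f e)" by (simp add: parallel_def)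
  then show "fn f e \<in> A" using X.orthoclosed_parallel[OF A g(3)] fn_closed[of f e] f by simp
next
  show "fn f e \<in> A \<Longrightarrow> ratio X f c \<in> hsub X A" using f by (auto simp: hsub_def)
qed

lemma hsub_subset: "hsub X A \<subseteq> elems X"
  by (auto simp: hsub_def elems_def)

lemma ocomp_hsub:
  assumes X: "X \<in> Obj C" and A: "orthoclosed X A"
  shows "ocomp (hortho X) (hsub X A) = hsub X (ocomp X A)"
proof -
  interpret X: orthoset X using X by (rule obj_orthoset)
  have AX: "A \<subseteq> carrier X" by (rule X.orthoclosed_subset[OF A])
  have A': "orthoclosed X (ocomp X A)" by (rule X.orthoclosed_ocomp[OF AX])
  have "ratio X f c \<in> ocomp (hortho X) (hsub X A) \<longleftrightarrow> fn f e \<in> ocomp X A"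
    if f: "vec X f" "nonzero c" for f c
  proof
    assume o: "ratio X f c \<in> ocomp (hortho X) (hsub X A)"
    have "orth X (fn f e) a" if a: "a \<in> A" for a
    proof -
      have aX: "a \<in> carrier X" using a AX by blast
      note g = vector_on[OF X aX]
      have "fn (vector_on X a) e \<in> A"
        using X.orthoclosed_parallel[OF A a _ parallel_sym[OF g(2)]] fn_closed[of "vector_on X a" e] g(1) by simp
      then have "ratio X (vector_on X a) (idn U) \<in> hsub X A" using ratio_hsub_iff[OF X A g(1) nonzero_idn] by simp
      then have "orth (hortho X) (ratio X f c) (ratio X (vector_on X a) (idn U))"
        using o unfolding ocomp_def by blast
      then show ?thesis
        using orth_ratio_iff[OF X f g(1) nonzero_idn] X.parallel_perp[OF g(2)] by blast
    qed
    then show "fn f e \<in> ocomp X A" using f fn_closed[of f e] by (simp add: ocomp_def)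
  next
    assume o: "fn f e \<in> ocomp X A"
    have "orth (hortho X) (ratio X f c) y" if "y \<in> hsub X A" for y
      using that o orth_ratio_iff[OF X f] unfolding hsub_def ocomp_def by blast
    then show "ratio X f c \<in> ocomp (hortho X) (hsub X A)"
      using ratio_elems[OF f] by (simp add: ocomp_def)
  qed
  note iff = this
  show ?thesis
  proof (intro equalityI subsetI)
    fix x assume x: "x \<in> ocomp (hortho X) (hsub X A)"
    then obtain f c where f: "vec X f" "nonzero c" "x = ratio X f c" by (auto simp: ocomp_def elim: elemsE)
    then show "x \<in> hsub X (ocomp X A)" using x iff[OF f(1,2)] ratio_hsub_iff[OF X A' f(1,2)] by blast
  next
    fix x assume x: "x \<in> hsub X (ocomp X A)"
    then obtain f c where f: "vec X f" "nonzero c" "x = ratio X f c" using hsub_subset by (blast elim: elemsE)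
    then show "x \<in> ocomp (hortho X) (hsub X A)" using x iff[OF f(1,2)] ratio_hsub_iff[OF X A' f(1,2)] by blast
  qed
qed

lemma orthoclosed_hsub:
  assumes X: "X \<in> Obj C" and A: "orthoclosed X A" shows "orthoclosed (hortho X) (hsub X A)"
proof -
  interpret X: orthoset X using X by (rule obj_orthoset)
  have A': "orthoclosed X (ocomp X A)" by (rule X.orthoclosed_ocomp[OF X.orthoclosed_subset[OF A]])
  have "ocomp X (ocomp X A) = A" using A by (simp add: orthoclosed_def)
  then show ?thesis
    unfolding orthoclosed_def ocomp_hsub[OF X A] ocomp_hsub[OF X A'] using hsub_subset by simp
qed

lemma orthoclosed_hsubE:
  assumes X: "X \<in> Obj C" and S: "orthoclosed (hortho X) S"
  obtains A where "orthoclosed X A" "S = hsub X A"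
proof -
  interpret X: orthoset X using X by (rule obj_orthoset)
  interpret H: orthoset "hortho X" by (rule hortho_orthoset[OF X])
  define T where "T = ocomp (hortho X) S"
  have ST: "S = ocomp (hortho X) T" using S by (simp add: orthoclosed_def T_def)
  have TH: "T \<subseteq> elems X" using H.ocomp_subset[of S] by (simp add: T_def)
  define B where "B = {fn g e | g d. vec X g \<and> nonzero d \<and> ratio X g d \<in> T}"
  have "fn g e \<in> carrier X" if "vec X g" for g using that fn_closed[of g e] by simp
  then have BX: "B \<subseteq> carrier X" unfolding B_def by blast
  have A: "orthoclosed X (ocomp X B)" by (rule X.orthoclosed_ocomp[OF BX])
  have "ratio X f c \<in> S \<longleftrightarrow> fn f e \<in> ocomp X B" if f: "vec X f" "nonzero c" for f c
  proof -
    have "fn f e \<in> ocomp X B \<longleftrightarrow>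
      (\<forall>g d. vec X g \<and> nonzero d \<and> ratio X g d \<in> T \<longrightarrow> orth X (fn f e) (fn g e))"
      using f fn_closed[of f e] unfolding ocomp_def B_def by auto
    also have "\<dots> \<longleftrightarrow> (\<forall>g d. vec X g \<and> nonzero d \<and> ratio X g d \<in> T \<longrightarrow>
        orth (hortho X) (ratio X f c) (ratio X g d))"
      using orth_ratio_iff[OF X f] by blast
    also have "\<dots> \<longleftrightarrow> (\<forall>y\<in>T. orth (hortho X) (ratio X f c) y)"
      using TH by (blast elim: elemsE)
    also have "\<dots> \<longleftrightarrow> ratio X f c \<in> S"
      unfolding ST using ratio_elems[OF f] by (simp add: ocomp_def)
    finally show ?thesis by simp
  qed
  note iff = this
  have "S = hsub X (ocomp X B)"
  proof (intro equalityI subsetI)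
    fix x assume x: "x \<in> S"
    then have "x \<in> elems X" using ST H.ocomp_subset[of T] by auto
    then obtain f c where f: "vec X f" "nonzero c" "x = ratio X f c" by (rule elemsE)
    then show "x \<in> hsub X (ocomp X B)" using x iff[OF f(1,2)] ratio_hsub_iff[OF X A f(1,2)] by blast
  next
    fix x assume x: "x \<in> hsub X (ocomp X B)"
    then obtain f c where f: "vec X f" "nonzero c" "x = ratio X f c" using hsub_subset by (blast elim: elemsE)
    then show "x \<in> S" using x iff[OF f(1,2)] ratio_hsub_iff[OF X A f(1,2)] by blast
  qed
  then show thesis using that A by blast
qed

text \<open>The numerator \<open>f\<close> is the sum of its components in \<open>A\<close> and \<open>A\<^sup>\<bottom>\<close>, and the denominator stays the same.\<close>
lemma orthomodular_hspace:
  assumes X: "X \<in> Obj C" shows "orthomodular_space scalars (hspace X)"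
proof -
  interpret X: orthoset X using X by (rule obj_orthoset)
  interpret H: hermitian_space scalars "hspace X" by (rule hermitian_hspace[OF X])
  show ?thesis
  proof
    fix S assume S: "orthoclosed (hortho X) S"
    obtain A where A: "orthoclosed X A" "S = hsub X A" using orthoclosed_hsubE[OF X S] by blast
    have A': "orthoclosed X (ocomp X A)" by (rule X.orthoclosed_ocomp[OF X.orthoclosed_subset[OF A(1)]])
    have Sc: "ocomp (hortho X) S = hsub X (ocomp X A)" using ocomp_hsub[OF X A(1)] A(2) by simp
    have "\<exists>u\<in>S. \<exists>v\<in>hsub X (ocomp X A). x = hadd X u v" if x: "x \<in> elems X" for x
    proof -
      obtain f c where f: "vec X f" "nonzero c" "x = ratio X f c" using x by (rule elemsE)
      define i j where "i = emb X A" and "j = emb X (ocomp X A)"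
      have b: "biprod i j" using biprod_emb[OF X A(1)] by (simp add: i_def j_def)
      have i: "\<guillemotleft>i : restr X A \<rightarrow> X\<guillemotright>" and j: "\<guillemotleft>j : restr X (ocomp X A) \<rightarrow> X\<guillemotright>"
        using X A(1) A' by (simp_all add: i_def j_def)
      have "fn (i\<^sup>\<dagger> \<cdot> f) e \<in> A" "fn (j\<^sup>\<dagger> \<cdot> f) e \<in> ocomp X A"
        using fn_closed[of "i\<^sup>\<dagger> \<cdot> f" e] fn_closed[of "j\<^sup>\<dagger> \<cdot> f" e] i j f by simp_all
      then have "fn (i \<cdot> i\<^sup>\<dagger> \<cdot> f) e \<in> A" "fn (j \<cdot> j\<^sup>\<dagger> \<cdot> f) e \<in> ocomp X A"
        using f i j by (simp_all add: i_def j_def)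
      then have m: "ratio X (i \<cdot> i\<^sup>\<dagger> \<cdot> f) c \<in> S" "ratio X (j \<cdot> j\<^sup>\<dagger> \<cdot> f) c \<in> hsub X (ocomp X A)"
        using ratio_hsub_iff[OF X A(1), of "i \<cdot> i\<^sup>\<dagger> \<cdot> f" c] ratio_hsub_iff[OF X A', of "j \<cdot> j\<^sup>\<dagger> \<cdot> f" c]
          A(2) f i j by simp_all
      have "f = (i \<cdot> i\<^sup>\<dagger> \<boxplus> j \<cdot> j\<^sup>\<dagger>) \<cdot> f" using biprod_idn[OF b] i f by simp
      also have "\<dots> = i \<cdot> i\<^sup>\<dagger> \<cdot> f \<boxplus> j \<cdot> j\<^sup>\<dagger> \<cdot> f" using i j f by (subst add_cmp) simp_all
      finally have "x = ratio X (i \<cdot> i\<^sup>\<dagger> \<cdot> f \<boxplus> j \<cdot> j\<^sup>\<dagger> \<cdot> f) c" using f(3) by simp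
      also have "\<dots> = hadd X (ratio X (i \<cdot> i\<^sup>\<dagger> \<cdot> f) c) (ratio X (j \<cdot> j\<^sup>\<dagger> \<cdot> f) c)"
        by (rule hadd_ratio[OF X, symmetric]) (use i j f in simp_all)
      finally show ?thesis using m by blast
    qed
    moreover have "hadd X u v \<in> elems X" if "u \<in> S" "v \<in> hsub X (ocomp X A)" for u v
      using that hsub_subset[of X] X unfolding A(2) by (intro hadd_closed) blast+
    ultimately have "elems X = (\<Union>u\<in>S. \<Union>v\<in>hsub X (ocomp X A). {hadd X u v})" by blast
    then show "carrier (hspace X) = S <+>\<^bsub>hspace X\<^esub> ocomp (hortho X) S"
      by (simp add: Sc set_add_def')
  qed
qed

text \<open>An isometry \<open>v\<close> onto the line of a nonzero element gives the unit vector \<open>v / 1\<close>, as \<open>v\<^sup>\<dagger> \<cdot> v = 1\<close>.\<close>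
lemma uniform_hspace:
  assumes X: "X \<in> Obj C" shows "uniform_orthomodular_space scalars (hspace X)"
proof -
  interpret X: orthoset X using X by (rule obj_orthoset)
  interpret H: orthomodular_space scalars "hspace X" by (rule orthomodular_hspace[OF X])
  show ?thesis
  proof
    fix S assume S: "is_subspace S (hspace X) scalars" "has_dim S scalars 1"
    let ?O = "orthoset_of S scalars"
    have oc: "orthoclosed (hortho X) (carrier S)" and S_eq: "S = hspace X\<lparr>carrier := carrier S\<rparr>"
      using S(1) by (simp_all add: is_subspace_def)
    have zS: "\<zero>\<^bsub>S\<^esub> = hzero X" by (subst S_eq) simp
    \<comment> \<open>In the zero space the empty set is a maximal orthogonal set, so the dimension would be 0.\<close>
    have "\<exists>u\<in>carrier S. u \<noteq> hzero X"
    proof (rule ccontr)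
      assume "\<not> ?thesis"
      then have "\<not> proper ?O x" for x unfolding proper_def orthoset_of_simps zS by blast
      then have "maximal_orthogonal_set ?O {}"
        unfolding maximal_orthogonal_set_def orthogonal_set_def pairwise_def by blast
      then have "ecard ({} :: 'a set) = 1" using S(2) unfolding has_dim_def by blast
      then show False by (simp add: ecard_def zero_enat_def[symmetric])
    qed
    then obtain u where u: "u \<in> carrier S" "u \<noteq> hzero X" by blast
    obtain A where A: "orthoclosed X A" "carrier S = hsub X A" using orthoclosed_hsubE[OF X oc] by blast
    obtain f c where f: "vec X f" "nonzero c" "u = ratio X f c"
      using u(1) A(2) hsub_subset by (blast elim: elemsE)
    have fA: "fn f e \<in> A" using u(1) f ratio_hsub_iff[OF X A(1) f(1,2)] A(2) by simp
    have "f \<noteq> zer U X" using u(2) f(3) hzero_ratio[OF X f(2)] by auto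
    then have "proper X (fn f e)" by (rule fn_e_proper[OF f(1)])
    then obtain v where v: "vec X v" "v\<^sup>\<dagger> \<cdot> v = idn U" "parallel X (fn v e) (fn f e)"
      using line_isometry[OF X] by metis
    have "fn v e \<in> A"
      using X.orthoclosed_parallel[OF A(1) fA _ parallel_sym[OF v(3)]] fn_closed[of v e] v(1) by simp
    then have vS: "ratio X v (idn U) \<in> carrier S" using ratio_hsub_iff[OF X A(1) v(1) nonzero_idn] A(2) by simp
    have "hform X (ratio X v (idn U)) (ratio X v (idn U)) = ratio U (idn U) (idn U)"
      by (rule hform_ratio[OF X]) (use v in simp_all)
    then show "\<exists>u\<in>carrier S. form (hspace X) u u = \<one>\<^bsub>scalars\<^esub>"
      using vS by (auto simp: hone_def)
  qed
qed

lemma has_dim_hspace: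
  assumes X: "X \<in> Obj C" shows "has_dim (hspace X) scalars (orank X)"
proof -
  interpret H: hermitian_space scalars "hspace X" by (rule hermitian_hspace[OF X])
  interpret R: orthoset_rep X "hortho X" "coord X" by (rule orthoset_rep_coord[OF X])
  show ?thesis using H.has_dim_orank R.orank_eq by simp
qed

section \<open>Isometries and the representation of the category\<close>

text \<open>Let \<open>A\<close> be the closure of the image of \<open>h\<close> and \<open>k = g - h \<cdot> h\<^sup>\<dagger> \<cdot> g\<close>. Then \<open>h\<^sup>\<dagger> \<cdot> k = 0\<close> shows that \<open>k e\<close> is
orthogonal to \<open>A\<close>. On the other hand, \<open>k e\<close> lies in \<open>A\<close>, since the component in \<open>A\<^sup>\<bottom>\<close> vanishes for both
terms of the difference. Hence \<open>k = 0\<close>.\<close>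
lemma isometry_fixes_closure:
  assumes h: "\<guillemotleft>h : X \<rightarrow> Y\<guillemotright>" "h\<^sup>\<dagger> \<cdot> h = idn X"
    and g: "vec Y g" "fn g e \<in> ocomp Y (ocomp Y (fn h ` carrier X))"
  shows "h \<cdot> h\<^sup>\<dagger> \<cdot> g = g"
proof -
  have XY: "X \<in> Obj C" "Y \<in> Obj C" using h arr_Obj[of h] by simp_all
  interpret Y: orthoset Y using XY(2) by (rule obj_orthoset)
  interpret X: orthoset X using XY(1) by (rule obj_orthoset)
  let ?I = "fn h ` carrier X"
  define A where "A = ocomp Y (ocomp Y ?I)"
  have IY: "?I \<subseteq> carrier Y" using h fn_closed[of h] by auto
  have IA: "?I \<subseteq> A" unfolding A_def by (rule Y.subset_ocomp_ocomp[OF IY])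
  have A: "orthoclosed Y A" unfolding A_def by (rule Y.orthoclosed_ocomp[OF Y.ocomp_subset])
  define k where "k = g \<boxplus> (h \<cdot> h\<^sup>\<dagger> \<cdot> g) \<cdot> minus_one"
  have k: "vec Y k" using h g by (simp add: k_def)
  have hk: "h\<^sup>\<dagger> \<cdot> k = zer U X"
  proof -
    have "h\<^sup>\<dagger> \<cdot> h \<cdot> (h\<^sup>\<dagger> \<cdot> g \<cdot> minus_one) = h\<^sup>\<dagger> \<cdot> g \<cdot> minus_one"
      using cmp_assoc[of "h\<^sup>\<dagger> \<cdot> g \<cdot> minus_one" h "h\<^sup>\<dagger>"] h g by simp
    then have "h\<^sup>\<dagger> \<cdot> k = h\<^sup>\<dagger> \<cdot> g \<boxplus> (h\<^sup>\<dagger> \<cdot> g) \<cdot> minus_one"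
      unfolding k_def using h g by (subst cmp_add) simp_all
    also have "\<dots> = zer U X" by (rule add_minus) (use h g in simp)
    finally show ?thesis .
  qed
  have "fn k e \<in> ocomp Y A"
  proof -
    have ke: "fn k e \<in> carrier Y" using k fn_closed[of k e] by simp
    have "fn (h\<^sup>\<dagger>) (fn k e) = origin X" using hk h k zer_iff[of "h\<^sup>\<dagger> \<cdot> k" X] by simp
    then have "orth Y (fn k e) (fn h x)" if "x \<in> carrier X" for x
      using adjoint'[of h x "fn k e"] that h ke X.origin_perp by simp
    then have "fn k e \<in> ocomp Y ?I" using ke by (auto simp: ocomp_def)
    then show ?thesis by (simp add: A_def Y.ocomp3[OF IY])
  qed
  moreover have "fn k e \<in> A"
  proof -
    define j where "j = emb Y (ocomp Y A)"
    have A': "orthoclosed Y (ocomp Y A)" by (rule Y.orthoclosed_ocomp[OF Y.orthoclosed_subset[OF A]])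
    have AA: "ocomp Y (ocomp Y A) = A" using A by (simp add: orthoclosed_def)
    have j: "\<guillemotleft>j : restr Y (ocomp Y A) \<rightarrow> Y\<guillemotright>" using XY A' by (simp add: j_def)
    have jz: "j\<^sup>\<dagger> \<cdot> f = zer U (restr Y (ocomp Y A))" if f: "vec Y f" "fn f e \<in> A" for f
      using emb_dag_origin[OF XY(2) A', of "fn f e"] f AA j
      by (subst zer_iff) (simp_all add: j_def)
    have gA: "fn g e \<in> A" using g by (simp add: A_def)
    have hA: "fn (h \<cdot> h\<^sup>\<dagger> \<cdot> g \<cdot> minus_one) e \<in> A"
    proof -
      have "fn (h\<^sup>\<dagger> \<cdot> g \<cdot> minus_one) e \<in> carrier X"
        using fn_closed[of "h\<^sup>\<dagger> \<cdot> g \<cdot> minus_one" e] h g by simp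
      then show ?thesis using IA h g by auto
    qed
    have "j\<^sup>\<dagger> \<cdot> k = j\<^sup>\<dagger> \<cdot> g \<boxplus> j\<^sup>\<dagger> \<cdot> h \<cdot> h\<^sup>\<dagger> \<cdot> g \<cdot> minus_one"
      unfolding k_def using h g j by (subst cmp_add) simp_all
    also have "\<dots> = zer U (restr Y (ocomp Y A))"
      using jz[OF g(1) gA] jz[OF _ hA] h g XY A' by simp
    finally have jk: "j\<^sup>\<dagger> \<cdot> k = zer U (restr Y (ocomp Y A))" .
    have "fn (j\<^sup>\<dagger>) (fn k e) = origin Y" using jk j k zer_iff[of "j\<^sup>\<dagger> \<cdot> k" "restr Y (ocomp Y A)"] by simp
    moreover have "fn k e \<in> carrier Y" using k fn_closed[of k e] by simp
    ultimately have "fn k e \<in> ocomp Y (ocomp Y A)"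
      using adjoint'[of j _ "fn k e"] j Y.origin_perp Y.ocomp_subset[of A] Y.origin_in_orthoclosed[OF A']
      by (auto simp: ocomp_def[of Y "ocomp Y A"] j_def)
    then show ?thesis by (simp add: AA)
  qed
  ultimately have "orth Y (fn k e) (fn k e)" by (simp add: ocomp_def)
  then have "fn k e = origin Y" by (rule Y.perp_self)
  then have "k = zer U Y" using zer_iff[OF k] by simp
  then show ?thesis
    using eq_if_diff_zer[of g Y "h \<cdot> h\<^sup>\<dagger> \<cdot> g"] h g by (simp add: k_def)
qed

text \<open>Fractions with numerator on the closed image of \<open>h\<close> can be written with numerator \<open>h \<cdot> f\<close>, and
\<open>h\<^sup>\<dagger> \<cdot> h = 1\<close> identifies their orthogonality with that in \<open>X\<close>.\<close>
lemma isometry_represented: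
  assumes h: "\<guillemotleft>h : X \<rightarrow> Y\<guillemotright>" "h\<^sup>\<dagger> \<cdot> h = idn X"
  defines "S \<equiv> hsub Y (ocomp Y (ocomp Y (fn h ` carrier X)))"
  shows "orthoclosed (hortho Y) S"
    and "orthoset_rep X (restr (hortho Y) S) (\<lambda>x. ratio Y (h \<cdot> vector_on X x) (idn U))"
proof -
  have XY: "X \<in> Obj C" "Y \<in> Obj C" using h arr_Obj[of h] by simp_all
  interpret Y: orthoset Y using XY(2) by (rule obj_orthoset)
  interpret X: orthoset X using XY(1) by (rule obj_orthoset)
  interpret HY: orthoset "hortho Y" by (rule hortho_orthoset[OF XY(2)])
  let ?I = "fn h ` carrier X"
  let ?f = "\<lambda>x. ratio Y (h \<cdot> vector_on X x) (idn U)"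
  have IY: "?I \<subseteq> carrier Y" using h fn_closed[of h] by auto
  have A: "orthoclosed Y (ocomp Y (ocomp Y ?I))" by (rule Y.orthoclosed_ocomp[OF Y.ocomp_subset])
  show S: "orthoclosed (hortho Y) S" unfolding S_def by (rule orthoclosed_hsub[OF XY(2) A])
  have SH: "S \<subseteq> carrier (hortho Y)" by (rule HY.orthoclosed_subset[OF S])
  interpret RS: orthoset "restr (hortho Y) S"
    by (rule HY.restr_orthoset[OF SH HY.origin_in_orthoclosed[OF S]])
  have hr: "vec Y (h \<cdot> vector_on X x)" if "x \<in> carrier X" for x using vector_on(1)[OF XY(1) that] h by simp
  have fS: "?f x \<in> S" if x: "x \<in> carrier X" for x
  proof -
    have "fn (vector_on X x) e \<in> carrier X" using vector_on(1)[OF XY(1) x] fn_closed[of "vector_on X x" e] by simp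
    then have "fn (h \<cdot> vector_on X x) e \<in> ?I" using vector_on(1)[OF XY(1) x] by simp
    then have "fn (h \<cdot> vector_on X x) e \<in> ocomp Y (ocomp Y ?I)" using Y.subset_ocomp_ocomp[OF IY] by blast
    then show ?thesis unfolding S_def using ratio_hsub_iff[OF XY(2) A hr[OF x] nonzero_idn] by blast
  qed
  show "orthoset_rep X (restr (hortho Y) S) ?f"
  proof
    fix x assume x: "x \<in> carrier X"
    show "?f x \<in> carrier (restr (hortho Y) S)" using fS[OF x] by simp
    fix y assume y: "y \<in> carrier X"
    note rx = vector_on[OF XY(1) x] and ry = vector_on[OF XY(1) y]
    have cx: "fn (vector_on X x) e \<in> carrier X" and cy: "fn (vector_on X y) e \<in> carrier X"
      using rx(1) ry(1) fn_closed[of "vector_on X x" e] fn_closed[of "vector_on X y" e] by simp_all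
    have "orth (restr (hortho Y) S) (?f x) (?f y) \<longleftrightarrow> orth (hortho Y) (?f x) (?f y)"
      using fS[OF x] fS[OF y] by simp
    also have "\<dots> \<longleftrightarrow> orth Y (fn (h \<cdot> vector_on X x) e) (fn (h \<cdot> vector_on X y) e)"
      by (rule orth_ratio_iff[OF XY(2) hr[OF x] nonzero_idn hr[OF y] nonzero_idn])
    also have "\<dots> \<longleftrightarrow> orth Y (fn h (fn (vector_on X x) e)) (fn h (fn (vector_on X y) e))"
      using rx(1) ry(1) by simp
    also have "\<dots> \<longleftrightarrow> orth X (fn (vector_on X x) e) (fn (h\<^sup>\<dagger> \<cdot> h) (fn (vector_on X y) e))"
      using adjoint[of h "fn (vector_on X x) e" "fn h (fn (vector_on X y) e)"] h(1) cx cy fn_closed[of h "fn (vector_on X y) e"]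
      by simp
    also have "\<dots> \<longleftrightarrow> orth X (fn (vector_on X x) e) (fn (vector_on X y) e)" using h(2) cy by simp
    also have "\<dots> \<longleftrightarrow> orth X x y" using X.parallel_perp'[OF rx(2)] X.parallel_perp[OF ry(2)] by blast
    finally show "orth (restr (hortho Y) S) (?f x) (?f y) \<longleftrightarrow> orth X x y" .
  next
    fix y assume "y \<in> carrier (restr (hortho Y) S)"
    then have yS: "y \<in> S" by simp
    then obtain g c where g: "vec Y g" "nonzero c" "fn g e \<in> ocomp Y (ocomp Y ?I)" "y = ratio Y g c"
      unfolding S_def hsub_def by blast
    have fix_g: "h \<cdot> h\<^sup>\<dagger> \<cdot> g = g" by (rule isometry_fixes_closure[OF h g(1,3)])
    define x where "x = fn (h\<^sup>\<dagger> \<cdot> g) e"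
    have x: "x \<in> carrier X" using fn_closed[of "h\<^sup>\<dagger> \<cdot> g" e] h(1) g(1) by (simp add: x_def)
    note r = vector_on[OF XY(1) x]
    have hx: "fn h x = fn g e"
      using arg_cong[OF fix_g, of "\<lambda>k. fn k e"] h(1) g(1) by (simp add: x_def)
    have "parallel Y (fn h (fn (vector_on X x) e)) (fn h x)"
      using fn_parallel[of h "fn (vector_on X x) e" x] h(1) r x fn_closed[of "vector_on X x" e] by simp
    then have "parallel Y (fn (h \<cdot> vector_on X x) e) (fn g e)" using hx r(1) by simp
    then have "parallel (hortho Y) (?f x) y"
      unfolding g(4) by (rule ratio_parallel[OF XY(2) hr[OF x] nonzero_idn g(1,2)])
    then have "parallel (restr (hortho Y) S) (?f x) y"
      using fS[OF x] yS SH HY.ocomp_restr[of "{?f x}" S] HY.ocomp_restr[of "{y}" S]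
      by (simp add: parallel_def)
    then show "\<exists>x\<in>carrier X. parallel (restr (hortho Y) S) (?f x) y" using x by blast
  qed
qed

text \<open>Both composites send the class of \<open>x\<close> to the class of a fraction with denominator 1 whose numerator
takes at \<open>e\<close> a value parallel to \<open>h x\<close>.\<close>
lemma isometry_realised:
  assumes X: "X \<in> Obj C" and Y: "Y \<in> Obj C" and iso: "isometry C X Y h"
  shows "\<exists>(F :: 'a star_ring) (H1 :: ('a, 'a) form_space) (H2 :: ('a, 'a) form_space) r1 r2.
    uniform_orthomodular_space F H1 \<and> uniform_orthomodular_space F H2 \<and>
    is_subspace H1 H2 F \<and>
    orthoisomorphism (proj_orthoset X) (proj_orthoset (orthoset_of H1 F)) r1 \<and>
    orthoisomorphism (proj_orthoset Y) (proj_orthoset (orthoset_of H2 F)) r2 \<and>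
    (\<forall>c\<in>carrier (proj_orthoset X).
      r2 (proj_map X Y h c) =
      proj_map (orthoset_of H1 F) (orthoset_of H2 F) (incl (carrier H1)) (r1 c))"
proof -
  define k where "k = Arrow X Y h"
  have k: "\<guillemotleft>k : X \<rightarrow> Y\<guillemotright>" "k\<^sup>\<dagger> \<cdot> k = idn X" using iso isometry_arr[OF X Y] by (simp_all add: k_def)
  have fnk: "fn k = h" by (simp add: k_def)
  interpret Y: orthoset Y using Y by (rule obj_orthoset)
  define S where "S = hsub Y (ocomp Y (ocomp Y (fn k ` carrier X)))"
  note rep = isometry_represented[OF k, folded S_def]
  interpret H: uniform_orthomodular_space scalars "hspace Y" by (rule uniform_hspace[OF Y])
  interpret HY: orthoset "hortho Y" by (rule hortho_orthoset[OF Y])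
  let ?H1 = "hspace Y\<lparr>carrier := S\<rparr>"
  have SH: "S \<subseteq> carrier (hspace Y)" using HY.orthoclosed_subset[OF rep(1)] by simp
  have O1: "orthoset_of ?H1 scalars = restr (hortho Y) S" by (rule H.orthoset_of_restr[OF SH])
  let ?f = "\<lambda>x. ratio Y (k \<cdot> vector_on X x) (idn U)"
  interpret R1: orthoset_rep X "restr (hortho Y) S" ?f by (rule rep(2))
  interpret R2: orthoset_rep Y "hortho Y" "coord Y" by (rule orthoset_rep_coord[OF Y])
  have "proj_map Y (hortho Y) (coord Y) (proj_map X Y h c) =
      proj_map (restr (hortho Y) S) (hortho Y) (incl S) (proj_map X (restr (hortho Y) S) ?f c)"
    if c: "c \<in> carrier (proj_orthoset X)" for c
  proof -
    obtain x where x: "x \<in> carrier X" "c = pclass X x" using c unfolding proj_orthoset_carrier by blast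
    have hx: "h x \<in> carrier Y" using fn_closed[of k x] k x fnk by simp
    have fS: "?f x \<in> S" using R1.map_closed[OF x(1)] by simp
    have "proj_map X Y h c = pclass Y (h x)"
      unfolding x(2) by (rule proj_map_pclass) (use k x fnk fn_closed[of k] fn_parallel[of k] in auto)
    then have lhs: "proj_map Y (hortho Y) (coord Y) (proj_map X Y h c) = pclass (hortho Y) (coord Y (h x))"
      using R2.proj_map_rep[OF hx] by simp
    have "proj_map (restr (hortho Y) S) (hortho Y) (incl S) (pclass (restr (hortho Y) S) (?f x))
        = pclass (hortho Y) (incl S (?f x))"
    proof (rule proj_map_pclass)
      fix u v assume uv: "u \<in> carrier (restr (hortho Y) S)" "v \<in> carrier (restr (hortho Y) S)"
        and p: "parallel (restr (hortho Y) S) u v"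
      then show "parallel (hortho Y) (incl S u) (incl S v)"
        using H.parallel_subspace[OF rep(1) _ _ p] by (simp add: incl_def)
    qed (use fS SH in \<open>auto simp: incl_def\<close>)
    then have rhs: "proj_map (restr (hortho Y) S) (hortho Y) (incl S) (proj_map X (restr (hortho Y) S) ?f c)
        = pclass (hortho Y) (?f x)"
      using R1.proj_map_rep[OF x(1)] x(2) fS by (simp add: incl_def)
    have r: "vec X (vector_on X x)" "parallel X (fn (vector_on X x) e) x" by (rule vector_on[OF X x(1)])+
    have r': "vec Y (vector_on Y (h x))" "parallel Y (fn (vector_on Y (h x)) e) (h x)" by (rule vector_on[OF Y hx])+
    have "parallel Y (fn (k \<cdot> vector_on X x) e) (h x)"
      using fn_parallel[of k "fn (vector_on X x) e" x] k(1) r x fn_closed[of "vector_on X x" e] fnk by simp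
    then have "parallel Y (fn (vector_on Y (h x)) e) (fn (k \<cdot> vector_on X x) e)"
      using r'(2) by (simp add: parallel_def)
    then have par: "parallel (hortho Y) (coord Y (h x)) (?f x)"
      unfolding coord_def
      by (rule ratio_parallel[OF Y r'(1) nonzero_idn _ nonzero_idn, rotated]) (use k(1) r(1) in simp)
    have "?f x \<in> carrier (hortho Y)" using fS SH by auto
    from pclass_eq_iff[OF this] par show ?thesis unfolding lhs rhs by (rule iffD2)
  qed
  moreover have "is_subspace ?H1 (hspace Y) scalars" using rep(1) by (simp add: is_subspace_def)
  ultimately show ?thesis
    using H.uniform_subspace[OF rep(1)] H.uniform_orthomodular_space_axioms
      R1.orthoisomorphism_rep R2.orthoisomorphism_rep
    by (intro exI[of _ scalars] exI[of _ ?H1] exI[of _ "hspace Y"]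
        exI[of _ "proj_map X (restr (hortho Y) S) ?f"] exI[of _ "proj_map Y (hortho Y) (coord Y)"])
      (simp add: O1)
qed

lemma object_realised:
  assumes X: "X \<in> Obj C"
  shows "\<exists>(F :: 'a star_ring) (H :: ('a, 'a) form_space) r.
    uniform_orthomodular_space F H \<and> has_dim H F (orank X) \<and>
    orthoisomorphism (proj_orthoset X) (proj_orthoset (orthoset_of H F)) r"
proof -
  interpret R: orthoset_rep X "hortho X" "coord X" by (rule orthoset_rep_coord[OF X])
  show ?thesis using uniform_hspace[OF X] has_dim_hspace[OF X] R.orthoisomorphism_rep by blast
qed

end

theorem theorem7p18:
  fixes C :: "'a orthocat"
  assumes cat: "dagger_orthocat C"
    and nonzero: "\<exists>X\<in>Obj C. orank X \<noteq> 0"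
    and H1: "has_dagger_biproducts C"
    and H2: "\<And>X A. \<lbrakk>X \<in> Obj C; orthoclosed X A\<rbrakk> \<Longrightarrow>
      restr X A \<in> Obj C \<and> restr X (ocomp X A) \<in> Obj C \<and>
      incl A \<in> Hom C (restr X A) X \<and> incl (ocomp X A) \<in> Hom C (restr X (ocomp X A)) X \<and>
      dagger_biproduct C (restr X A) (restr X (ocomp X A)) X (incl A) (incl (ocomp X A))"
    and H3a: "\<And>X. \<lbrakk>X \<in> Obj C; unital X\<rbrakk> \<Longrightarrow> dagger_simple C X"
    and H3b: "\<And>X Y. \<lbrakk>X \<in> Obj C; Y \<in> Obj C; unital X; unital Y\<rbrakk> \<Longrightarrow> \<exists>f. dagger_iso C X Y f"
  shows "(\<forall>X\<in>Obj C. \<exists>(F :: 'a star_ring) (H :: ('a, 'a) form_space) r.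
            uniform_orthomodular_space F H \<and> has_dim H F (orank X) \<and>
            orthoisomorphism (proj_orthoset X) (proj_orthoset (orthoset_of H F)) r)
      \<and> (\<forall>X1\<in>Obj C. \<forall>X2\<in>Obj C. \<forall>h. isometry C X1 X2 h \<longrightarrow>
          (\<exists>(F :: 'a star_ring) (H1 :: ('a, 'a) form_space) (H2 :: ('a, 'a) form_space) r1 r2.
            uniform_orthomodular_space F H1 \<and> uniform_orthomodular_space F H2 \<and>
            is_subspace H1 H2 F \<and>
            orthoisomorphism (proj_orthoset X1) (proj_orthoset (orthoset_of H1 F)) r1 \<and>
            orthoisomorphism (proj_orthoset X2) (proj_orthoset (orthoset_of H2 F)) r2 \<and>
            (\<forall>c\<in>carrier (proj_orthoset X1).
              r2 (proj_map X1 X2 h c) =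
              proj_map (orthoset_of H1 F) (orthoset_of H2 F) (incl (carrier H1)) (r1 c))))"
proof -
  interpret dagger_orthocat C by (rule cat)
  interpret splitting_orthocat C using H1 H2 by unfold_locales auto
  obtain X where X: "X \<in> Obj C" "orank X \<noteq> 0" using nonzero by blast
  interpret X: orthoset X by (rule obj_orthoset[OF X(1)])
  \<comment> \<open>Without proper elements the empty set is the only orthogonal set.\<close>
  obtain x where x: "proper X x"
  proof (rule ccontr)
    assume "\<not> thesis"
    then have "\<not> proper X x" for x using that by blast
    then have "ecard D \<le> 0" if "orthogonal_set X D" for D
      using that unfolding orthogonal_set_def by (cases "D = {}") (auto simp: ecard_def zero_enat_def)
    then have "orank X \<le> 0" unfolding orank_def by (intro SUP_least) blast
    then show False using X(2) by simp
  qed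
  have xX: "{x} \<subseteq> carrier X" using x by (simp add: proper_def)
  let ?A = "ocomp X (ocomp X {x})"
  have A: "orthoclosed X ?A" by (rule X.orthoclosed_ocomp[OF X.ocomp_subset])
  have "x \<in> ?A" using X.subset_ocomp_ocomp[OF xX] by simp
  then interpret unit_orthocat C "restr X ?A" x
    using restr_Obj[OF X(1) A] X.unital_restr[OF x] x H3a H3b
    by unfold_locales (auto simp: proper_def)
  show ?thesis using object_realised isometry_realised by blast
qed

end
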